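(* Let $0<H<1$ and let $(\gamma_n)_{n\ge 1}$ be a sequence of constants with $0<\gamma_n\le 1$ such that $$\infty>-\frac{\log\gamma_n}{\log n}\longrightarrow \eta\quad\text{as } n\to\infty$$ for some $0\le\eta<1/(2H)$. Then for any $0<\rho<1/2$ and any $T>1$, almost surely as $n\to\infty$, $$\sup_{(t,\alpha)\in[\gamma_n,T]\times[\rho,1-\rho]}\left|v_n(t,\tau_\alpha(t))+f(t,\tau_\alpha(t))\,u_n(t,\alpha)\right| = O\left(n^{-1/4}\gamma_n^{-H/2}(\log\log n)^{1/4}(\log n)^{1/2}\right).$$
   Context: Let $0<H<1$ and let $B, B_1,B_2,\dots$ be i.i.d. sample continuous fractional Brownian motions on $[0,\infty)$ with Hurst index $H$, i.e. continuous centered Gaussian processes with $E(B(s)B(t))=\frac12(|s|^{2H}+|t|^{2H}-|s-t|^{2H})$. Versions are chosen so that for every trajectory and every $0<T<\infty$, $\sup_{0\le s\le t\le T}|B(t)-B(s)|/f_H(t-s)<\infty$, where $f_H(u)=u^H\sqrt{1\vee\log u^{-1}}$ (and likewise for each $B_j$). For $t>0$, $x\in\mathbb{R}$: $F(t,x)=P\{B(t)\le x\}=\Phi(x/t^H)$, with $\Phi$ the standard normal distribution function; $f(t,x)=\frac{1}{t^H\sqrt{2\pi}}\exp\left(-\frac{x^2}{2t^{2H}}\right)$ is the density of $F(t,\cdot)$; $F_n(t,x)=n^{-1}\sum_{j=1}^n 1\{B_j(t)\le x\}$; $v_n(t,x)=\sqrt n\,\{F_n(t,x)-F(t,x)\}$.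 For $t>0$, $\alpha\in(0,1)$: $\tau_\alpha(t)=\inf\{x:F(t,x)\ge\alpha\}=t^H z_\alpha$, where $\Phi(z_\alpha)=\alpha$; $\tau^n_\alpha(t)=\inf\{x:F_n(t,x)\ge\alpha\}$; $u_n(t,\alpha)=\sqrt n\,(\tau^n_\alpha(t)-\tau_\alpha(t))$. *)

theory Defs
  imports "HOL-Probability.Probability" "HOL-Library.Landau_Symbols"
begin

text \<open>A stochastic process is a family \<open>X :: real \<Rightarrow> 'a \<Rightarrow> real\<close> of real random variables on the
  probability space \<open>M\<close>; only its values at times \<open>t \<ge> 0\<close> are ever used.\<close>

(* Constants count as Gaussian, so that degenerate linear combinations are allowed below. *)
definition gaussian_rv :: "'a measure \<Rightarrow> ('a \<Rightarrow> real) \<Rightarrow> bool" where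
  "gaussian_rv M X \<longleftrightarrow> X \<in> borel_measurable M \<and>
     ((\<exists>\<mu>. AE \<omega> in M. X \<omega> = \<mu>) \<or>
      (\<exists>\<mu> \<sigma>. \<sigma> > 0 \<and> distributed M lborel X (\<lambda>x. ennreal (normal_density \<mu> \<sigma> x))))"

definition gaussian_process :: "'a measure \<Rightarrow> real set \<Rightarrow> (real \<Rightarrow> 'a \<Rightarrow> real) \<Rightarrow> bool" where
  "gaussian_process M I X \<longleftrightarrow>
     (\<forall>S c. finite S \<longrightarrow> S \<subseteq> I \<longrightarrow> gaussian_rv M (\<lambda>\<omega>. \<Sum>t\<in>S. c t * X t \<omega>))"

definition sample_continuous_fbm :: "'a measure \<Rightarrow> real \<Rightarrow> (real \<Rightarrow> 'a \<Rightarrow> real) \<Rightarrow> bool" where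
  "sample_continuous_fbm M H X \<longleftrightarrow>
     gaussian_process M {0..} X \<and>
     (\<forall>t\<ge>0. (\<integral>\<omega>. X t \<omega> \<partial>M) = 0) \<and>
     (\<forall>s\<ge>0. \<forall>t\<ge>0. (\<integral>\<omega>. X s \<omega> * X t \<omega> \<partial>M) =
        (\<bar>s\<bar> powr (2 * H) + \<bar>t\<bar> powr (2 * H) - \<bar>s - t\<bar> powr (2 * H)) / 2) \<and>
     (\<forall>\<omega>\<in>space M. continuous_on {0..} (\<lambda>t. X t \<omega>))"

definition f_mod :: "real \<Rightarrow> real \<Rightarrow> real" where
  "f_mod H u = u powr H * sqrt (max 1 (ln (1 / u)))"

(* For s = t the quotient is 0 / 0 = 0, so the diagonal does not affect the supremum. *)
definition modulus_regular :: "'a measure \<Rightarrow> real \<Rightarrow> (real \<Rightarrow> 'a \<Rightarrow> real) \<Rightarrow> bool" where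
  "modulus_regular M H X \<longleftrightarrow>
     (\<forall>\<omega>\<in>space M. \<forall>T>0.
        bdd_above {\<bar>X t \<omega> - X s \<omega>\<bar> / f_mod H (t - s) | s t. 0 \<le> s \<and> s \<le> t \<and> t \<le> T})"

text \<open>Independence and equality of laws are those of the whole paths, regarded as random elements
  of the product space of functions on the half-line \<open>{0..}\<close>.\<close>

definition path_space :: "(real \<Rightarrow> real) measure" where
  "path_space = PiM {0..} (\<lambda>_. borel)"

definition path_of :: "(real \<Rightarrow> 'a \<Rightarrow> real) \<Rightarrow> 'a \<Rightarrow> real \<Rightarrow> real" where
  "path_of X \<omega> = (\<lambda>t\<in>{0..}. X t \<omega>)"

definition iid_processes :: "'a measure \<Rightarrow> (nat \<Rightarrow> real \<Rightarrow> 'a \<Rightarrow> real) \<Rightarrow> bool" where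
  "iid_processes M B \<longleftrightarrow>
     prob_space.indep_vars M (\<lambda>_. path_space) (\<lambda>j. path_of (B j)) UNIV \<and>
     (\<forall>i j. distr M path_space (path_of (B i)) = distr M path_space (path_of (B j)))"

text \<open>In the following, \<open>B 0\<close> is the generic process, and \<open>B 1, B 2, \<dots>\<close> is the sample.\<close>

definition F :: "'a measure \<Rightarrow> (nat \<Rightarrow> real \<Rightarrow> 'a \<Rightarrow> real) \<Rightarrow> real \<Rightarrow> real \<Rightarrow> real" where
  "F M B t x = measure M {\<omega>\<in>space M. B 0 t \<omega> \<le> x}"

definition F_emp :: "(nat \<Rightarrow> real \<Rightarrow> 'a \<Rightarrow> real) \<Rightarrow> nat \<Rightarrow> 'a \<Rightarrow> real \<Rightarrow> real \<Rightarrow> real" where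
  "F_emp B n \<omega> t x = (\<Sum>j=1..n. indicator {y. y \<le> x} (B j t \<omega>)) / real n"

definition v :: "'a measure \<Rightarrow> (nat \<Rightarrow> real \<Rightarrow> 'a \<Rightarrow> real) \<Rightarrow> nat \<Rightarrow> 'a \<Rightarrow> real \<Rightarrow> real \<Rightarrow> real" where
  "v M B n \<omega> t x = sqrt (real n) * (F_emp B n \<omega> t x - F M B t x)"

(* The density of F(t, .): standard deviation t^H, for t > 0. *)
definition f_dens :: "real \<Rightarrow> real \<Rightarrow> real \<Rightarrow> real" where
  "f_dens H t x = normal_density 0 (t powr H) x"

definition quantile :: "(real \<Rightarrow> real) \<Rightarrow> real \<Rightarrow> real" where
  "quantile G \<alpha> = Inf {x. G x \<ge> \<alpha>}"

definition \<tau> :: "'a measure \<Rightarrow> (nat \<Rightarrow> real \<Rightarrow> 'a \<Rightarrow> real) \<Rightarrow> real \<Rightarrow> real \<Rightarrow> real" where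
  "\<tau> M B \<alpha> t = quantile (F M B t) \<alpha>"

definition \<tau>_emp :: "(nat \<Rightarrow> real \<Rightarrow> 'a \<Rightarrow> real) \<Rightarrow> nat \<Rightarrow> 'a \<Rightarrow> real \<Rightarrow> real \<Rightarrow> real" where
  "\<tau>_emp B n \<omega> \<alpha> t = quantile (F_emp B n \<omega> t) \<alpha>"

definition u :: "'a measure \<Rightarrow> (nat \<Rightarrow> real \<Rightarrow> 'a \<Rightarrow> real) \<Rightarrow> nat \<Rightarrow> 'a \<Rightarrow> real \<Rightarrow> real \<Rightarrow> real" where
  "u M B n \<omega> t \<alpha> = sqrt (real n) * (\<tau>_emp B n \<omega> \<alpha> t - \<tau> M B \<alpha> t)"

definition bahadur_kiefer ::
  "'a measure \<Rightarrow> real \<Rightarrow> (nat \<Rightarrow> real \<Rightarrow> 'a \<Rightarrow> real) \<Rightarrow> nat \<Rightarrow> 'a \<Rightarrow> real \<Rightarrow> real \<Rightarrow> real" where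
  "bahadur_kiefer M H B n \<omega> t \<alpha> =
     v M B n \<omega> t (\<tau> M B \<alpha> t) + f_dens H t (\<tau> M B \<alpha> t) * u M B n \<omega> t \<alpha>"

end

theory Submission
  imports Defs "HOL-Real_Asymp.Real_Asymp"
begin

text \<open>
  At a fixed time the Bahadur-Kiefer phenomenon is elementary. Write \<open>Y\<close> for \<open>B(t) / t\<^sup>H\<close>, a
  standard normal variable, \<open>S\<^sub>n(t,z)\<close> for the centred number of sample paths with \<open>Y\<^sub>j \<le> z\<close>
  (called \<open>dev\<close> below), \<open>\<alpha> = \<Phi>(z)\<close>, and \<open>q\<close> for the empirical \<open>\<alpha>\<close>-quantile of the \<open>Y\<^sub>j\<close>. Since the
  empirical distribution function takes a value close to \<open>\<alpha>\<close> at \<open>q\<close>, a Taylor expansion of \<open>\<Phi>\<close> gives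
    \<open>S\<^sub>n(t,z) + n \<phi>(z) (q - z) = S\<^sub>n(t,z) - S\<^sub>n(t,q) + O(n (q - z)\<^sup>2 + 1)\<close>,
  and the left-hand side is \<open>\<surd>n\<close> times the Bahadur-Kiefer process. So two uniform facts are needed:
  the size of \<open>S\<^sub>n\<close>, which bounds \<open>\<bar>q - z\<bar>\<close>, and the oscillation of \<open>S\<^sub>n\<close> in \<open>z\<close> at that distance.
  The deterministic reduction is \<open>bahadur_kiefer_bound\<close>; the two facts are \<open>dev_bounds\<close>.

  Size. The rate has the factor \<open>(log log n)\<^sup>1\<^sup>/\<^sup>4\<close> only if \<open>S\<^sub>n\<close> obeys a law of the iterated logarithm
  uniformly in \<open>(t,z)\<close>. It does after multiplication by \<open>t\<close> to the power \<open>H/4\<close>: with this weight the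
  summands are mean-square Hoelder continuous in \<open>(t,z)\<close> down to \<open>t = 0\<close>, because the blow-up of
  the relative time increment is absorbed by the weight (\<open>wdev_increment_second_moment\<close>). A chaining
  along dyadic grids, with an exponential bound for the maximum over \<open>n \<le> 2\<^sup>m\<close> on every link, gives
  \<open>weighted_iterated_log_on_grid\<close>. The weight costs a factor \<open>\<gamma>\<^sub>n\<close> to the power \<open>-H/4\<close> in \<open>\<bar>q - z\<bar>\<close>.
  Its square root, which enters the oscillation of \<open>S\<^sub>n\<close>, and its square, which enters the Taylor
  remainder, are both at most \<open>\<gamma>\<^sub>n\<close> to the power \<open>-H/2\<close>.

  Oscillation. Here a logarithm may be lost, so a union bound over all pairs of grid points, of which
  there are only polynomially many in \<open>n\<close>, suffices (\<open>dev_oscillation_on_grid\<close>). Each pair is given a bound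
  proportional to its own standard deviation, so that the distance at which the oscillation is
  evaluated, and hence \<open>\<gamma>\<^sub>n\<close>, need not be known in advance.

  Passage from grid points to all \<open>(t,z)\<close>. Almost surely, all of the first \<open>2\<^sup>k\<close> paths oscillate by
  at most a constant times \<open>2\<close> to the power \<open>-kH/2\<close> on dyadic intervals of length \<open>2\<close> to the power \<open>-k\<close>
  (\<open>dyadic_oscillation_small\<close>). On a grid that is polynomially fine in \<open>n\<close> this is less than the
  admissible error in \<open>z\<close>, and monotonicity of indicators in \<open>z\<close> sandwiches \<open>S\<^sub>n(t,z)\<close> between grid
  values (\<open>dev_between_grid_values\<close>).
\<close>

section \<open>The standard normal distribution function\<close>

definition Phi :: "real \<Rightarrow> real" where
  "Phi z = measure (density lborel std_normal_density) {..z}"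

lemma continuous_on_std_normal_density: "continuous_on A std_normal_density"
  unfolding std_normal_density_def by (intro continuous_intros) auto

lemma std_normal_density_le_1: "std_normal_density x \<le> 1"
proof -
  have "sqrt (2 * pi) \<ge> 1" using pi_ge_two by simp
  moreover have "exp (- x\<^sup>2 / 2) \<le> 1" by simp
  ultimately have "exp (- x\<^sup>2 / 2) \<le> sqrt (2 * pi)" by linarith
  thus ?thesis unfolding std_normal_density_def using \<open>sqrt (2 * pi) \<ge> 1\<close>
    by (simp add: divide_le_eq)
qed

lemma std_normal_density_Lipschitz: "\<bar>std_normal_density x - std_normal_density y\<bar> \<le> \<bar>x - y\<bar>"
proof -
  have der: "(std_normal_density has_real_derivative - t * std_normal_density t) (at t within UNIV)" for t
    unfolding std_normal_density_def
    by (rule derivative_eq_intros refl | simp add: field_simps)+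
  have bd: "norm (- t * std_normal_density t) \<le> 1" for t
  proof -
    have "\<bar>t\<bar> \<le> exp (t\<^sup>2 / 2)"
    proof -
      have "1 + t\<^sup>2 / 2 \<le> exp (t\<^sup>2 / 2)" by (rule exp_ge_add_one_self)
      moreover have "\<bar>t\<bar> \<le> 1 + t\<^sup>2 / 2" using sum_power2_ge_zero[of "\<bar>t\<bar> - 1" 0]
        by (simp add: power2_eq_square algebra_simps abs_mult_self_eq)
      ultimately show ?thesis by linarith
    qed
    hence "\<bar>t\<bar> * exp (- t\<^sup>2 / 2) \<le> 1"
      by (simp add: exp_minus divide_simps)
    moreover have "sqrt (2 * pi) \<ge> 1" using pi_ge_two by simp
    ultimately have "\<bar>t\<bar> * exp (- t\<^sup>2 / 2) \<le> sqrt (2 * pi)" by linarith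
    thus ?thesis unfolding std_normal_density_def
      by (simp add: abs_mult divide_le_eq)
  qed
  show ?thesis
    using field_differentiable_bound[of UNIV std_normal_density "\<lambda>t. - t * std_normal_density t" 1 x y]
      der bd by (simp add: abs_minus_commute)
qed

lemma Phi_diff:
  assumes "a \<le> b"
  shows "Phi b - Phi a = integral {a..b} std_normal_density"
proof -
  interpret N: prob_space "density lborel std_normal_density"
    by (rule prob_space_normal_density) simp
  have "Phi b - Phi a = measure (density lborel std_normal_density) ({..b} - {..a})"
    unfolding Phi_def using assms by (subst N.finite_measure_Diff) auto
  also have "{..b} - {..a} = {a<..b}" by auto
  also have "measure (density lborel std_normal_density) {a<..b}
      = (LINT x:{a<..b}|lborel. std_normal_density x)"
  proof -
    have int: "integrable lborel (\<lambda>x. indicator {a<..b} x * std_normal_density x)"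
      using integrable_mult_indicator[of "{a<..b}" lborel std_normal_density] by simp
    have "emeasure (density lborel std_normal_density) {a<..b}
      = (\<integral>\<^sup>+x. ennreal (indicator {a<..b} x * std_normal_density x) \<partial>lborel)"
      by (subst emeasure_density)
        (auto intro!: nn_integral_cong simp: indicator_def)
    also have "\<dots> = ennreal (LINT x|lborel. indicator {a<..b} x * std_normal_density x)"
      by (rule nn_integral_eq_integral[OF int]) (auto simp: indicator_def)
    finally show ?thesis unfolding set_lebesgue_integral_def measure_def
      by (auto simp: integral_nonneg_AE indicator_def intro!: enn2real_ennreal integral_nonneg_AE)
  qed
  also have "\<dots> = integral {a<..b} std_normal_density"
    by (rule set_borel_integral_eq_integral)
      (use integrable_mult_indicator[of "{a<..b}" lborel std_normal_density] in \<open>simp add: set_integrable_def\<close>)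
  also have "\<dots> = integral {a..b} std_normal_density"
  proof (rule integral_subset_negligible)
    have "{a..b} - {a<..b} \<subseteq> {a}" by auto
    thus "negligible ({a..b} - {a<..b})" by (rule negligible_subset[rotated]) simp
  qed auto
  finally show ?thesis .
qed

lemma Phi_mono: "a \<le> b \<Longrightarrow> Phi a \<le> Phi b"
  and Phi_Lipschitz_le: "a \<le> b \<Longrightarrow> Phi b - Phi a \<le> b - a"
proof -
  assume ab: "a \<le> b"
  have I: "std_normal_density integrable_on {a..b}"
    by (rule integrable_continuous_interval continuous_on_std_normal_density)+
  show "Phi a \<le> Phi b" using integral_nonneg[OF I] Phi_diff[OF ab] by auto
  have "integral {a..b} std_normal_density \<le> integral {a..b} (\<lambda>x. 1)"
    by (rule integral_le[OF I]) (auto simp: std_normal_density_le_1)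
  thus "Phi b - Phi a \<le> b - a" using Phi_diff[OF ab] ab by simp
qed

lemma Phi_bounds: "0 \<le> Phi z" "Phi z \<le> 1"
proof -
  interpret N: prob_space "density lborel std_normal_density"
    by (rule prob_space_normal_density) simp
  show "0 \<le> Phi z" "Phi z \<le> 1" unfolding Phi_def by auto
qed

lemma Phi_deriv: "(Phi has_real_derivative std_normal_density x) (at x)"
proof -
  let ?I = "{x - 1..x + 1}"
  have "((\<lambda>u. integral {x-1..u} std_normal_density) has_real_derivative std_normal_density x) (at x within ?I)"
    by (rule integral_has_real_derivative) (auto intro: continuous_on_std_normal_density)
  hence D: "((\<lambda>u. Phi (x-1) + integral {x-1..u} std_normal_density) has_real_derivative std_normal_density x) (at x within ?I)"
    by (auto intro!: derivative_eq_intros)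
  have E: "Phi (x-1) + integral {x-1..u} std_normal_density = Phi u" if "u \<in> ?I" for u
    using Phi_diff[of "x-1" u] that by auto
  have "(Phi has_real_derivative std_normal_density x) (at x within ?I)"
    by (rule has_field_derivative_transform_within[OF D, where d=1]) (simp, simp, rule E, simp)
  thus ?thesis by (simp add: at_within_Icc_at)
qed

lemma Phi_Taylor: "\<bar>Phi b - Phi a - std_normal_density a * (b - a)\<bar> \<le> (b - a)\<^sup>2"
proof -
  have "\<exists>c. \<bar>c - a\<bar> \<le> \<bar>b - a\<bar> \<and> Phi b - Phi a = (b - a) * std_normal_density c"
  proof (cases a b rule: linorder_cases)
    case less
    from MVT2[OF less, of Phi std_normal_density] Phi_deriv
    obtain c where "a < c" "c < b" "Phi b - Phi a = (b - a) * std_normal_density c" by auto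
    thus ?thesis by (intro exI[of _ c]) auto
  next
    case greater
    from MVT2[OF greater, of Phi std_normal_density] Phi_deriv
    obtain c where "b < c" "c < a" "Phi a - Phi b = (a - b) * std_normal_density c" by auto
    thus ?thesis by (intro exI[of _ c]) (auto simp: algebra_simps)
  qed auto
  then obtain c where c: "\<bar>c - a\<bar> \<le> \<bar>b - a\<bar>" "Phi b - Phi a = (b - a) * std_normal_density c" by auto
  have "\<bar>Phi b - Phi a - std_normal_density a * (b - a)\<bar> = \<bar>b - a\<bar> * \<bar>std_normal_density c - std_normal_density a\<bar>"
    unfolding c by (simp add: abs_mult[symmetric] algebra_simps)
  also have "\<dots> \<le> \<bar>b - a\<bar> * \<bar>b - a\<bar>"
    using std_normal_density_Lipschitz[of c a] c(1) by (intro mult_left_mono) auto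
  finally show ?thesis by (simp add: power2_eq_square)
qed

lemma Phi_increase_lower:
  assumes "a \<le> b" "\<bar>a\<bar> \<le> Z" "\<bar>b\<bar> \<le> Z"
  shows "std_normal_density Z * (b - a) \<le> Phi b - Phi a"
proof (cases "a = b")
  case False
  hence "a < b" using assms by simp
  from MVT2[OF this, of Phi std_normal_density] Phi_deriv
  obtain c where c: "a < c" "c < b" "Phi b - Phi a = (b - a) * std_normal_density c" by auto
  have "c\<^sup>2 \<le> Z\<^sup>2" using c assms by (intro abs_le_square_iff[THEN iffD1]) auto
  hence "std_normal_density Z \<le> std_normal_density c" unfolding std_normal_density_def
    by (intro mult_left_mono) auto
  thus ?thesis using c \<open>a < b\<close> by (simp add: mult.commute mult_left_mono)
qed simp

lemma Phi_quantile_exists: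
  assumes "0 < r" "r < 1/2"
  obtains Z where "0 < Z" "\<And>\<alpha>. r \<le> \<alpha> \<Longrightarrow> \<alpha> \<le> 1 - r \<Longrightarrow> \<exists>z. \<bar>z\<bar> \<le> Z \<and> Phi z = \<alpha>"
proof -
  interpret N: prob_space "density lborel std_normal_density"
    by (rule prob_space_normal_density) simp
  interpret N: real_distribution "density lborel std_normal_density"
    by standard auto
  have Phi: "Phi = cdf (density lborel std_normal_density)" by (auto simp: Phi_def cdf_def)
  have "\<forall>\<^sub>F x in at_top. Phi x > 1 - r"
    using order_tendstoD(1)[OF N.cdf_lim_at_top_prob, of "1 - r"] assms Phi by simp
  moreover have "\<forall>\<^sub>F x in at_bot. Phi x < r"
    using order_tendstoD(2)[OF N.cdf_lim_at_bot, of r] assms Phi by simp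
  ultimately obtain a b where a: "\<And>x. x \<ge> a \<Longrightarrow> Phi x > 1 - r" and b: "\<And>x. x \<le> b \<Longrightarrow> Phi x < r"
    unfolding eventually_at_top_linorder eventually_at_bot_linorder by blast
  define Z where "Z = max 1 (max a (- b))"
  have "Phi Z > 1 - r" "Phi (-Z) < r" using a[of Z] b[of "-Z"] by (auto simp: Z_def)
  moreover have "continuous_on {-Z..Z} Phi"
    using Phi_deriv by (intro continuous_at_imp_continuous_on ballI DERIV_isCont)
  ultimately have "\<exists>z. \<bar>z\<bar> \<le> Z \<and> Phi z = \<alpha>" if "r \<le> \<alpha>" "\<alpha> \<le> 1 - r" for \<alpha>
    using IVT'[of Phi "-Z" \<alpha> Z] that by (force simp: Z_def abs_le_iff)
  thus thesis using that[of Z] by (auto simp: Z_def)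
qed

lemma exp_le_quadratic:
  fixes x :: real assumes "\<bar>x\<bar> \<le> 1" shows "exp x \<le> 1 + x + x\<^sup>2"
proof (cases "0 \<le> x")
  case True thus ?thesis using exp_bound[of x] assms by auto
next
  case False
  have "exp x = 1 / exp (- x)" by (simp add: exp_minus inverse_eq_divide)
  also have "\<dots> \<le> 1 / (1 - x)"
    using exp_ge_add_one_self[of "-x"] False by (intro divide_left_mono) auto
  also have "\<dots> \<le> 1 + x + x\<^sup>2"
  proof -
    have "(1 + x + x\<^sup>2) * (1 - x) = 1 - x ^ 3" by (simp add: algebra_simps power2_eq_square power3_eq_cube)
    moreover have "x ^ 3 \<le> 0" using False by (simp add: power3_eq_cube mult_nonneg_nonpos mult_nonpos_nonpos)
    ultimately show ?thesis using False by (simp add: divide_le_eq)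
  qed
  finally show ?thesis .
qed

text \<open>
  The linear term of \<open>exp x \<le> 1 + x + x\<^sup>2\<close> has mean zero, so only the second moment enters. This
  makes small-variance chaining links cheap; a bound in terms of the range alone would not.
\<close>

lemma (in prob_space) exp_moment_bound:
  fixes X :: "'a \<Rightarrow> real"
  assumes X[measurable]: "random_variable borel X" and bd: "AE \<omega> in M. \<bar>X \<omega>\<bar> \<le> b"
    and mean: "expectation X = 0" and var: "expectation (\<lambda>\<omega>. (X \<omega>)\<^sup>2) \<le> V"
    and \<theta>: "0 \<le> \<theta>" "\<theta> * b \<le> 1"
  shows "integrable M (\<lambda>\<omega>. exp (\<theta> * X \<omega>))" "expectation (\<lambda>\<omega>. exp (\<theta> * X \<omega>)) \<le> exp (\<theta>\<^sup>2 * V)"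
proof -
  have le1: "AE \<omega> in M. \<bar>\<theta> * X \<omega>\<bar> \<le> 1"
  proof (use bd in eventually_elim)
    fix \<omega> assume "\<bar>X \<omega>\<bar> \<le> b"
    hence "\<theta> * \<bar>X \<omega>\<bar> \<le> \<theta> * b" using \<theta> by (intro mult_left_mono)
    thus "\<bar>\<theta> * X \<omega>\<bar> \<le> 1" using \<theta> by (simp add: abs_mult)
  qed
  show int: "integrable M (\<lambda>\<omega>. exp (\<theta> * X \<omega>))"
    by (rule integrable_const_bound[of _ "exp 1"]) (use le1 in \<open>auto elim!: eventually_mono\<close>)
  have iX: "integrable M X" 
    by (rule integrable_const_bound[of _ b]) (use bd in auto)
  have iX2: "integrable M (\<lambda>\<omega>. (X \<omega>)\<^sup>2)"
    by (rule integrable_const_bound[of _ "b\<^sup>2"]) 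
       (use bd in \<open>auto elim!: eventually_mono simp: abs_le_square_iff[symmetric]\<close>)
  have "expectation (\<lambda>\<omega>. exp (\<theta> * X \<omega>)) \<le> expectation (\<lambda>\<omega>. 1 + \<theta> * X \<omega> + \<theta>\<^sup>2 * (X \<omega>)\<^sup>2)"
    by (rule integral_mono_AE[OF int]) 
       (use le1 iX iX2 in \<open>auto elim!: eventually_mono dest!: exp_le_quadratic simp: power_mult_distrib\<close>)
  also have "\<dots> = 1 + \<theta>\<^sup>2 * expectation (\<lambda>\<omega>. (X \<omega>)\<^sup>2)"
    using iX iX2 mean by (simp add: prob_space)
  also have "\<dots> \<le> 1 + \<theta>\<^sup>2 * V" using var by (intro add_left_mono mult_left_mono) auto
  also have "\<dots> \<le> exp (\<theta>\<^sup>2 * V)" by (rule exp_ge_add_one_self)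
  finally show "expectation (\<lambda>\<omega>. exp (\<theta> * X \<omega>)) \<le> exp (\<theta>\<^sup>2 * V)" .
qed

section \<open>A maximal inequality for sums of independent variables\<close>

text \<open>
  The exponential supermartingale of the partial sums, frozen at the first time at which a partial
  sum reaches the level \<open>l\<close>. The test in the successor case looks at the times up to \<open>n\<close> only, so
  the value at the crossing time itself is still computed from the partial sum and then kept.
\<close>

primrec stopped_exp :: "(nat \<Rightarrow> 'a \<Rightarrow> real) \<Rightarrow> real \<Rightarrow> real \<Rightarrow> real \<Rightarrow> nat \<Rightarrow> 'a \<Rightarrow> real" where
  "stopped_exp X \<theta> V l 0 \<omega> = 1"
| "stopped_exp X \<theta> V l (Suc n) \<omega> =
     (if \<forall>k\<in>{..n}. (\<Sum>i=1..k. X i \<omega>) < l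
      then exp (\<theta> * (\<Sum>i=1..Suc n. X i \<omega>) - \<theta>\<^sup>2 * V * real (Suc n))
      else stopped_exp X \<theta> V l n \<omega>)"

lemma stopped_exp_before:
  "\<forall>k\<in>{..n}. (\<Sum>i=1..k. X i \<omega>) < l \<Longrightarrow>
     stopped_exp X \<theta> V l n \<omega> = exp (\<theta> * (\<Sum>i=1..n. X i \<omega>) - \<theta>\<^sup>2 * V * real n)"
  by (cases n) auto

lemma stopped_exp_after:
  fixes N :: nat and \<theta> V l :: real
  assumes "\<theta> \<ge> 0" "V \<ge> 0" "k \<le> n" "n \<le> N" "l \<le> (\<Sum>i=1..k. X i \<omega>)"
  shows "exp (\<theta> * l - \<theta>\<^sup>2 * V * N) \<le> stopped_exp X \<theta> V l n \<omega>"
  using assms(3-5)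
proof (induction n arbitrary: k)
  case 0
  have "\<theta> * l \<le> 0" using 0 assms(1) by (intro mult_nonneg_nonpos) auto
  moreover have "0 \<le> \<theta>\<^sup>2 * V * real N" using assms(2) by simp
  ultimately have "\<theta> * l - \<theta>\<^sup>2 * V * real N \<le> 0" by linarith
  thus ?case by simp
next
  case (Suc n)
  show ?case
  proof (cases "\<forall>k\<in>{..n}. (\<Sum>i=1..k. X i \<omega>) < l")
    case True
    hence "k = Suc n" using Suc.prems by (metis atMost_iff le_SucE linorder_not_le)
    have "\<theta> * l - \<theta>\<^sup>2 * V * N \<le> \<theta> * (\<Sum>i=1..Suc n. X i \<omega>) - \<theta>\<^sup>2 * V * real (Suc n)"
      using Suc.prems assms unfolding \<open>k = Suc n\<close> by (intro diff_mono mult_left_mono) auto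
    thus ?thesis using True by simp
  next
    case False
    then obtain k' where "k' \<le> n" "l \<le> (\<Sum>i=1..k'. X i \<omega>)" by force
    with Suc.IH Suc.prems have "exp (\<theta> * l - \<theta>\<^sup>2 * V * N) \<le> stopped_exp X \<theta> V l n \<omega>" by auto
    thus ?thesis using False by auto
  qed
qed

text \<open>
  The frozen process has expectation at most one: as long as the level is not reached, it is
  multiplied by an independent factor of expectation at most one. On the event that the level is
  reached it is at least \<open>exp (\<theta> l - \<theta>\<^sup>2 V N)\<close>, so Markov's inequality at the final time bounds the
  probability that the maximum is large, with no loss compared with a single partial sum.
\<close>

lemma (in prob_space) maximal_exponential_inequality:
  fixes X :: "nat \<Rightarrow> 'a \<Rightarrow> real"
  assumes indep: "indep_vars (\<lambda>_. borel) X UNIV"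
    and bd: "\<And>i. AE \<omega> in M. \<bar>X i \<omega>\<bar> \<le> b"
    and mean: "\<And>i. expectation (X i) = 0" and var: "\<And>i. expectation (\<lambda>\<omega>. (X i \<omega>)\<^sup>2) \<le> V"
    and \<theta>: "0 \<le> \<theta>" "\<theta> * b \<le> 1"
  shows "prob {\<omega>\<in>space M. \<exists>n\<in>{..N}. l \<le> (\<Sum>i=1..n. X i \<omega>)} \<le> exp (\<theta>\<^sup>2 * V * N - \<theta> * l)"
proof -
  have X[measurable]: "random_variable borel (X i)" for i
    using indep by (auto simp: indep_vars_def)
  have V: "V \<ge> 0" using var[of 0] by (rule order_trans[rotated]) simp
  let ?Z = "stopped_exp X \<theta> V l"
  let ?P = "\<lambda>n \<omega>. \<forall>k\<in>{..n}. (\<Sum>i=1..k. X i \<omega>) < l"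
  let ?C = "\<lambda>n \<omega>. if ?P n \<omega> then exp (\<theta> * (\<Sum>i=1..n. X i \<omega>) - \<theta>\<^sup>2 * V * real n) else 0"
  let ?W = "\<lambda>n \<omega>. exp (\<theta> * X (Suc n) \<omega> - \<theta>\<^sup>2 * V)"
  have Zm[measurable]: "random_variable borel (?Z n)" for n
    by (induction n) (auto simp del: sum.cl_ivl_Suc)
  have Znn: "0 \<le> ?Z n \<omega>" for n \<omega> by (induction n) auto
  have iW: "integrable M (?W n)" and EW: "expectation (?W n) \<le> 1" for n
    using exp_moment_bound[OF X bd mean var \<theta>, of "Suc n"]
    by (auto simp: exp_diff divide_le_eq)
  have step: "?Z (Suc n) \<omega> = (?Z n \<omega> - ?C n \<omega>) + ?C n \<omega> * ?W n \<omega>" for n \<omega>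
  proof (cases "?P n \<omega>")
    case True
    hence "?Z n \<omega> = ?C n \<omega>" by (simp add: stopped_exp_before)
    thus ?thesis using True by (simp add: exp_add[symmetric] algebra_simps)
  next
    case False
    thus ?thesis by (auto simp del: sum.cl_ivl_Suc)
  qed
  have indepCW: "indep_var borel (?C n) borel (?W n)" for n
  proof -
    have "indep_var (PiM {1..n} (\<lambda>_. borel)) (\<lambda>\<omega>. restrict (\<lambda>i. X i \<omega>) {1..n})
                    (PiM {Suc n} (\<lambda>_. borel)) (\<lambda>\<omega>. restrict (\<lambda>i. X i \<omega>) {Suc n})"
      by (rule indep_var_restrict[OF indep]) auto
    moreover let ?f = "\<lambda>x. if \<forall>k\<in>{..n}. (\<Sum>i\<in>{1..n}. if i \<le> k then x i else 0) < l
             then exp (\<theta> * (\<Sum>i\<in>{1..n}. x i) - \<theta>\<^sup>2 * V * real n) else 0"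
    have "?f \<in> borel_measurable (PiM {1..n} (\<lambda>_. borel))" by measurable
    moreover let ?g = "\<lambda>x. exp (\<theta> * x (Suc n) - \<theta>\<^sup>2 * V)"
    have "?g \<in> borel_measurable (PiM {Suc n} (\<lambda>_. borel))" by measurable
    ultimately have "indep_var borel (?f \<circ> (\<lambda>\<omega>. restrict (\<lambda>i. X i \<omega>) {1..n}))
        borel (?g \<circ> (\<lambda>\<omega>. restrict (\<lambda>i. X i \<omega>) {Suc n}))"
      by (rule indep_var_compose)
    moreover have "?g \<circ> (\<lambda>\<omega>. restrict (\<lambda>i. X i \<omega>) {Suc n}) = ?W n" by auto
    moreover have "?f \<circ> (\<lambda>\<omega>. restrict (\<lambda>i. X i \<omega>) {1..n}) = ?C n"
    proof
      fix \<omega>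
      have "(\<Sum>i\<in>{1..n}. if i \<le> k then restrict (\<lambda>i. X i \<omega>) {1..n} i else 0) = (\<Sum>i\<in>{1..k}. X i \<omega>)"
        if "k \<le> n" for k
      proof -
        have "(\<Sum>i\<in>{1..k}. X i \<omega>) = (\<Sum>i\<in>{1..k}. if i \<le> k then restrict (\<lambda>i. X i \<omega>) {1..n} i else 0)"
          using that by (intro sum.cong) auto
        also have "\<dots> = (\<Sum>i\<in>{1..n}. if i \<le> k then restrict (\<lambda>i. X i \<omega>) {1..n} i else 0)"
          using that by (intro sum.mono_neutral_left) auto
        finally show ?thesis ..
      qed
      hence "(\<forall>k\<in>{..n}. (\<Sum>i\<in>{1..n}. if i \<le> k then restrict (\<lambda>i. X i \<omega>) {1..n} i else 0) < l) \<longleftrightarrow> ?P n \<omega>"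
        by (simp only: atMost_iff Ball_def) auto
      moreover have "(\<Sum>i\<in>{1..n}. restrict (\<lambda>i. X i \<omega>) {1..n} i) = (\<Sum>i\<in>{1..n}. X i \<omega>)"
        by (rule sum.cong) auto
      ultimately show "(?f \<circ> (\<lambda>\<omega>. restrict (\<lambda>i. X i \<omega>) {1..n})) \<omega> = ?C n \<omega>"
        by (simp only: comp_apply)
    qed
    ultimately show ?thesis by (simp only:)
  qed
  define Z where "Z = ?Z"
  define C where "C = ?C"
  define W where "W = ?W"
  have Z0: "Z 0 = (\<lambda>_. 1)" by (auto simp: Z_def)
  have ZSuc: "Z (Suc n) = (\<lambda>\<omega>. (Z n \<omega> - C n \<omega>) + C n \<omega> * W n \<omega>)" for n
    unfolding Z_def C_def W_def by (rule ext) (rule step)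
  have CZ: "0 \<le> C n \<omega>" "C n \<omega> \<le> Z n \<omega>" for n \<omega>
    using Znn[of n \<omega>] by (auto simp: stopped_exp_before Z_def C_def simp del: stopped_exp.simps)
  have Cm[measurable]: "random_variable borel (C n)" for n
    unfolding C_def by measurable
  have Zm'[measurable]: "random_variable borel (Z n)" for n
    unfolding Z_def by (rule Zm)
  have Zpos: "0 \<le> Z n \<omega>" for n \<omega> unfolding Z_def by (rule Znn)
  have iW': "integrable M (W n)" and EW': "expectation (W n) \<le> 1"
    and indepCW': "indep_var borel (C n) borel (W n)" for n
    unfolding W_def C_def by (rule iW EW indepCW)+
  have EZ: "integrable M (Z n) \<and> expectation (Z n) \<le> 1" for n
  proof (induction n)
    case 0 show ?case by (simp add: prob_space Z0)
  next
    case (Suc n)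
    have iC: "integrable M (C n)"
      by (rule Bochner_Integration.integrable_bound[of _ "Z n"]) (use Suc CZ Zpos in auto)
    have iCW: "integrable M (\<lambda>\<omega>. C n \<omega> * W n \<omega>)" by (rule indep_var_integrable[OF indepCW' iC iW'])
    have nn: "0 \<le> expectation (C n)" using CZ by (intro integral_nonneg_AE) auto
    have "expectation (\<lambda>\<omega>. C n \<omega> * W n \<omega>) = expectation (C n) * expectation (W n)"
      by (rule indep_var_lebesgue_integral[OF indepCW' iC iW'])
    hence "expectation (\<lambda>\<omega>. C n \<omega> * W n \<omega>) \<le> expectation (C n)"
      using mult_left_mono[OF EW' nn, of n] by simp
    moreover have "expectation (Z (Suc n)) = expectation (Z n) - expectation (C n) + expectation (\<lambda>\<omega>. C n \<omega> * W n \<omega>)"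
      unfolding ZSuc using iC iCW Suc by simp
    ultimately have "expectation (Z (Suc n)) \<le> 1" using Suc by linarith
    moreover have "integrable M (Z (Suc n))" unfolding ZSuc using iC iCW Suc by simp
    ultimately show ?case by blast
  qed
  let ?c = "exp (\<theta> * l - \<theta>\<^sup>2 * V * N)"
  have "prob {\<omega>\<in>space M. \<exists>n\<in>{..N}. l \<le> (\<Sum>i=1..n. X i \<omega>)} \<le> prob {\<omega>\<in>space M. Z N \<omega> \<ge> ?c}"
    unfolding Z_def using stopped_exp_after[OF \<theta>(1) V, of _ N N l X]
    by (intro finite_measure_mono) auto
  moreover have "prob {\<omega>\<in>space M. Z N \<omega> \<ge> ?c} \<le> expectation (Z N) / ?c"
    using EZ Zpos by (intro integral_Markov_inequality_measure[where A="{}"]) auto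
  moreover have "expectation (Z N) / ?c \<le> 1 / ?c" using EZ by (intro divide_right_mono) auto
  moreover have "1 / ?c = exp (\<theta>\<^sup>2 * V * N - \<theta> * l)" by (simp add: exp_diff)
  ultimately show ?thesis by linarith
qed

corollary (in prob_space) maximal_exponential_inequality_abs:
  fixes X :: "nat \<Rightarrow> 'a \<Rightarrow> real"
  assumes indep: "indep_vars (\<lambda>_. borel) X UNIV"
    and bd: "\<And>i. AE \<omega> in M. \<bar>X i \<omega>\<bar> \<le> b"
    and mean: "\<And>i. expectation (X i) = 0" and var: "\<And>i. expectation (\<lambda>\<omega>. (X i \<omega>)\<^sup>2) \<le> V"
    and \<theta>: "0 \<le> \<theta>" "\<theta> * b \<le> 1"
  shows "prob {\<omega>\<in>space M. \<exists>n\<in>{..N}. l \<le> \<bar>\<Sum>i=1..n. X i \<omega>\<bar>} \<le> 2 * exp (\<theta>\<^sup>2 * V * N - \<theta> * l)"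
proof -
  have X[measurable]: "random_variable borel (X i)" for i
    using indep by (auto simp: indep_vars_def)
  let ?A = "\<lambda>X. {\<omega>\<in>space M. \<exists>n\<in>{..N}. l \<le> (\<Sum>i=1..n. X i \<omega>)}"
  have indep': "indep_vars (\<lambda>_. borel) (\<lambda>i \<omega>. - X i \<omega>) UNIV"
    by (rule indep_vars_compose2[OF indep]) auto
  have "{\<omega>\<in>space M. \<exists>n\<in>{..N}. l \<le> \<bar>\<Sum>i=1..n. X i \<omega>\<bar>} = ?A X \<union> ?A (\<lambda>i \<omega>. - X i \<omega>)"
  proof -
    have "l \<le> \<bar>y\<bar> \<longleftrightarrow> l \<le> y \<or> l \<le> - y" for y :: real by linarith
    thus ?thesis unfolding sum_negf by blast
  qed
  moreover have "prob (?A X \<union> ?A (\<lambda>i \<omega>. - X i \<omega>)) \<le> prob (?A X) + prob (?A (\<lambda>i \<omega>. - X i \<omega>))"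
    by (rule measure_Un_le) measurable
  moreover have "prob (?A X) \<le> exp (\<theta>\<^sup>2 * V * N - \<theta> * l)"
    by (rule maximal_exponential_inequality[OF assms])
  moreover have "prob (?A (\<lambda>i \<omega>. - X i \<omega>)) \<le> exp (\<theta>\<^sup>2 * V * N - \<theta> * l)"
    by (rule maximal_exponential_inequality[OF indep' _ _ _ \<theta>]) (use bd mean var in auto)
  ultimately show ?thesis by simp
qed

section \<open>Gaussian marginals of fractional Brownian motion\<close>

lemma (in prob_space) gaussian_rv_square_integrable:
  assumes "gaussian_rv M X"
  shows "integrable M (\<lambda>\<omega>. (X \<omega>)\<^sup>2)"
proof -
  have X[measurable]: "random_variable borel X" using assms by (simp add: gaussian_rv_def)
  from assms consider m where "AE \<omega> in M. X \<omega> = m"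
    | m \<sigma> where "\<sigma> > 0" "distributed M lborel X (\<lambda>x. ennreal (normal_density m \<sigma> x))"
    unfolding gaussian_rv_def by blast
  thus ?thesis
  proof cases
    case 1
    show ?thesis by (rule integrable_const_bound[of _ "m\<^sup>2"]) (use 1 in auto)
  next
    case (2 m \<sigma>)
    have D: "distributed M lborel (\<lambda>\<omega>. (X \<omega> - m) / \<sigma>) std_normal_density"
      using normal_standard_normal_convert[OF 2(1)] 2(2) by simp
    have int: "integrable M (\<lambda>\<omega>. ((X \<omega> - m) / \<sigma>) ^ k)" for k
      using integrable_std_normal_moment[of k] distributed_integrable[OF D, of "\<lambda>x. x ^ k"] by simp
    have "integrable M (\<lambda>\<omega>. m\<^sup>2 + 2 * m * \<sigma> * ((X \<omega> - m) / \<sigma>) ^ 1 + \<sigma>\<^sup>2 * ((X \<omega> - m) / \<sigma>) ^ 2)"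
      by (intro Bochner_Integration.integrable_add integrable_mult_right int) auto
    also have "(\<lambda>\<omega>. m\<^sup>2 + 2 * m * \<sigma> * ((X \<omega> - m) / \<sigma>) ^ 1 + \<sigma>\<^sup>2 * ((X \<omega> - m) / \<sigma>) ^ 2) = (\<lambda>\<omega>. (X \<omega>)\<^sup>2)"
      using 2(1) by (auto simp: fun_eq_iff field_simps power2_eq_square)
    finally show ?thesis .
  qed
qed

text \<open>
  A positive second moment with mean zero excludes the almost surely constant case and
  determines both parameters of the normal density.
\<close>

lemma (in prob_space) gaussian_rv_standardize:
  assumes G: "gaussian_rv M X" and mean: "expectation X = 0"
    and var: "expectation (\<lambda>\<omega>. (X \<omega>)\<^sup>2) = \<sigma>\<^sup>2" and \<sigma>: "\<sigma> > 0"
  shows "distributed M lborel (\<lambda>\<omega>. X \<omega> / \<sigma>) std_normal_density"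
proof -
  have X[measurable]: "random_variable borel X" using G by (simp add: gaussian_rv_def)
  from G consider m where "AE \<omega> in M. X \<omega> = m"
    | m s where "s > 0" "distributed M lborel X (\<lambda>x. ennreal (normal_density m s x))"
    unfolding gaussian_rv_def by blast
  thus ?thesis
  proof cases
    case 1
    have "expectation X = expectation (\<lambda>_. m)" by (rule integral_cong_AE) (use 1 in auto)
    hence "m = 0" using mean by (simp add: prob_space)
    hence "expectation (\<lambda>\<omega>. (X \<omega>)\<^sup>2) = expectation (\<lambda>_. 0)" 
      by (intro integral_cong_AE) (use 1 in auto)
    thus ?thesis using var \<sigma> by simp
  next
    case (2 m s)
    have "m = 0" using normal_distributed_expectation[OF 2] mean by simp
    moreover have "s\<^sup>2 = \<sigma>\<^sup>2" using normal_distributed_variance[OF 2] mean var by simp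
    hence "s = \<sigma>" using 2(1) \<sigma> by (simp add: power2_eq_iff)
    ultimately show ?thesis using normal_standard_normal_convert[OF \<sigma>, of X 0] 2(2) by simp
  qed
qed

lemma (in prob_space) std_normal_cdf:
  assumes "distributed M lborel X std_normal_density"
  shows "prob {\<omega>\<in>space M. X \<omega> \<le> z} = Phi z"
proof -
  have D: "distr M lborel X = density lborel std_normal_density"
    by (rule distributed_distr_eq_density[OF assms])
  have "Phi z = measure (distr M lborel X) {..z}" unfolding Phi_def D ..
  also have "\<dots> = prob (X -` {..z} \<inter> space M)"
    by (rule measure_distr) (use distributed_measurable[OF assms] in auto)
  also have "X -` {..z} \<inter> space M = {\<omega>\<in>space M. X \<omega> \<le> z}" by auto
  finally show ?thesis ..
qed

definition normal_even_moment :: "nat \<Rightarrow> real" where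
  "normal_even_moment q = fact (2 * q) / (2 ^ q * fact q)"

text \<open>
  A tail of every polynomial order is enough for the path oscillation, since the number of dyadic
  increments considered is only exponential in the level.
\<close>

lemma (in prob_space) std_normal_polynomial_tail:
  assumes D: "distributed M lborel X std_normal_density" and c: "c > 0"
  shows "prob {\<omega>\<in>space M. c \<le> \<bar>X \<omega>\<bar>} \<le> normal_even_moment q / c ^ (2 * q)"
proof -
  have X[measurable]: "random_variable borel X" using distributed_measurable[OF D] by simp
  have int: "integrable M (\<lambda>\<omega>. X \<omega> ^ (2 * q))"
    using integrable_std_normal_moment[of "2 * q"] distributed_integrable[OF D, of "\<lambda>x. x ^ (2 * q)"] by simp
  have E: "expectation (\<lambda>\<omega>. X \<omega> ^ (2 * q)) = normal_even_moment q"
    using integral_std_normal_moment_even[of q] distributed_integral[OF D, of "\<lambda>x. x ^ (2 * q)"]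
    by (simp add: normal_even_moment_def)
  have "prob {\<omega>\<in>space M. c \<le> \<bar>X \<omega>\<bar>} \<le> prob {\<omega>\<in>space M. c ^ (2 * q) \<le> X \<omega> ^ (2 * q)}"
  proof (rule finite_measure_mono)
    show "{\<omega>\<in>space M. c \<le> \<bar>X \<omega>\<bar>} \<subseteq> {\<omega>\<in>space M. c ^ (2 * q) \<le> X \<omega> ^ (2 * q)}"
    proof safe
      fix \<omega> assume "c \<le> \<bar>X \<omega>\<bar>"
      hence "c ^ (2 * q) \<le> \<bar>X \<omega>\<bar> ^ (2 * q)" using c by (intro power_mono) auto
      thus "c ^ (2 * q) \<le> X \<omega> ^ (2 * q)" by (simp add: power_mult)
    qed
  qed measurable
  also have "\<dots> \<le> expectation (\<lambda>\<omega>. X \<omega> ^ (2 * q)) / c ^ (2 * q)"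
    by (rule integral_Markov_inequality_measure[OF int, of "{}"]) (use c in \<open>auto simp: power_mult\<close>)
  finally show ?thesis by (simp add: E)
qed

lemma powr_subadd:
  fixes x y \<kappa> :: real
  assumes "0 \<le> x" "0 \<le> y" "0 < \<kappa>" "\<kappa> \<le> 1"
  shows "(x + y) powr \<kappa> \<le> x powr \<kappa> + y powr \<kappa>"
proof (cases "x + y = 0")
  case True
  hence "x = 0" "y = 0" using assms by auto
  thus ?thesis by simp
next
  case False
  hence pos: "x + y > 0" using assms by auto
  have le: "a / (x + y) * (x + y) powr \<kappa> \<le> a powr \<kappa>" if "0 \<le> a" "a \<le> x + y" for a
  proof (cases "a = 0")
    case False
    hence "a / (x + y) \<le> (a / (x + y)) powr \<kappa>"
      using that pos assms powr_mono'[of \<kappa> 1 "a / (x + y)"] by simp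
    also have "\<dots> = a powr \<kappa> / (x + y) powr \<kappa>" using that pos by (simp add: powr_divide)
    finally show ?thesis using pos by (simp add: field_simps)
  qed simp
  have "(x + y) powr \<kappa> = x / (x + y) * (x + y) powr \<kappa> + y / (x + y) * (x + y) powr \<kappa>"
    using pos by (simp add: distrib_right[symmetric] add_divide_distrib[symmetric])
  also have "\<dots> \<le> x powr \<kappa> + y powr \<kappa>" by (intro add_mono le) (use assms in auto)
  finally show ?thesis .
qed

lemma powr_diff_le:
  fixes s t \<kappa> :: real
  assumes "0 \<le> s" "s \<le> t" "0 < \<kappa>" "\<kappa> \<le> 1"
  shows "t powr \<kappa> - s powr \<kappa> \<le> (t - s) powr \<kappa>"
  using powr_subadd[of s "t - s" \<kappa>] assms by simp

lemma powr_time_le: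
  fixes t T \<kappa> :: real
  assumes "0 \<le> t" "t \<le> T" "1 \<le> T" "0 < \<kappa>" "\<kappa> \<le> 1"
  shows "t powr \<kappa> \<le> T"
proof -
  have "t powr \<kappa> \<le> T powr \<kappa>" using assms by (intro powr_mono2) auto
  also have "\<dots> \<le> T powr 1" using assms by (intro powr_mono) auto
  finally show ?thesis using assms by simp
qed

locale fbm_sample = prob_space M for M :: "'a measure" +
  fixes B :: "nat \<Rightarrow> real \<Rightarrow> 'a \<Rightarrow> real" and H :: real
  assumes H: "0 < H" "H < 1"
    and iid: "iid_processes M B"
    and fbm: "\<And>j. sample_continuous_fbm M H (B j)"
begin

lemma gaussian_combination: "finite S \<Longrightarrow> S \<subseteq> {0..} \<Longrightarrow> gaussian_rv M (\<lambda>\<omega>. \<Sum>t\<in>S. c t * B j t \<omega>)"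
  using fbm[of j] by (auto simp: sample_continuous_fbm_def gaussian_process_def)

lemma gaussian_marginal: "0 \<le> t \<Longrightarrow> gaussian_rv M (B j t)"
  using gaussian_combination[of "{t}" "\<lambda>_. 1" j] by simp

lemma gaussian_increment:
  assumes "0 \<le> s" "0 \<le> t" "s \<noteq> t" shows "gaussian_rv M (\<lambda>\<omega>. B j t \<omega> - B j s \<omega>)"
  using gaussian_combination[of "{s, t}" "\<lambda>r. if r = t then 1 else - 1" j] assms
  by (simp add: insert_commute)

lemma B_measurable [measurable]: "0 \<le> t \<Longrightarrow> B j t \<in> borel_measurable M"
  using gaussian_marginal by (simp add: gaussian_rv_def)

lemma continuous_path: "\<omega> \<in> space M \<Longrightarrow> continuous_on {0..} (\<lambda>t. B j t \<omega>)"
  using fbm[of j] by (auto simp: sample_continuous_fbm_def)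

lemma B_mean: "0 \<le> t \<Longrightarrow> expectation (B j t) = 0"
  using fbm[of j] by (auto simp: sample_continuous_fbm_def)

lemma B_covariance:
  "0 \<le> s \<Longrightarrow> 0 \<le> t \<Longrightarrow> expectation (\<lambda>\<omega>. B j s \<omega> * B j t \<omega>) =
     (s powr (2 * H) + t powr (2 * H) - \<bar>s - t\<bar> powr (2 * H)) / 2"
  using fbm[of j] by (auto simp: sample_continuous_fbm_def)

lemma B_square_integrable: "0 \<le> t \<Longrightarrow> integrable M (\<lambda>\<omega>. (B j t \<omega>)\<^sup>2)"
  by (rule gaussian_rv_square_integrable[OF gaussian_marginal])

lemma B_product_integrable:
  assumes "0 \<le> s" "0 \<le> t" shows "integrable M (\<lambda>\<omega>. B j s \<omega> * B j t \<omega>)"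
proof (rule Bochner_Integration.integrable_bound)
  show "integrable M (\<lambda>\<omega>. (B j s \<omega>)\<^sup>2 + (B j t \<omega>)\<^sup>2)" using assms B_square_integrable by simp
  have "\<bar>x * y\<bar> \<le> x\<^sup>2 + y\<^sup>2" for x y :: real
  proof -
    have "2 * (\<bar>x\<bar> * \<bar>y\<bar>) \<le> x\<^sup>2 + y\<^sup>2" using sum_squares_bound[of "\<bar>x\<bar>" "\<bar>y\<bar>"] by (simp add: mult.assoc)
    moreover have "0 \<le> \<bar>x\<bar> * \<bar>y\<bar>" by simp
    ultimately have "\<bar>x\<bar> * \<bar>y\<bar> \<le> x\<^sup>2 + y\<^sup>2" by linarith
    thus ?thesis by (simp only: abs_mult)
  qed
  thus "AE \<omega> in M. norm (B j s \<omega> * B j t \<omega>) \<le> norm ((B j s \<omega>)\<^sup>2 + (B j t \<omega>)\<^sup>2)" by simp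
  show "(\<lambda>\<omega>. B j s \<omega> * B j t \<omega>) \<in> borel_measurable M" using assms by simp
qed

lemma B_integrable: "0 \<le> t \<Longrightarrow> integrable M (B j t)"
  by (rule square_integrable_imp_integrable) (auto simp: B_square_integrable)

lemma second_moment_combination:
  assumes "0 \<le> s" "0 \<le> t"
  shows "expectation (\<lambda>\<omega>. (a * B j t \<omega> - b * B j s \<omega>)\<^sup>2)
    = a\<^sup>2 * t powr (2 * H) + b\<^sup>2 * s powr (2 * H)
      - a * b * (s powr (2 * H) + t powr (2 * H) - \<bar>s - t\<bar> powr (2 * H))"
    (is "?l = ?r")
proof -
  have "?l = expectation (\<lambda>\<omega>. a\<^sup>2 * (B j t \<omega> * B j t \<omega>) + b\<^sup>2 * (B j s \<omega> * B j s \<omega>) - 2 * a * b * (B j s \<omega> * B j t \<omega>))"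
    by (rule Bochner_Integration.integral_cong) (auto simp: power2_eq_square algebra_simps)
  also have "\<dots> = a\<^sup>2 * expectation (\<lambda>\<omega>. B j t \<omega> * B j t \<omega>) + b\<^sup>2 * expectation (\<lambda>\<omega>. B j s \<omega> * B j s \<omega>)
      - 2 * a * b * expectation (\<lambda>\<omega>. B j s \<omega> * B j t \<omega>)"
    using B_product_integrable assms by simp
  also have "\<dots> = ?r" using H by (simp only: B_covariance assms) (simp add: field_simps)
  finally show ?thesis .
qed

lemma marginal_std_normal:
  assumes "0 < t" shows "distributed M lborel (\<lambda>\<omega>. B j t \<omega> / t powr H) std_normal_density"
proof (rule gaussian_rv_standardize)
  show "expectation (\<lambda>\<omega>. (B j t \<omega>)\<^sup>2) = (t powr H)\<^sup>2"
    using second_moment_combination[of t t 1 j 0] assms by (simp add: power2_eq_square powr_add[symmetric])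
qed (use assms in \<open>auto simp: B_mean gaussian_marginal\<close>)

lemma increment_std_normal:
  assumes "0 \<le> s" "0 \<le> t" "s \<noteq> t"
  shows "distributed M lborel (\<lambda>\<omega>. (B j t \<omega> - B j s \<omega>) / \<bar>t - s\<bar> powr H) std_normal_density"
proof (rule gaussian_rv_standardize)
  show "expectation (\<lambda>\<omega>. (B j t \<omega> - B j s \<omega>)\<^sup>2) = (\<bar>t - s\<bar> powr H)\<^sup>2"
    using second_moment_combination[of s t 1 j 1] assms
    by (simp add: power2_eq_square powr_add[symmetric] abs_minus_commute)
  show "expectation (\<lambda>\<omega>. B j t \<omega> - B j s \<omega>) = 0" using assms by (simp add: B_integrable B_mean)
qed (use assms in \<open>auto simp: gaussian_increment\<close>)

text \<open>
  The space variable is measured in units of \<open>t\<close> to the power \<open>H\<close>, the standard deviation at time \<open>t\<close>. In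
  this scale the level \<open>\<tau>\<^sub>\<alpha>(t)\<close> is the constant \<open>z\<close> with \<open>\<Phi>(z) = \<alpha>\<close>, and all times look alike.
\<close>

definition hit :: "nat \<Rightarrow> real \<Rightarrow> real \<Rightarrow> 'a \<Rightarrow> real" where
  "hit j t z \<omega> = of_bool (B j t \<omega> \<le> t powr H * z)"

lemma hit_measurable [measurable]: "0 \<le> t \<Longrightarrow> hit j t z \<in> borel_measurable M"
  unfolding hit_def by measurable

lemma hit_bounds: "0 \<le> hit j t z \<omega>" "hit j t z \<omega> \<le> 1"
  by (auto simp: hit_def)

lemma hit_integrable: "0 \<le> t \<Longrightarrow> integrable M (hit j t z)"
  by (rule integrable_const_bound[of _ 1]) (auto simp: hit_def)

lemma hit_alt: "0 < t \<Longrightarrow> hit j t z \<omega> = of_bool (B j t \<omega> / t powr H \<le> z)"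
  by (simp add: hit_def field_simps)

lemma hit_expectation:
  assumes "0 < t" shows "expectation (hit j t z) = Phi z"
proof -
  have [measurable]: "B j t \<in> borel_measurable M" using assms by simp
  have "expectation (hit j t z) = expectation (indicator {\<omega>\<in>space M. B j t \<omega> / t powr H \<le> z})"
    using assms by (intro Bochner_Integration.integral_cong) (auto simp: hit_alt)
  also have "\<dots> = prob {\<omega>\<in>space M. B j t \<omega> / t powr H \<le> z}" by simp
  finally show ?thesis using std_normal_cdf[OF marginal_std_normal[OF assms]] by simp
qed

lemma F_eq_Phi: "0 < t \<Longrightarrow> F M B t x = Phi (x / t powr H)"
  using std_normal_cdf[OF marginal_std_normal, of t 0 "x / t powr H"]
  by (simp add: F_def divide_le_cancel)

lemma hit_difference_same_time:
  assumes t: "0 < t"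
  shows "expectation (\<lambda>\<omega>. (hit j t z \<omega> - hit j t z' \<omega>)\<^sup>2) \<le> \<bar>z - z'\<bar>"
proof -
  have *: "expectation (\<lambda>\<omega>. (hit j t b \<omega> - hit j t a \<omega>)\<^sup>2) \<le> b - a" if "a \<le> b" for a b
  proof -
    have "expectation (\<lambda>\<omega>. (hit j t b \<omega> - hit j t a \<omega>)\<^sup>2) = expectation (\<lambda>\<omega>. hit j t b \<omega> - hit j t a \<omega>)"
      using that t by (intro Bochner_Integration.integral_cong) (auto simp: hit_alt)
    also have "\<dots> = Phi b - Phi a" using t by (simp add: hit_integrable hit_expectation)
    finally show ?thesis using Phi_Lipschitz_le[OF that] by simp
  qed
  show ?thesis using *[of z z'] *[of z' z] by (cases "z \<le> z'") (auto simp: power2_commute)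
qed

text \<open>
  If the two indicators differ, then either the normalised positions at the two times differ by
  more than \<open>\<epsilon>\<close>, or the position at time \<open>t\<close> lies within \<open>\<bar>z - z'\<bar> + \<epsilon>\<close> of \<open>z\<close>. The first case is
  handled by Chebyshev's inequality and covariance, the second by the bounded normal density. This
  only uses one-dimensional laws and second moments; the choice of \<open>\<epsilon>\<close> makes the Chebyshev term
  \<open>((t - s) / s)\<close> to the power \<open>H\<close>, which is at most \<open>\<epsilon>\<close> as \<open>t - s \<le> s\<close>.
\<close>

lemma hit_difference_second_moment:
  assumes "0 < s" "s < t" "t - s \<le> s"
  shows "expectation (\<lambda>\<omega>. (hit j t z \<omega> - hit j s z' \<omega>)\<^sup>2) \<le> 2 * \<bar>z - z'\<bar> + 3 * ((t - s) / s) powr (H / 2)"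
proof -
  define \<epsilon> where "\<epsilon> = ((t - s) / s) powr (H / 2)"
  define d where "d = \<bar>z - z'\<bar> + \<epsilon>"
  let ?Y = "\<lambda>t \<omega>. B j t \<omega> / t powr H"
  have pos: "0 < t" "0 < s" "0 < t powr H" "0 < s powr H" "\<epsilon> > 0" using assms by (auto simp: \<epsilon>_def)
  have m[measurable]: "B j t \<in> borel_measurable M" "B j s \<in> borel_measurable M" using assms by auto
  have pw: "(hit j t z \<omega> - hit j s z' \<omega>)\<^sup>2 \<le> hit j t (z + d) \<omega> - hit j t (z - d) \<omega> + (?Y t \<omega> - ?Y s \<omega>)\<^sup>2 / \<epsilon>\<^sup>2" for \<omega>
  proof (cases "\<bar>?Y t \<omega> - ?Y s \<omega>\<bar> \<le> \<epsilon>")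
    case True
    have "0 \<le> (?Y t \<omega> - ?Y s \<omega>)\<^sup>2 / \<epsilon>\<^sup>2" by simp
    moreover have "(hit j t z \<omega> - hit j s z' \<omega>)\<^sup>2 \<le> hit j t (z + d) \<omega> - hit j t (z - d) \<omega>"
      using True pos unfolding hit_alt[OF pos(1)] hit_alt[OF pos(2)] d_def
      by (auto simp: of_bool_def)
    ultimately show ?thesis by linarith
  next
    case False
    hence "\<epsilon>\<^sup>2 \<le> (?Y t \<omega> - ?Y s \<omega>)\<^sup>2" using pos abs_le_square_iff[of \<epsilon> "?Y t \<omega> - ?Y s \<omega>"] by simp
    hence "1 \<le> (?Y t \<omega> - ?Y s \<omega>)\<^sup>2 / \<epsilon>\<^sup>2" using pos by simp
    moreover have "(hit j t z \<omega> - hit j s z' \<omega>)\<^sup>2 \<le> 1" by (auto simp: hit_def)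
    moreover have "hit j t (z - d) \<omega> \<le> hit j t (z + d) \<omega>"
      unfolding hit_alt[OF pos(1)] d_def using pos by (auto simp: of_bool_def)
    ultimately show ?thesis by linarith
  qed
  have Yeq: "(?Y t \<omega> - ?Y s \<omega>)\<^sup>2 = (1 / t powr H * B j t \<omega> - 1 / s powr H * B j s \<omega>)\<^sup>2" for \<omega> by simp
  have iY: "integrable M (\<lambda>\<omega>. (?Y t \<omega> - ?Y s \<omega>)\<^sup>2)"
  proof -
    have "(\<lambda>\<omega>. (?Y t \<omega> - ?Y s \<omega>)\<^sup>2) = (\<lambda>\<omega>. (1 / t powr H)\<^sup>2 * (B j t \<omega> * B j t \<omega>) + (1 / s powr H)\<^sup>2 * (B j s \<omega> * B j s \<omega>)
        - 2 * (1 / t powr H) * (1 / s powr H) * (B j s \<omega> * B j t \<omega>))"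
      by (auto simp: fun_eq_iff power2_eq_square algebra_simps)
    thus ?thesis using B_product_integrable pos by simp
  qed
  have EY: "expectation (\<lambda>\<omega>. (?Y t \<omega> - ?Y s \<omega>)\<^sup>2) \<le> ((t - s) / s) powr (2 * H)"
  proof -
    let ?a = "t powr H" and ?b = "s powr H" and ?c = "(t - s) powr H"
    have sq: "x powr (2 * H) = (x powr H)\<^sup>2" for x by (simp add: power2_eq_square powr_add[symmetric])
    have "expectation (\<lambda>\<omega>. (?Y t \<omega> - ?Y s \<omega>)\<^sup>2) = (1 / ?a)\<^sup>2 * ?a\<^sup>2 + (1 / ?b)\<^sup>2 * ?b\<^sup>2
        - 1 / ?a * (1 / ?b) * (?b\<^sup>2 + ?a\<^sup>2 - ?c\<^sup>2)"
      unfolding Yeq using second_moment_combination[of s t "1 / ?a" j "1 / ?b"] assms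
      by (simp add: sq abs_minus_commute)
    also have "\<dots> = (?c\<^sup>2 - (?a - ?b)\<^sup>2) / (?a * ?b)"
      using pos by (simp add: field_simps power2_eq_square)
    also have "\<dots> \<le> ?c\<^sup>2 / (?b * ?b)"
    proof (rule frac_le)
      show "?b * ?b \<le> ?a * ?b" using pos assms H by (intro mult_right_mono powr_mono2) auto
    qed (use pos in auto)
    also have "\<dots> = ((t - s) / s) powr (2 * H)"
      using assms by (simp add: sq powr_divide power2_eq_square)
    finally show ?thesis .
  qed
  have "expectation (\<lambda>\<omega>. (hit j t z \<omega> - hit j s z' \<omega>)\<^sup>2)
      \<le> expectation (\<lambda>\<omega>. hit j t (z + d) \<omega> - hit j t (z - d) \<omega> + (?Y t \<omega> - ?Y s \<omega>)\<^sup>2 / \<epsilon>\<^sup>2)"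
  proof (rule integral_mono)
    show "integrable M (\<lambda>\<omega>. (hit j t z \<omega> - hit j s z' \<omega>)\<^sup>2)"
      by (rule integrable_const_bound[of _ 1]) (use pos in \<open>auto simp: hit_def\<close>)
  qed (use pw iY pos in \<open>auto simp: hit_integrable\<close>)
  also have "\<dots> = Phi (z + d) - Phi (z - d) + expectation (\<lambda>\<omega>. (?Y t \<omega> - ?Y s \<omega>)\<^sup>2) / \<epsilon>\<^sup>2"
    using iY pos by (simp add: hit_integrable hit_expectation)
  also have "\<dots> \<le> 2 * d + ((t - s) / s) powr (2 * H) / \<epsilon>\<^sup>2"
  proof (intro add_mono divide_right_mono EY)
    show "Phi (z + d) - Phi (z - d) \<le> 2 * d" using Phi_Lipschitz_le[of "z - d" "z + d"] pos by (simp add: d_def)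
  qed simp
  also have "((t - s) / s) powr (2 * H) / \<epsilon>\<^sup>2 = ((t - s) / s) powr H"
    using assms unfolding \<epsilon>_def by (simp add: power2_eq_square powr_add[symmetric] powr_diff[symmetric])
  also have "\<dots> \<le> \<epsilon>" unfolding \<epsilon>_def using assms H by (intro powr_mono') auto
  finally show ?thesis by (simp add: d_def \<epsilon>_def)
qed

end

section \<open>Dyadic rounding\<close>

definition dyad :: "nat \<Rightarrow> real \<Rightarrow> real" where
  "dyad k x = real_of_int \<lfloor>2 ^ k * x\<rfloor> / 2 ^ k"

lemma dyad_le: "dyad k x \<le> x"
  and dyad_gt: "x < dyad k x + 1 / 2 ^ k"
proof -
  have "real_of_int \<lfloor>2 ^ k * x\<rfloor> \<le> 2 ^ k * x" "2 ^ k * x < real_of_int \<lfloor>2 ^ k * x\<rfloor> + 1" by linarith+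
  thus "dyad k x \<le> x" "x < dyad k x + 1 / 2 ^ k" by (simp_all add: dyad_def field_simps)
qed

lemma dyad_nonneg: "0 \<le> x \<Longrightarrow> 0 \<le> dyad k x"
  by (simp add: dyad_def)

text \<open>
  The rounding at a level is determined by the integer that describes the rounding at the next
  level. Hence the number of chaining links is at most the number of points of the finer grid.
\<close>

lemma dyad_parent: "dyad k x = real_of_int (\<lfloor>2 ^ Suc k * x\<rfloor> div 2) / 2 ^ k"
proof -
  have "\<lfloor>(2 ^ Suc k * x) / real_of_int 2\<rfloor> = \<lfloor>2 ^ Suc k * x\<rfloor> div 2"
    by (rule floor_divide_real_eq_div) simp
  thus ?thesis by (simp add: dyad_def)
qed

lemma dyad_Suc_cases:
  "dyad (Suc k) x = dyad k x \<or> dyad (Suc k) x = dyad k x + 1 / 2 ^ Suc k"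
proof -
  let ?m = "\<lfloor>2 ^ Suc k * x\<rfloor>"
  have "dyad k x = real_of_int (2 * (?m div 2)) / 2 ^ Suc k" unfolding dyad_parent by simp
  moreover have "dyad (Suc k) x = real_of_int ?m / 2 ^ Suc k" by (simp add: dyad_def)
  moreover have "?m = 2 * (?m div 2) \<or> ?m = 2 * (?m div 2) + 1" by presburger
  moreover have "real_of_int (n + 1) / 2 ^ Suc k = real_of_int n / 2 ^ Suc k + 1 / 2 ^ Suc k" for n
    by (simp add: add_divide_distrib)
  ultimately show ?thesis by metis
qed

lemma dyad_tendsto: "(\<lambda>k. dyad k x) \<longlonglongrightarrow> x"
proof (rule tendsto_sandwich)
  have "(\<lambda>k. x - (1 / 2) ^ k) \<longlonglongrightarrow> x - 0"
    by (intro tendsto_diff tendsto_const LIMSEQ_power_zero) simp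
  thus "(\<lambda>k. x - (1 / 2) ^ k) \<longlonglongrightarrow> x" by simp
  have "x - (1 / 2) ^ k \<le> dyad k x" for k using dyad_gt[of x k] by (simp add: power_one_over)
  thus "\<forall>\<^sub>F k in sequentially. x - (1 / 2) ^ k \<le> dyad k x" by simp
qed (auto simp: dyad_le)

section \<open>Weighted deviations\<close>

context fbm_sample
begin

text \<open>
  The weight vanishes at \<open>t = 0\<close>, where the normalised process has no continuous extension.
\<close>

definition wdev :: "nat \<Rightarrow> real \<Rightarrow> real \<Rightarrow> 'a \<Rightarrow> real" where
  "wdev j t z \<omega> = t powr (H / 4) * (hit j t z \<omega> - Phi z)"

lemma wdev_measurable [measurable]: "0 \<le> t \<Longrightarrow> wdev j t z \<in> borel_measurable M"
  unfolding wdev_def by measurable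

lemma hit_linear_indep:
  assumes "0 \<le> s" "0 \<le> t"
  shows "indep_vars (\<lambda>_. borel) (\<lambda>j \<omega>. a * (hit j t z \<omega> - c) - b * (hit j s z' \<omega> - d)) UNIV"
proof -
  have "indep_vars (\<lambda>_. path_space) (\<lambda>j. path_of (B j)) UNIV"
    using iid by (simp add: iid_processes_def)
  hence "indep_vars (\<lambda>_. borel) (\<lambda>j \<omega>. (\<lambda>x. a * (of_bool (x t \<le> t powr H * z) - c)
      - b * (of_bool (x s \<le> s powr H * z') - d)) (path_of (B j) \<omega>)) UNIV"
  proof (rule indep_vars_compose2)
    have [measurable]: "(\<lambda>x. x t) \<in> borel_measurable path_space" "(\<lambda>x. x s) \<in> borel_measurable path_space"
      unfolding path_space_def using assms by (auto intro!: measurable_component_singleton)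
    show "(\<lambda>x. a * (of_bool (x t \<le> t powr H * z) - c)
      - b * (of_bool (x s \<le> s powr H * z') - d)) \<in> borel_measurable path_space"
      by measurable
  qed
  thus ?thesis using assms by (simp add: path_of_def hit_def)
qed

lemma hit_abs_dev_le_1: "\<bar>hit j t z \<omega> - Phi z\<bar> \<le> 1"
  using hit_bounds[of j t z \<omega>] Phi_bounds[of z] by linarith

lemma wdev_abs_le:
  assumes "0 \<le> t" "t \<le> T" "1 \<le> T" shows "\<bar>wdev j t z \<omega>\<bar> \<le> T"
proof -
  have "\<bar>wdev j t z \<omega>\<bar> \<le> t powr (H/4) * 1"
    unfolding wdev_def abs_mult using hit_abs_dev_le_1 by (intro mult_mono) auto
  thus ?thesis using powr_time_le[OF assms, of "H/4"] H by simp
qed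

lemma wdev_expectation: "0 \<le> t \<Longrightarrow> expectation (wdev j t z) = 0"
  unfolding wdev_def by (cases "t = 0") (simp_all add: hit_integrable hit_expectation prob_space)

lemma wdev_integrable: "0 \<le> t \<Longrightarrow> integrable M (wdev j t z)"
  unfolding wdev_def by (simp add: hit_integrable)

lemma hit_dev_diff_second_moment:
  assumes "0 < s" "0 < t"
  shows "expectation (\<lambda>\<omega>. ((hit j t z \<omega> - Phi z) - (hit j s z' \<omega> - Phi z'))\<^sup>2)
    \<le> expectation (\<lambda>\<omega>. (hit j t z \<omega> - hit j s z' \<omega>)\<^sup>2)"
proof -
  let ?X = "\<lambda>\<omega>. hit j t z \<omega> - hit j s z' \<omega>" and ?m = "Phi z - Phi z'"
  have iX2: "integrable M (\<lambda>\<omega>. (?X \<omega>)\<^sup>2)"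
    by (rule integrable_const_bound[of _ 1]) (use assms in \<open>auto simp: hit_def\<close>)
  have iX: "integrable M ?X" using assms by (simp add: hit_integrable)
  have "expectation (\<lambda>\<omega>. ((hit j t z \<omega> - Phi z) - (hit j s z' \<omega> - Phi z'))\<^sup>2)
    = expectation (\<lambda>\<omega>. (?X \<omega>)\<^sup>2 - 2 * ?m * ?X \<omega> + ?m\<^sup>2)"
    by (intro Bochner_Integration.integral_cong) (auto simp: power2_eq_square algebra_simps)
  also have "\<dots> = expectation (\<lambda>\<omega>. (?X \<omega>)\<^sup>2) - 2 * ?m * expectation ?X + ?m\<^sup>2"
    using iX iX2 by (simp add: prob_space)
  also have "expectation ?X = ?m" using assms by (simp add: hit_integrable hit_expectation)
  finally have "expectation (\<lambda>\<omega>. ((hit j t z \<omega> - Phi z) - (hit j s z' \<omega> - Phi z'))\<^sup>2)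
    = expectation (\<lambda>\<omega>. (?X \<omega>)\<^sup>2) - 2 * ?m * ?m + ?m\<^sup>2" .
  moreover have "2 * ?m * ?m = 2 * ?m\<^sup>2" "0 \<le> ?m\<^sup>2" by (simp_all add: power2_eq_square)
  ultimately show ?thesis by linarith
qed

text \<open>
  Without the weight the increment between times \<open>s\<close> and \<open>t\<close> is governed by \<open>(t - s) / s\<close>, which is
  unbounded near zero. The square of the weight is \<open>s\<close> to the power \<open>H/2\<close>, exactly the power of the
  denominator in \<open>hit_difference_second_moment\<close>, and cancels it. If \<open>s < t - s\<close>, that lemma is not
  available, but then the square of the weight is at most \<open>t - s\<close> to the power \<open>H/2\<close>.
\<close>

lemma wdev_increment_second_moment:
  assumes "0 \<le> s" "s \<le> t" "t \<le> T" "1 \<le> T"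
  shows "expectation (\<lambda>\<omega>. (wdev j t z \<omega> - wdev j s z' \<omega>)\<^sup>2)
      \<le> 8 * (t - s) powr (H / 2) + 4 * T * \<bar>z - z'\<bar>"
proof (cases "s = 0")
  case True
  have "expectation (\<lambda>\<omega>. (wdev j t z \<omega> - wdev j s z' \<omega>)\<^sup>2) \<le> expectation (\<lambda>_. t powr (H/2))"
  proof (rule integral_mono_AE)
    have *: "(wdev j t z \<omega> - wdev j s z' \<omega>)\<^sup>2 \<le> t powr (H/2)" for \<omega>
    proof -
      have "(wdev j t z \<omega> - wdev j s z' \<omega>)\<^sup>2 = (t powr (H/4))\<^sup>2 * (hit j t z \<omega> - Phi z)\<^sup>2"
        using True by (simp add: wdev_def power_mult_distrib)
      also have "\<dots> \<le> (t powr (H/4))\<^sup>2 * 1"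
        using hit_abs_dev_le_1 by (intro mult_left_mono) (auto simp: abs_square_le_1)
      finally show ?thesis by (simp add: power2_eq_square powr_add[symmetric])
    qed
    thus "AE \<omega> in M. (wdev j t z \<omega> - wdev j s z' \<omega>)\<^sup>2 \<le> t powr (H/2)" by simp
    show "integrable M (\<lambda>\<omega>. (wdev j t z \<omega> - wdev j s z' \<omega>)\<^sup>2)"
      by (rule integrable_const_bound[of _ "t powr (H/2)"]) (use * assms in auto)
  qed simp
  also have "\<dots> \<le> 8 * (t - s) powr (H / 2) + 4 * T * \<bar>z - z'\<bar>"
    using True assms by (simp add: prob_space)
  finally show ?thesis .
next
  case False
  hence pos: "0 < s" "0 < t" using assms by auto
  let ?a = "t powr (H/4)" and ?b = "s powr (H/4)"
  let ?X = "\<lambda>\<omega>. hit j t z \<omega> - Phi z" and ?X' = "\<lambda>\<omega>. hit j s z' \<omega> - Phi z'"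
  have sq: "x powr (H/2) = (x powr (H/4))\<^sup>2" for x by (simp add: power2_eq_square powr_add[symmetric])
  have i1: "integrable M (\<lambda>\<omega>. (?X \<omega> - ?X' \<omega>)\<^sup>2)"
  proof (rule integrable_const_bound[of _ 4])
    have "\<bar>?X \<omega> - ?X' \<omega>\<bar> \<le> 2" for \<omega> using hit_abs_dev_le_1[of j t z \<omega>] hit_abs_dev_le_1[of j s z' \<omega>] by linarith
    hence "\<bar>?X \<omega> - ?X' \<omega>\<bar>\<^sup>2 \<le> 2\<^sup>2" for \<omega> by (intro power_mono) auto
    thus "AE \<omega> in M. norm ((?X \<omega> - ?X' \<omega>)\<^sup>2) \<le> 4" by simp
  qed (use assms in simp)
  have pw: "(wdev j t z \<omega> - wdev j s z' \<omega>)\<^sup>2 \<le> 2 * (?a - ?b)\<^sup>2 + 2 * ?b\<^sup>2 * (?X \<omega> - ?X' \<omega>)\<^sup>2" for \<omega>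
  proof -
    have "wdev j t z \<omega> - wdev j s z' \<omega> = (?a - ?b) * ?X \<omega> + ?b * (?X \<omega> - ?X' \<omega>)"
      by (simp add: wdev_def algebra_simps)
    moreover have "(p + q)\<^sup>2 \<le> 2 * p\<^sup>2 + 2 * q\<^sup>2" for p q :: real
      using sum_squares_bound[of p q] by (simp add: power2_sum)
    moreover have le: "((?a - ?b) * ?X \<omega>)\<^sup>2 \<le> (?a - ?b)\<^sup>2"
      unfolding power_mult_distrib using hit_abs_dev_le_1[of j t z \<omega>]
      by (intro mult_right_le_one_le) (auto simp: abs_square_le_1)
    ultimately have "(wdev j t z \<omega> - wdev j s z' \<omega>)\<^sup>2 \<le> 2 * ((?a - ?b) * ?X \<omega>)\<^sup>2 + 2 * (?b * (?X \<omega> - ?X' \<omega>))\<^sup>2"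
      by (simp only:)
    also have "\<dots> \<le> 2 * (?a - ?b)\<^sup>2 + 2 * (?b * (?X \<omega> - ?X' \<omega>))\<^sup>2" using le by simp
    also have "(?b * (?X \<omega> - ?X' \<omega>))\<^sup>2 = ?b\<^sup>2 * (?X \<omega> - ?X' \<omega>)\<^sup>2" by (rule power_mult_distrib)
    finally show ?thesis by (simp only: mult.assoc)
  qed
  have iw: "integrable M (\<lambda>\<omega>. (wdev j t z \<omega> - wdev j s z' \<omega>)\<^sup>2)"
    by (rule Bochner_Integration.integrable_bound[of _ "\<lambda>\<omega>. 2 * (?a - ?b)\<^sup>2 + 2 * ?b\<^sup>2 * (?X \<omega> - ?X' \<omega>)\<^sup>2"])
       (use i1 pw assms in auto)
  have E: "expectation (\<lambda>\<omega>. (wdev j t z \<omega> - wdev j s z' \<omega>)\<^sup>2)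
      \<le> 2 * (?a - ?b)\<^sup>2 + 2 * ?b\<^sup>2 * expectation (\<lambda>\<omega>. (?X \<omega> - ?X' \<omega>)\<^sup>2)"
  proof -
    have "expectation (\<lambda>\<omega>. (wdev j t z \<omega> - wdev j s z' \<omega>)\<^sup>2)
      \<le> expectation (\<lambda>\<omega>. 2 * (?a - ?b)\<^sup>2 + 2 * ?b\<^sup>2 * (?X \<omega> - ?X' \<omega>)\<^sup>2)"
      by (rule integral_mono) (use iw i1 pw in auto)
    thus ?thesis using i1 by (simp add: prob_space)
  qed
  have ab: "(?a - ?b)\<^sup>2 \<le> (t - s) powr (H/2)"
  proof -
    have "0 \<le> ?a - ?b" using assms H by (simp add: powr_mono2)
    moreover have "?a - ?b \<le> (t - s) powr (H/4)" using assms H by (intro powr_diff_le) auto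
    ultimately show ?thesis unfolding sq by (intro power_mono) auto
  qed
  have ED: "expectation (\<lambda>\<omega>. (?X \<omega> - ?X' \<omega>)\<^sup>2) \<le> expectation (\<lambda>\<omega>. (hit j t z \<omega> - hit j s z' \<omega>)\<^sup>2)"
    by (rule hit_dev_diff_second_moment) (use pos in auto)
  have bT: "?b\<^sup>2 \<le> T" unfolding sq[symmetric] using assms H by (intro powr_time_le) auto
  have "?b\<^sup>2 * expectation (\<lambda>\<omega>. (hit j t z \<omega> - hit j s z' \<omega>)\<^sup>2) \<le> 2 * T * \<bar>z - z'\<bar> + 3 * (t - s) powr (H/2)"
  proof -
    consider "s = t" | "s < t" "t - s \<le> s" | "s < t" "s < t - s" using assms by linarith
    thus ?thesis
    proof cases
      case 1
      have "?b\<^sup>2 * expectation (\<lambda>\<omega>. (hit j t z \<omega> - hit j s z' \<omega>)\<^sup>2) \<le> T * \<bar>z - z'\<bar>"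
        using hit_difference_same_time[OF pos(1), of j z z'] bT assms 1 by (intro mult_mono) auto
      also have "\<dots> \<le> 2 * T * \<bar>z - z'\<bar>" using assms by simp
      finally show ?thesis using 1 by simp
    next
      case 2
      have "?b\<^sup>2 * expectation (\<lambda>\<omega>. (hit j t z \<omega> - hit j s z' \<omega>)\<^sup>2)
        \<le> ?b\<^sup>2 * (2 * \<bar>z - z'\<bar> + 3 * ((t - s) / s) powr (H / 2))"
        using hit_difference_second_moment[OF pos(1) 2] by (intro mult_left_mono) auto
      also have "\<dots> = ?b\<^sup>2 * (2 * \<bar>z - z'\<bar>) + 3 * (t - s) powr (H / 2)"
        using pos 2 by (simp add: sq powr_divide power_divide distrib_left)
      also have "?b\<^sup>2 * (2 * \<bar>z - z'\<bar>) \<le> T * (2 * \<bar>z - z'\<bar>)" using bT by (intro mult_right_mono) auto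
      finally show ?thesis by simp
    next
      case 3
      have "expectation (\<lambda>\<omega>. (hit j t z \<omega> - hit j s z' \<omega>)\<^sup>2) \<le> expectation (\<lambda>_. 1)"
        by (rule integral_mono) 
          (use pos in \<open>auto simp: hit_def intro!: integrable_const_bound[of _ 1]\<close>)
      hence "?b\<^sup>2 * expectation (\<lambda>\<omega>. (hit j t z \<omega> - hit j s z' \<omega>)\<^sup>2) \<le> ?b\<^sup>2 * 1"
        by (intro mult_left_mono) (auto simp: prob_space)
      also have "\<dots> \<le> (t - s) powr (H/2)"
        unfolding sq[symmetric] using pos 3 H by (simp add: powr_mono2)
      finally have "?b\<^sup>2 * expectation (\<lambda>\<omega>. (hit j t z \<omega> - hit j s z' \<omega>)\<^sup>2) \<le> (t - s) powr (H/2)" .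
      moreover have "0 \<le> 2 * T * \<bar>z - z'\<bar>" "0 \<le> (t - s) powr (H/2)" using assms by auto
      ultimately show ?thesis by linarith
    qed
  qed
  moreover have "?b\<^sup>2 * expectation (\<lambda>\<omega>. (?X \<omega> - ?X' \<omega>)\<^sup>2)
      \<le> ?b\<^sup>2 * expectation (\<lambda>\<omega>. (hit j t z \<omega> - hit j s z' \<omega>)\<^sup>2)"
    using ED by (intro mult_left_mono) auto
  ultimately show ?thesis using E ab by linarith
qed

section \<open>Oscillation of the sample paths\<close>

text \<open>
  Threshold and standard deviation of a level-\<open>k\<close> increment differ by the factor \<open>2\<close> to the power \<open>kH/2\<close>,
  so a high even moment makes each exceptional probability as small a power of \<open>2\<^sup>-\<^sup>k\<close> as desired.
  It has to beat the number of increments, which is of order \<open>2\<^sup>k\<close>, times the number \<open>2\<^sup>k\<close> of paths.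
\<close>

lemma dyadic_increments_small:
  fixes T :: nat
  shows "AE \<omega> in M. \<forall>\<^sub>F k in sequentially. \<forall>j\<in>{..2 ^ k}. \<forall>i\<in>{..<T * 2 ^ k}.
    \<bar>B j (real (Suc i) / 2 ^ k) \<omega> - B j (real i / 2 ^ k) \<omega>\<bar> \<le> (2 powr (- H / 2)) ^ k"
proof -
  \<comment> \<open>The order of the moment: it yields probabilities of the order \<open>8\<^sup>-\<^sup>k\<close> for the order of \<open>4\<^sup>k\<close> events.\<close>
  define q where "q = nat \<lceil>3 / H\<rceil>"
  have q: "H * q \<ge> 3"
  proof -
    have "real q \<ge> 3 / H" unfolding q_def by linarith
    thus ?thesis using H by (simp add: field_simps)
  qed
  define r where "r = 2 powr (- H / 2)"
  have r: "r > 0" by (simp add: r_def)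
  define E where "E = (\<lambda>k j i. {\<omega>\<in>space M. r ^ k < \<bar>B j (real (Suc i) / 2 ^ k) \<omega> - B j (real i / 2 ^ k) \<omega>\<bar>})"
  have Em[measurable]: "E k j i \<in> sets M" for k j i
    unfolding E_def by measurable
  have PE: "prob (E k j i) \<le> normal_even_moment q * (1 / 8) ^ k" for k j i
  proof -
    let ?X = "\<lambda>\<omega>. (B j (real (Suc i) / 2 ^ k) \<omega> - B j (real i / 2 ^ k) \<omega>) / \<bar>real (Suc i) / 2 ^ k - real i / 2 ^ k\<bar> powr H"
    have D: "distributed M lborel ?X std_normal_density"
      by (rule increment_std_normal) (auto simp: field_simps)
    have d: "\<bar>real (Suc i) / 2 ^ k - real i / 2 ^ k\<bar> powr H = (r ^ k)\<^sup>2"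
    proof -
      have "\<bar>real (Suc i) / 2 ^ k - real i / 2 ^ k\<bar> = 1 / 2 ^ k" by (simp add: diff_divide_distrib[symmetric])
      also have "\<dots> = 2 powr (- real k)" by (simp add: powr_minus powr_realpow inverse_eq_divide)
      finally show ?thesis unfolding r_def by (simp add: powr_powr powr_power power2_eq_square powr_add[symmetric] algebra_simps)
    qed
    have X[measurable]: "?X \<in> borel_measurable M" using distributed_measurable[OF D] by simp
    have "prob (E k j i) \<le> prob {\<omega>\<in>space M. 1 / r ^ k \<le> \<bar>?X \<omega>\<bar>}"
    proof (rule finite_measure_mono)
      show "E k j i \<subseteq> {\<omega>\<in>space M. 1 / r ^ k \<le> \<bar>?X \<omega>\<bar>}"
        unfolding E_def d using r by (auto simp: abs_divide field_simps power2_eq_square)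
    qed measurable
    also have "\<dots> \<le> normal_even_moment q / (1 / r ^ k) ^ (2 * q)"
      by (rule std_normal_polynomial_tail[OF D]) (use r in simp)
    also have "\<dots> = normal_even_moment q * (r ^ (2 * q)) ^ k"
      by (simp add: power_divide power_mult[symmetric] mult_ac)
    also have "\<dots> \<le> normal_even_moment q * (1 / 8) ^ k"
    proof (intro mult_left_mono power_mono)
      have "r ^ (2 * q) = 2 powr (- (H * q))" unfolding r_def by (simp add: powr_power mult.commute)
      also have "\<dots> \<le> 2 powr (-3)" using q by (intro powr_mono) auto
      finally show "r ^ (2 * q) \<le> 1 / 8" by (simp add: powr_minus)
    qed (use r in \<open>auto simp: normal_even_moment_def\<close>)
    finally show ?thesis .
  qed
  define A where "A = (\<lambda>k. \<Union>j\<in>{..2 ^ k}. \<Union>i\<in>{..<T * 2 ^ k}. E k j i)"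
  have Am[measurable]: "A k \<in> sets M" for k unfolding A_def by measurable
  have PA: "prob (A k) \<le> 2 * T * normal_even_moment q * (1 / 2) ^ k" for k
  proof -
    have "prob (A k) \<le> (\<Sum>j\<in>{..2 ^ k::nat}. prob (\<Union>i\<in>{..<T * 2 ^ k}. E k j i))"
      unfolding A_def by (rule measure_UNION_le) auto
    also have "\<dots> \<le> (\<Sum>j\<in>{..2 ^ k::nat}. \<Sum>i\<in>{..<T * 2 ^ k}. prob (E k j i))"
      by (intro sum_mono measure_UNION_le) auto
    also have "\<dots> \<le> (\<Sum>j\<in>{..2 ^ k::nat}. \<Sum>i\<in>{..<T * 2 ^ k}. normal_even_moment q * (1 / 8) ^ k)"
      by (intro sum_mono PE)
    also have "\<dots> = (1 + (2::real) ^ k) * (real T * 2 ^ k) * (normal_even_moment q * (1 / 8) ^ k)" by (simp add: algebra_simps)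
    also have "\<dots> \<le> (2 * (2::real) ^ k) * (real T * 2 ^ k) * (normal_even_moment q * (1 / 8) ^ k)"
      by (intro mult_right_mono) (auto simp: normal_even_moment_def)
    also have "\<dots> = 2 * real T * normal_even_moment q * (2 * 2 * (1 / 8)) ^ k"
      by (simp only: power_mult_distrib mult_ac)
    finally show ?thesis by simp
  qed
  have "AE \<omega> in M. \<forall>\<^sub>F k in sequentially. \<omega> \<in> space M - A k"
  proof (rule borel_cantelli_AE1)
    show "summable (\<lambda>k. prob (A k))"
      by (rule summable_comparison_test'[where N=0, OF summable_mult[OF summable_geometric[of "1/2::real"]]])
         (use PA in auto)
  qed (auto simp: emeasure_eq_measure)
  thus ?thesis
  proof (rule AE_mp, intro AE_I2 impI)
    fix \<omega> assume "\<omega> \<in> space M" "\<forall>\<^sub>F k in sequentially. \<omega> \<in> space M - A k"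
    from this(2) show "\<forall>\<^sub>F k in sequentially. \<forall>j\<in>{..2 ^ k}. \<forall>i\<in>{..<T * 2 ^ k}.
      \<bar>B j (real (Suc i) / 2 ^ k) \<omega> - B j (real i / 2 ^ k) \<omega>\<bar> \<le> (2 powr (- H / 2)) ^ k"
      by (rule eventually_mono) (auto simp: A_def E_def r_def not_less)
  qed
qed

text \<open>
  A continuous path is the limit of its values at the dyadic roundings of \<open>t\<close>, and consecutive
  roundings are equal or adjacent grid points, so the increments sum up to a geometric series.
\<close>

lemma dyadic_oscillation_small:
  fixes T :: nat
  shows "\<exists>C>0. AE \<omega> in M. \<forall>\<^sub>F k in sequentially. \<forall>j\<in>{..2 ^ k}. \<forall>t\<in>{0..real T}.
    \<bar>B j t \<omega> - B j (dyad k t) \<omega>\<bar> \<le> C * (2 powr (- H / 2)) ^ k"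
proof -
  define r where "r = 2 powr (- H / 2)"
  have "2 powr (- H / 2) < 2 powr 0" using H by (intro powr_less_mono) auto
  hence r: "0 < r" "r < 1" by (auto simp: r_def)
  define C where "C = 1 / (1 - r)"
  have C: "C > 0" "C * r + 1 = C" using r by (auto simp: C_def field_simps)
  have "AE \<omega> in M. \<forall>\<^sub>F k in sequentially. \<forall>j\<in>{..2 ^ k}. \<forall>t\<in>{0..real T}.
    \<bar>B j t \<omega> - B j (dyad k t) \<omega>\<bar> \<le> C * r ^ k"
  proof (rule AE_mp[OF dyadic_increments_small[of T]], intro AE_I2 impI)
    fix \<omega> assume \<omega>: "\<omega> \<in> space M" and "\<forall>\<^sub>F k in sequentially. \<forall>j\<in>{..2 ^ k}. \<forall>i\<in>{..<T * 2 ^ k}.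
      \<bar>B j (real (Suc i) / 2 ^ k) \<omega> - B j (real i / 2 ^ k) \<omega>\<bar> \<le> (2 powr (- H / 2)) ^ k"
    then obtain k0 where k0: "\<And>k j i. k \<ge> k0 \<Longrightarrow> j \<le> 2 ^ k \<Longrightarrow> i < T * 2 ^ k \<Longrightarrow>
      \<bar>B j (real (Suc i) / 2 ^ k) \<omega> - B j (real i / 2 ^ k) \<omega>\<bar> \<le> r ^ k"
      unfolding eventually_sequentially r_def by blast
    have "\<bar>B j t \<omega> - B j (dyad k t) \<omega>\<bar> \<le> C * r ^ k" if k: "k \<ge> k0" and j: "j \<le> 2 ^ k" and t: "0 \<le> t" "t \<le> real T" for k j t
    proof -
      have step: "\<bar>B j (dyad (Suc l) t) \<omega> - B j (dyad l t) \<omega>\<bar> \<le> r ^ Suc l" if "l \<ge> k" for l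
      proof (cases "dyad (Suc l) t = dyad l t")
        case False
        hence eq: "dyad (Suc l) t = dyad l t + 1 / 2 ^ Suc l" using dyad_Suc_cases by blast
        define m where "m = nat \<lfloor>2 ^ Suc l * t\<rfloor>"
        have m: "dyad (Suc l) t = real m / 2 ^ Suc l" using t by (simp add: dyad_def m_def)
        have "dyad l t \<ge> 0" using t by (simp add: dyad_nonneg)
        hence "real m / 2 ^ Suc l \<ge> 1 / 2 ^ Suc l" using eq m by linarith
        hence "real m \<ge> 1" by (simp add: divide_le_cancel)
        then obtain i where i: "m = Suc i" by (cases m) auto
        have "dyad l t = real i / 2 ^ Suc l" using eq m unfolding i by (simp add: add_divide_distrib)
        moreover have "i < T * 2 ^ Suc l"
        proof -
          have "real m / 2 ^ Suc l \<le> real T" using m dyad_le[of "Suc l" t] t by linarith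
          hence "real m \<le> real (T * 2 ^ Suc l)" by (simp add: field_simps)
          thus ?thesis using i by linarith
        qed
        moreover have "j \<le> 2 ^ Suc l" using j that by (meson le_Suc_eq order_trans one_le_numeral power_increasing)
        ultimately show ?thesis using k0[of "Suc l" j i] k that m i by simp
      qed (use r in simp)
      have part: "\<bar>B j (dyad (k + l) t) \<omega> - B j (dyad k t) \<omega>\<bar> \<le> C * r ^ k - C * r ^ (k + l)" for l
      proof (induction l)
        case (Suc l)
        have "\<bar>B j (dyad (k + Suc l) t) \<omega> - B j (dyad k t) \<omega>\<bar> \<le> r ^ Suc (k + l) + (C * r ^ k - C * r ^ (k + l))"
          using Suc step[of "k + l"] by simp
        also have "r ^ Suc (k + l) \<le> r ^ (k + l)" using r by (intro power_decreasing) auto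
        also have "r ^ (k + l) + (C * r ^ k - C * r ^ (k + l)) = C * r ^ k - C * r ^ (k + Suc l)"
        proof -
          have "r ^ (k + l) * (C * r + 1) = r ^ (k + l) * C" using C by simp
          thus ?thesis by (simp add: algebra_simps)
        qed
        finally show ?case by simp
      qed simp
      have "(\<lambda>l. B j (dyad (k + l) t) \<omega>) \<longlonglongrightarrow> B j t \<omega>"
      proof -
        have "(\<lambda>l. dyad (l + k) t) \<longlonglongrightarrow> t" by (rule LIMSEQ_ignore_initial_segment[OF dyad_tendsto])
        from continuous_on_tendsto_compose[OF continuous_path[OF \<omega>, of j] this] t
        show ?thesis by (simp add: dyad_nonneg add.commute)
      qed
      hence "(\<lambda>l. \<bar>B j (dyad (k + l) t) \<omega> - B j (dyad k t) \<omega>\<bar>) \<longlonglongrightarrow> \<bar>B j t \<omega> - B j (dyad k t) \<omega>\<bar>"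
        by (intro tendsto_intros)
      moreover have "\<bar>B j (dyad (k + l) t) \<omega> - B j (dyad k t) \<omega>\<bar> \<le> C * r ^ k" for l
      proof -
        have "0 \<le> C * r ^ (k + l)" using C r by simp
        thus ?thesis using part[of l] by linarith
      qed
      ultimately show ?thesis by (intro LIMSEQ_le_const2[where X="\<lambda>l. \<bar>B j (dyad (k + l) t) \<omega> - B j (dyad k t) \<omega>\<bar>"]) auto
    qed
    thus "\<forall>\<^sub>F k in sequentially. \<forall>j\<in>{..2 ^ k}. \<forall>t\<in>{0..real T}. \<bar>B j t \<omega> - B j (dyad k t) \<omega>\<bar> \<le> C * r ^ k"
      unfolding eventually_sequentially by (auto intro!: exI[of _ k0])
  qed
  thus ?thesis using C unfolding r_def by blast
qed

end

section \<open>Comparison with the values on a dyadic grid\<close>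

context fbm_sample
begin

definition dev :: "nat \<Rightarrow> real \<Rightarrow> real \<Rightarrow> 'a \<Rightarrow> real" where
  "dev n t z \<omega> = (\<Sum>j=1..n. hit j t z \<omega> - Phi z)"

text \<open>
  The grid for sample sizes up to \<open>2\<^sup>m\<close> has level \<open>mesh * m\<close>. The constant \<open>6 / H\<close> brings the path
  oscillation at this level down to \<open>8\<^sup>-\<^sup>m\<close>: one factor \<open>2\<^sup>-\<^sup>m\<close> is lost in the division by
  \<open>t\<close> to the power \<open>H\<close>, one is the admissible shift of the space variable, and the last absorbs constants.
\<close>

definition mesh :: nat where
  "mesh = nat \<lceil>6 / H\<rceil>"

lemma mesh_ge: "6 \<le> H * mesh"
proof -
  have "6 / H \<le> real mesh" unfolding mesh_def by linarith
  thus ?thesis using H by (simp add: field_simps)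
qed

lemma mesh_ge_6: "6 \<le> mesh"
proof -
  have "6 \<le> H * mesh" by (rule mesh_ge)
  also have "\<dots> \<le> 1 * real mesh" using H by (intro mult_right_mono) auto
  finally show ?thesis by simp
qed

text \<open>
  Admissible times are so large, relative to the grid, that rounding at most halves them.
\<close>

lemma half_time:
  assumes m: "1 \<le> m" and t: "0 < t" "(1 / 2) ^ m \<le> t powr H"
  shows "t \<le> 2 * dyad (mesh * m) t" "(1 / 2) ^ m / 2 \<le> dyad (mesh * m) t powr H"
proof -
  let ?K = "mesh * m"
  have "(1 / 2) ^ m = 2 powr (- real m)" by (simp add: powr_minus powr_realpow power_one_over inverse_eq_divide)
  hence "2 powr (- real m) \<le> t powr H" using t by simp
  hence "(2 powr (- real m)) powr (1 / H) \<le> (t powr H) powr (1 / H)" using H by (intro powr_mono2) auto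
  hence tl: "2 powr (- real m / H) \<le> t" using H t by (simp add: powr_powr)
  have "1 / 2 ^ ?K = 2 powr (- real ?K)"
    by (simp add: powr_minus powr_realpow inverse_eq_divide del: of_nat_mult)
  also have "\<dots> \<le> 2 powr (- 1 - real m / H)"
  proof (intro powr_mono)
    have "6 * real m \<le> H * real mesh * real m" using mesh_ge by (intro mult_right_mono) auto
    hence "6 * real m / H \<le> real ?K" using H by (simp add: field_simps)
    moreover have "1 * 1 \<le> real m * (1 / H)" using m H by (intro mult_mono) (auto simp: field_simps)
    hence "1 + real m / H \<le> 6 * real m / H" by simp
    ultimately show "- real ?K \<le> - 1 - real m / H" by linarith
  qed simp
  also have "\<dots> = 2 powr (- real m / H) / 2" by (simp add: powr_diff powr_minus field_simps)
  also have "\<dots> \<le> t / 2" using tl by simp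
  finally have "1 / 2 ^ ?K \<le> t / 2" .
  thus *: "t \<le> 2 * dyad ?K t" using dyad_gt[of t ?K] by linarith
  have "(1 / 2) ^ m / 2 \<le> t powr H / 2 powr H"
  proof (rule frac_le)
    show "2 powr H \<le> 2" using powr_mono[of H 1 2] H by simp
  qed (use t in auto)
  also have "\<dots> = (t / 2) powr H" using t by (simp add: powr_divide)
  also have "\<dots> \<le> dyad ?K t powr H" using * t H by (intro powr_mono2) auto
  finally show "(1 / 2) ^ m / 2 \<le> dyad ?K t powr H" .
qed

text \<open>
  Replacing \<open>t\<close> by its rounding shifts the normalised positions of all relevant paths by at most
  \<open>2\<^sup>-\<^sup>m\<close>. Indicators of half-lines are monotone in the space variable, so enlarging or shrinking
  \<open>z\<close> by this amount, and then rounding it, gives bounds for every summand. The centring changes by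
  at most \<open>2 / 2\<^sup>m\<close> for each of at most \<open>2\<^sup>m\<close> summands, whence the error \<open>2\<close>.
\<close>

lemma dev_between_grid_values:
  fixes T :: nat and t z Z C :: real
  assumes m: "1 \<le> m" and Z: "0 \<le> Z" and C: "0 < C" and large: "2 * (Z + C) \<le> 2 ^ m"
    and osc: "\<forall>j\<in>{..2 ^ (mesh * m)}. \<forall>t\<in>{0..real T}.
      \<bar>B j t \<omega> - B j (dyad (mesh * m) t) \<omega>\<bar> \<le> C * (2 powr (- H / 2)) ^ (mesh * m)"
    and n: "n \<le> 2 ^ m" and t: "0 < t" "t \<le> T" "(1 / 2) ^ m \<le> t powr H" and z: "\<bar>z\<bar> \<le> Z"
  shows "dev n t z \<omega> \<le> dev n (dyad (mesh * m) t) (dyad (mesh * m) (z + 2 / 2 ^ m)) \<omega> + 2"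
    and "dev n (dyad (mesh * m) t) (dyad (mesh * m) (z - 1 / 2 ^ m)) \<omega> - 2 \<le> dev n t z \<omega>"
proof -
  define K where "K = mesh * m"
  define s where "s = dyad K t"
  define w where "w = C * (2 powr (- H / 2)) ^ K"
  note ht = half_time[OF m t(1,3), folded K_def, folded s_def]
  have s: "0 < s" "s \<le> t" using ht t dyad_le[of K t] by (auto simp: s_def)
  have mK: "m \<le> K" unfolding K_def using mesh_ge_6 by simp
  have rK: "(2 powr (- H / 2)) ^ K \<le> (1 / 8) ^ m"
  proof -
    have "(2 powr (- H / 2)) ^ K = 2 powr (- (H * mesh / 2) * m)"
      by (simp add: powr_power K_def mult_ac)
    also have "\<dots> \<le> 2 powr (- 3 * real m)" using mesh_ge by (intro powr_mono mult_right_mono) auto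
    also have "\<dots> = (2 powr (- 3)) ^ m" by (simp add: powr_power mult.commute)
    finally show ?thesis by (simp add: powr_minus)
  qed
  have tH: "0 \<le> t powr H - s powr H" "t powr H - s powr H \<le> (2 powr (- H / 2)) ^ K"
  proof -
    show "0 \<le> t powr H - s powr H" using s H by (simp add: powr_mono2)
    have "t - s \<le> 1 / 2 ^ K" using dyad_gt[of t K] by (simp add: s_def)
    have "t powr H - s powr H \<le> (t - s) powr H" using s H by (intro powr_diff_le) auto
    also have "\<dots> \<le> (1 / 2 ^ K) powr H" using s H \<open>t - s \<le> 1 / 2 ^ K\<close> by (intro powr_mono2) auto
    also have "\<dots> = 2 powr (- H * K)"
      by (simp add: powr_divide powr_realpow[symmetric] powr_powr powr_minus inverse_eq_divide mult.commute)
    also have "\<dots> \<le> 2 powr (- H / 2 * K)" using H by (intro powr_mono mult_right_mono) auto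
    also have "\<dots> = (2 powr (- H / 2)) ^ K" by (simp add: powr_power mult.commute)
    finally show "t powr H - s powr H \<le> (2 powr (- H / 2)) ^ K" .
  qed
  have eps: "Z * (t powr H - s powr H) + w \<le> s powr H * (1 / 2 ^ m)"
  proof -
    have "Z * (t powr H - s powr H) + w \<le> (Z + C) * (2 powr (- H / 2)) ^ K"
      unfolding w_def distrib_right using tH Z C by (intro add_mono mult_left_mono) auto
    also have "\<dots> \<le> (2 ^ m / 2) * (1 / 8) ^ m" using rK large Z C by (intro mult_mono) auto
    also have "\<dots> = ((1 / 2) ^ m / 2) * (1 / 2) ^ m"
    proof -
      have "(2::real) ^ m * (1 / 8) ^ m = (1 / 2) ^ m * (1 / 2) ^ m"
        by (simp only: power_mult_distrib[symmetric]) simp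
      thus ?thesis by simp
    qed
    also have "\<dots> \<le> s powr H * (1 / 2) ^ m" using ht by (intro mult_right_mono) auto
    finally show ?thesis by (simp add: power_one_over)
  qed
  have zd: "\<bar>z * (t powr H - s powr H)\<bar> \<le> Z * (t powr H - s powr H)"
    using z tH by (simp add: abs_mult mult_right_mono)
  have Bd: "\<bar>B j t \<omega> - B j s \<omega>\<bar> \<le> w" if "j \<in> {1..n}" for j
  proof -
    have "j \<le> 2 ^ m" using that n by auto
    also have "2 ^ m \<le> (2::nat) ^ K" using mK by (intro power_increasing) auto
    finally show ?thesis using osc t by (auto simp: w_def s_def K_def)
  qed
  have N: "(2::real) ^ m > 0" by simp
  have up: "hit j t z \<omega> \<le> hit j s z' \<omega>" if "j \<in> {1..n}" "z + 1 / 2 ^ m \<le> z'" for j z'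
  proof -
    have "B j s \<omega> \<le> s powr H * z'" if "B j t \<omega> \<le> t powr H * z"
    proof -
      have "B j s \<omega> \<le> t powr H * z + w" using Bd[of j] that \<open>j \<in> {1..n}\<close> by force
      also have "t powr H * z + w = s powr H * z + z * (t powr H - s powr H) + w" by (simp add: algebra_simps)
      also have "\<dots> \<le> s powr H * z + s powr H * (1 / 2 ^ m)" using zd eps by linarith
      also have "\<dots> = s powr H * (z + 1 / 2 ^ m)" by (simp add: distrib_left)
      also have "\<dots> \<le> s powr H * z'" using \<open>z + 1 / 2 ^ m \<le> z'\<close> by (intro mult_left_mono) auto
      finally show ?thesis .
    qed
    thus ?thesis by (auto simp: hit_def)
  qed
  have down: "hit j s z' \<omega> \<le> hit j t z \<omega>" if "j \<in> {1..n}" "z' \<le> z - 1 / 2 ^ m" for j z'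
  proof -
    have "B j t \<omega> \<le> t powr H * z" if "B j s \<omega> \<le> s powr H * z'"
    proof -
      have "s powr H * z' \<le> s powr H * (z - 1 / 2 ^ m)" using \<open>z' \<le> z - 1 / 2 ^ m\<close> by (intro mult_left_mono) auto
      also have "\<dots> = s powr H * z - s powr H * (1 / 2 ^ m)" by (simp add: right_diff_distrib)
      also have "\<dots> \<le> s powr H * z + z * (t powr H - s powr H) - w" using zd eps by linarith
      also have "\<dots> = t powr H * z - w" by (simp add: algebra_simps)
      finally show ?thesis using Bd[of j] that \<open>j \<in> {1..n}\<close> by force
    qed
    thus ?thesis by (auto simp: hit_def)
  qed
  have KN: "1 / 2 ^ K \<le> 1 / (2::real) ^ m" using mK by (intro divide_left_mono power_increasing) auto
  have nN: "real n * (2 / 2 ^ m) \<le> 2"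
  proof -
    have "real n \<le> real (2 ^ m)" using n by (rule of_nat_mono)
    thus ?thesis by (simp add: field_simps)
  qed
  show "dev n t z \<omega> \<le> dev n (dyad (mesh * m) t) (dyad (mesh * m) (z + 2 / 2 ^ m)) \<omega> + 2"
  proof -
    define z' where "z' = dyad K (z + 2 / 2 ^ m)"
    have z': "z + 1 / 2 ^ m \<le> z'" "z' \<le> z + 2 / 2 ^ m"
      using dyad_gt[of "z + 2 / 2 ^ m" K] dyad_le[of K "z + 2 / 2 ^ m"] KN by (auto simp: z'_def)
    have "dev n t z \<omega> \<le> (\<Sum>j=1..n. (hit j s z' \<omega> - Phi z') + 2 / 2 ^ m)"
      unfolding dev_def
    proof (rule sum_mono)
      fix j assume "j \<in> {1..n}"
      moreover have "z \<le> z'" using z' N by (smt (verit) divide_pos_pos)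
      ultimately show "hit j t z \<omega> - Phi z \<le> hit j s z' \<omega> - Phi z' + 2 / 2 ^ m"
        using up[of j z'] Phi_Lipschitz_le[of z z'] z' by linarith
    qed
    also have "\<dots> = dev n s z' \<omega> + real n * (2 / 2 ^ m)" by (simp add: dev_def sum.distrib)
    finally show ?thesis using nN by (simp add: s_def z'_def K_def)
  qed
  show "dev n (dyad (mesh * m) t) (dyad (mesh * m) (z - 1 / 2 ^ m)) \<omega> - 2 \<le> dev n t z \<omega>"
  proof -
    define z' where "z' = dyad K (z - 1 / 2 ^ m)"
    have "1 / 2 ^ m + 1 / 2 ^ m = 2 / (2::real) ^ m" by simp
    hence z': "z' \<le> z - 1 / 2 ^ m" "z - 2 / 2 ^ m \<le> z'"
      using dyad_gt[of "z - 1 / 2 ^ m" K] dyad_le[of K "z - 1 / 2 ^ m"] KN by (auto simp: z'_def)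
    have "(\<Sum>j=1..n. (hit j s z' \<omega> - Phi z') - 2 / 2 ^ m) \<le> dev n t z \<omega>"
      unfolding dev_def
    proof (rule sum_mono)
      fix j assume "j \<in> {1..n}"
      moreover have "z' \<le> z" using z' N by (smt (verit) divide_pos_pos)
      ultimately show "hit j s z' \<omega> - Phi z' - 2 / 2 ^ m \<le> hit j t z \<omega> - Phi z"
        using down[of j z'] Phi_Lipschitz_le[of z' z] z' by linarith
    qed
    moreover have "(\<Sum>j=1..n. (hit j s z' \<omega> - Phi z') - 2 / 2 ^ m) = dev n s z' \<omega> - real n * (2 / 2 ^ m)"
      by (simp add: dev_def sum_subtractf)
    ultimately show ?thesis using nN by (simp add: s_def z'_def K_def)
  qed
qed

end

section \<open>Chaining and the law of the iterated logarithm\<close>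

lemma card_int_dyadic:
  "real (card {0..int T * 2 ^ k}) \<le> real (T + 1) * 2 ^ k"
  "real (card {- (int Z * 2 ^ k)..int Z * 2 ^ k}) \<le> real (2 * Z + 1) * 2 ^ k"
proof -
  have "(1::real) \<le> 2 ^ k" by simp
  thus "real (card {0..int T * 2 ^ k}) \<le> real (T + 1) * 2 ^ k"
    "real (card {- (int Z * 2 ^ k)..int Z * 2 ^ k}) \<le> real (2 * Z + 1) * 2 ^ k"
    by (simp_all add: nat_add_distrib nat_mult_distrib nat_power_eq algebra_simps)
qed

lemma floor_dyadic_range:
  assumes "\<bar>z\<bar> \<le> real Z"
  shows "\<lfloor>2 ^ k * z\<rfloor> \<in> {- (int Z * 2 ^ k)..int Z * 2 ^ k}"
proof -
  have "2 ^ k * z \<le> 2 ^ k * real Z" "2 ^ k * - real Z \<le> 2 ^ k * z"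
    by (rule mult_left_mono; use assms in \<open>simp add: abs_le_iff; linarith\<close>)+
  hence "2 ^ k * z \<le> real_of_int (int Z * 2 ^ k)" "real_of_int (- (int Z * 2 ^ k)) \<le> 2 ^ k * z"
    by (simp_all add: mult.commute)
  from this[THEN floor_mono] show ?thesis by (simp only: floor_of_int atLeastAtMost_iff)
qed

lemma floor_dyadic_nonneg: "0 \<le> t \<Longrightarrow> t \<le> real T \<Longrightarrow> \<lfloor>2 ^ k * t\<rfloor> \<in> {0..int T * 2 ^ k}"
proof -
  assume t: "0 \<le> t" "t \<le> real T"
  hence "\<bar>t\<bar> \<le> real T" by simp
  hence "\<lfloor>2 ^ k * t\<rfloor> \<le> int T * 2 ^ k" using floor_dyadic_range[of t T k] unfolding atLeastAtMost_iff by blast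
  moreover have "0 \<le> \<lfloor>2 ^ k * t\<rfloor>" using t by simp
  ultimately show ?thesis unfolding atLeastAtMost_iff by blast
qed

lemma sum_inverse_squares_le_2: "(\<Sum>k\<le>K. 1 / (real k + 1)\<^sup>2) \<le> 2 - 1 / (real K + 1)"
proof (induction K)
  case (Suc K)
  have "1 / (real K + 2)\<^sup>2 \<le> 1 / ((real K + 1) * (real K + 2))"
    unfolding power2_eq_square by (intro divide_left_mono mult_right_mono) auto
  also have "\<dots> = 1 / (real K + 1) - 1 / (real K + 2)" by (simp add: field_simps)
  finally show ?case using Suc by (simp add: add.commute)
qed simp

lemma polynomial_times_geometric_bounded:
  assumes "0 < r" "r < 1"
  obtains c :: real where "c > 0" "\<And>k. (real k + 1) ^ 5 * r ^ k \<le> c"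
proof -
  define q where "q = - ln r"
  have q: "q > 0" using assms by (simp add: q_def)
  have "(\<lambda>k::nat. (real k + 1) ^ 5 * exp (- q * real k)) \<longlonglongrightarrow> 0" using q by real_asymp
  moreover have "exp (- q * real k) = r ^ k" for k
    using assms by (simp add: q_def exp_of_nat_mult[symmetric] mult.commute ln_realpow[symmetric])
  ultimately have "Bseq (\<lambda>k. (real k + 1) ^ 5 * r ^ k)"
    by (intro convergent_imp_Bseq convergentI) simp
  then obtain c where "c > 0" "\<And>k. norm ((real k + 1) ^ 5 * r ^ k) \<le> c" by (rule BseqE) blast
  thus thesis using that[of c] by (auto simp: abs_le_iff)
qed

context fbm_sample
begin

lemma wdev_link_tail:
  assumes st: "0 \<le> s" "s \<le> t" "t \<le> T" "1 \<le> T"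
    and V: "8 * (t - s) powr (H / 2) + 4 * T * \<bar>z - z'\<bar> \<le> V"
    and \<theta>: "0 \<le> \<theta>" "\<theta> * (2 * T) \<le> 1"
  shows "prob {\<omega>\<in>space M. \<exists>n\<in>{..N}. l \<le> \<bar>\<Sum>j=1..n. wdev j t z \<omega> - wdev j s z' \<omega>\<bar>}
      \<le> 2 * exp (\<theta>\<^sup>2 * V * N - \<theta> * l)"
proof (rule maximal_exponential_inequality_abs[OF _ _ _ _ \<theta>])
  show "indep_vars (\<lambda>_. borel) (\<lambda>j \<omega>. wdev j t z \<omega> - wdev j s z' \<omega>) UNIV"
    unfolding wdev_def by (rule hit_linear_indep) (use st in auto)
  fix j
  have "\<bar>wdev j t z \<omega> - wdev j s z' \<omega>\<bar> \<le> 2 * T" for \<omega>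
    using wdev_abs_le[of t T j z \<omega>] wdev_abs_le[of s T j z' \<omega>] st by linarith
  thus "AE \<omega> in M. \<bar>wdev j t z \<omega> - wdev j s z' \<omega>\<bar> \<le> 2 * T" by simp
  show "expectation (\<lambda>\<omega>. wdev j t z \<omega> - wdev j s z' \<omega>) = 0"
    using st by (simp add: wdev_integrable wdev_expectation)
  show "expectation (\<lambda>\<omega>. (wdev j t z \<omega> - wdev j s z' \<omega>)\<^sup>2) \<le> V"
    using wdev_increment_second_moment[of s t T j z z'] st V by simp
qed

text \<open>
  The increment of the weighted deviation from a grid point of level \<open>k\<close> to its parent of level
  \<open>k - 1\<close>. At level \<open>0\<close> the parent is the time \<open>0\<close>, where the weighted deviation vanishes, so that
  the links from level \<open>0\<close> on sum up to the weighted deviation itself.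
\<close>

definition link :: "nat \<Rightarrow> int \<Rightarrow> int \<Rightarrow> nat \<Rightarrow> 'a \<Rightarrow> real" where
  "link k a b j \<omega> = wdev j (a / 2 ^ k) (b / 2 ^ k) \<omega> -
     (if k = 0 then wdev j 0 b \<omega>
      else wdev j (real_of_int (a div 2) / 2 ^ (k - 1)) (real_of_int (b div 2) / 2 ^ (k - 1)) \<omega>)"

lemma link_measurable [measurable]: "0 \<le> a \<Longrightarrow> link k a b j \<in> borel_measurable M"
proof -
  assume "0 \<le> a"
  hence [measurable]: "wdev j (real_of_int a / 2 ^ k) z \<in> borel_measurable M"
    "wdev j (real_of_int (a div 2) / 2 ^ l) z \<in> borel_measurable M" "wdev j 0 z \<in> borel_measurable M" for z l
    by auto
  show ?thesis unfolding link_def by measurable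
qed

lemma sum_links:
  "(\<Sum>k\<le>K. link k \<lfloor>2 ^ k * t\<rfloor> \<lfloor>2 ^ k * z\<rfloor> j \<omega>) = wdev j (dyad K t) (dyad K z) \<omega>"
proof (induction K)
  case 0
  show ?case by (simp add: link_def dyad_def) (simp add: wdev_def)
next
  case (Suc K)
  have "link (Suc K) \<lfloor>2 ^ Suc K * t\<rfloor> \<lfloor>2 ^ Suc K * z\<rfloor> j \<omega>
    = wdev j (dyad (Suc K) t) (dyad (Suc K) z) \<omega> - wdev j (dyad K t) (dyad K z) \<omega>"
    by (simp add: link_def dyad_parent[of K] del: power_Suc) (simp add: dyad_def)
  thus ?case using Suc by simp
qed

lemma div2_grid_gap:
  fixes a :: int
  assumes "0 < k"
  shows "real_of_int (a div 2) / 2 ^ (k - 1) \<le> real_of_int a / 2 ^ k"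
    "real_of_int a / 2 ^ k - real_of_int (a div 2) / 2 ^ (k - 1) \<le> 1 / 2 ^ k"
proof -
  obtain l where l: "k = Suc l" using assms by (cases k) auto
  have "a = 2 * (a div 2) + a mod 2" by simp
  hence "real_of_int a = 2 * real_of_int (a div 2) + real_of_int (a mod 2)"
    by (metis of_int_add of_int_mult of_int_numeral)
  hence "real_of_int a / 2 ^ k = real_of_int (a div 2) / 2 ^ (k - 1) + real_of_int (a mod 2) / 2 ^ k"
    by (simp add: l add_divide_distrib)
  moreover have "0 \<le> real_of_int (a mod 2) / 2 ^ k" by simp
  moreover have "real_of_int (a mod 2) / 2 ^ k \<le> 1 / 2 ^ k"
  proof (rule divide_right_mono)
    have "a mod 2 \<le> 1" by presburger
    thus "real_of_int (a mod 2) \<le> 1" by simp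
  qed simp
  ultimately show "real_of_int (a div 2) / 2 ^ (k - 1) \<le> real_of_int a / 2 ^ k"
    "real_of_int a / 2 ^ k - real_of_int (a div 2) / 2 ^ (k - 1) \<le> 1 / 2 ^ k" by linarith+
qed

lemma link_tail:
  fixes T N :: nat and \<theta> l :: real
  assumes T: "1 \<le> T" and a: "a \<in> {0..int T * 2 ^ k}" and \<theta>: "0 \<le> \<theta>" "\<theta> * (2 * real T) \<le> 1"
  shows "prob {\<omega>\<in>space M. \<exists>n\<in>{..N}. l \<le> \<bar>\<Sum>j=1..n. link k a b j \<omega>\<bar>}
      \<le> 2 * exp (\<theta>\<^sup>2 * (12 * real T * (2 powr (- H / 2)) ^ k) * N - \<theta> * l)"
proof (cases "k = 0")
  case True
  have "8 * (real_of_int a) powr (H / 2) \<le> 8 * real T"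
    using a T H True by (intro mult_left_mono powr_time_le) auto
  hence "8 * (real_of_int a - 0) powr (H / 2) + 4 * real T * \<bar>real_of_int b - real_of_int b\<bar> \<le> 12 * real T * (2 powr (- H / 2)) ^ k"
    using True T by simp
  from wdev_link_tail[OF _ _ _ _ this \<theta>, of N l] a T True show ?thesis by (simp add: link_def)
next
  case False
  hence k: "0 < k" by simp
  note ga = div2_grid_gap[OF k, of a] and gb = div2_grid_gap[OF k, of b]
  let ?t = "real_of_int a / 2 ^ k" and ?s = "real_of_int (a div 2) / 2 ^ (k - 1)"
  let ?z = "real_of_int b / 2 ^ k" and ?z' = "real_of_int (b div 2) / 2 ^ (k - 1)"
  define r where "r = 2 powr (- H / 2)"
  have p: "(1 / 2 ^ k) powr (H / 2) = r ^ k"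
    unfolding r_def by (simp add: powr_divide powr_realpow[symmetric] powr_powr powr_minus inverse_eq_divide powr_power mult.commute)
  have V: "8 * (?t - ?s) powr (H / 2) + 4 * real T * \<bar>?z - ?z'\<bar> \<le> 12 * real T * r ^ k"
  proof -
    have "(?t - ?s) powr (H / 2) \<le> r ^ k" unfolding p[symmetric] using ga H by (intro powr_mono2) auto
    moreover have "1 * r ^ k \<le> real T * r ^ k" using T by (intro mult_right_mono) (auto simp: r_def)
    ultimately have "8 * (?t - ?s) powr (H / 2) \<le> 8 * real T * r ^ k" by linarith
    moreover have "\<bar>?z - ?z'\<bar> \<le> r ^ k"
    proof -
      have "\<bar>?z - ?z'\<bar> \<le> 1 / 2 ^ k" using gb by linarith
      also have "\<dots> \<le> (1 / 2 ^ k) powr (H / 2)" using powr_mono'[of "H/2" 1 "1 / 2 ^ k"] H by simp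
      finally show ?thesis by (simp only: p)
    qed
    hence "4 * real T * \<bar>?z - ?z'\<bar> \<le> 4 * real T * r ^ k" by (intro mult_left_mono) auto
    ultimately show ?thesis by simp
  qed
  have s0: "0 \<le> ?s" using a by auto
  have tT: "?t \<le> real T"
  proof -
    have "real_of_int a \<le> real_of_int (int T * 2 ^ k)" using a by (intro of_int_le_iff[THEN iffD2]) auto
    thus ?thesis by (simp add: field_simps)
  qed
  have T1: "1 \<le> real T" using T by simp
  have "link k a b j \<omega> = wdev j ?t ?z \<omega> - wdev j ?s ?z' \<omega>" for j \<omega>
    using k by (simp add: link_def)
  thus ?thesis using wdev_link_tail[OF s0 ga(1) tT T1 V \<theta>, of N l] by (simp only: r_def)
qed

text \<open>
  The variance of a link decays geometrically in the level \<open>k\<close>, while the number of links grows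
  geometrically. Allowing the sum of the level-\<open>k\<close> links the size \<open>1 / (k + 1)\<^sup>2\<close> (summable in \<open>k\<close>) times
  \<open>\<surd>(2\<^sup>m log m)\<close>, the maximal inequality gives the exponent \<open>-5 (k + 1) log m\<close>. This beats the
  number of links of level \<open>k\<close> and still leaves \<open>m\<^sup>-\<^sup>2\<close>, which is summable over the blocks of
  sample sizes up to \<open>2\<^sup>m\<close>. As \<open>log m\<close> is of the order of \<open>log log n\<close> on such a block, the iterated
  logarithm appears.
\<close>

lemma weighted_iterated_log_on_grid:
  fixes T Z :: nat
  assumes T: "1 \<le> T"
  shows "\<exists>A>0. AE \<omega> in M. \<forall>\<^sub>F m in sequentially. \<forall>n\<in>{..2 ^ m}. \<forall>t\<in>{0..real T}. \<forall>z\<in>{- real Z..real Z}.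
    dyad (mesh * m) t powr (H / 4) * \<bar>dev n (dyad (mesh * m) t) (dyad (mesh * m) z) \<omega>\<bar>
      \<le> A * sqrt (2 ^ m * ln (real m))"
proof -
  define r where "r = 2 powr (- H / 2)"
  have "2 powr (- H / 2) < 2 powr 0" using H by (intro powr_less_mono) auto
  hence r: "0 < r" "r < 1" by (auto simp: r_def)
  obtain c where c: "c > 0" "\<And>k. (real k + 1) ^ 5 * r ^ k \<le> c"
    using polynomial_times_geometric_bounded[OF r] by blast
  define A where "A = 12 * real T * c + 5"
  have A: "A > 0" using c by (simp add: A_def add_nonneg_pos)
  define lev where "lev = (\<lambda>m k. A / (real k + 1)\<^sup>2 * sqrt (2 ^ m * ln (real m)))"
  define E where "E = (\<lambda>m k a b. {\<omega>\<in>space M. \<exists>n\<in>{..2 ^ m}. lev m k \<le> \<bar>\<Sum>j=1..n. link k a b j \<omega>\<bar>})"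
  define U where "U = (\<lambda>m. \<Union>k\<in>{..mesh * m}. \<Union>a\<in>{0..int T * 2 ^ k}. \<Union>b\<in>{- (int Z * 2 ^ k)..int Z * 2 ^ k}. E m k a b)"
  have Em: "E m k a b \<in> sets M" if "a \<in> {0..int T * 2 ^ k}" for m k a b
  proof -
    have "0 \<le> a" using that by simp
    thus ?thesis unfolding E_def by measurable
  qed
  have Um: "U m \<in> sets M" for m
    unfolding U_def by (intro sets.finite_UN Em) auto
  have PE: "prob (E m k a b) \<le> 2 * (1 / (real m)\<^sup>2) * exp (- 3 * real k)"
    if m: "3 \<le> m" and a: "a \<in> {0..int T * 2 ^ k}"
      and small: "(real k + 1) ^ 3 * sqrt (ln (real m) / 2 ^ m) * (2 * real T) \<le> 1" for m k a b
  proof -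
    define L where "L = ln (real m)"
    have "exp 1 \<le> real m" using m exp_le by linarith
    hence L: "1 \<le> L" using m unfolding L_def by (subst ln_ge_iff) auto
    \<comment> \<open>The power \<open>3\<close> exceeds the power \<open>2\<close> in \<open>lev\<close> by one, which makes the linear term of the
      exponent proportional to \<open>k + 1\<close>; the geometric decay of the variance absorbs \<open>\<theta>\<^sup>2\<close>.\<close>
    define \<theta> where "\<theta> = (real k + 1) ^ 3 * sqrt (L / 2 ^ m)"
    have "prob (E m k a b) \<le> 2 * exp (\<theta>\<^sup>2 * (12 * real T * r ^ k) * real (2 ^ m) - \<theta> * lev m k)"
      unfolding E_def r_def by (rule link_tail[OF T a]) (use small L in \<open>auto simp: \<theta>_def L_def\<close>)
    also have "2 * exp (\<theta>\<^sup>2 * (12 * real T * r ^ k) * real (2 ^ m) - \<theta> * lev m k) \<le> 2 * exp (- 2 * L + - 3 * real k)"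
    proof (intro mult_left_mono exp_mono)
      define x where "x = real k + 1"
      have x: "x > 0" by (simp add: x_def)
      have "\<theta>\<^sup>2 = x ^ 6 * (L / 2 ^ m)"
        using L by (simp add: \<theta>_def x_def power_mult_distrib power_mult[symmetric])
      hence "\<theta>\<^sup>2 * 2 ^ m = x ^ 6 * L" by simp
      moreover have "x ^ 6 = x ^ 5 * x" by (simp add: eval_nat_numeral)
      ultimately have "12 * real T * r ^ k * (\<theta>\<^sup>2 * 2 ^ m) = 12 * real T * (x ^ 5 * r ^ k) * (x * L)"
        by (simp add: mult_ac)
      also have "\<dots> \<le> 12 * real T * c * (x * L)"
        using L x c(2)[of k] by (intro mult_right_mono mult_left_mono) (auto simp: x_def)
      finally have 1: "12 * real T * r ^ k * (\<theta>\<^sup>2 * 2 ^ m) \<le> 12 * real T * c * (x * L)" .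
      have 2: "\<theta>\<^sup>2 * (12 * real T * r ^ k) * real (2 ^ m) = 12 * real T * r ^ k * (\<theta>\<^sup>2 * 2 ^ m)"
        by (simp add: mult_ac)
      have sL: "sqrt (L / 2 ^ m) * sqrt (2 ^ m * L) = L" using L by (simp add: real_sqrt_mult[symmetric])
      have "\<theta> * lev m k = (x ^ 3 * (A / x\<^sup>2)) * (sqrt (L / 2 ^ m) * sqrt (2 ^ m * L))"
        unfolding \<theta>_def lev_def L_def[symmetric] x_def[symmetric] by (simp only: mult_ac)
      also have "x ^ 3 * (A / x\<^sup>2) = A * x" using x by (simp add: power3_eq_cube power2_eq_square)
      finally have 3: "\<theta> * lev m k = A * (x * L)" unfolding sL by simp
      have 4: "A * (x * L) = 12 * real T * c * (x * L) + 5 * (x * L)" by (simp add: A_def distrib_right)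
      have "real k * 1 \<le> real k * L" using L by (intro mult_left_mono) auto
      moreover have "x * L = real k * L + L" by (simp add: x_def distrib_right)
      ultimately have "3 * real k + 2 * L \<le> 5 * (x * L)" using L by linarith
      thus "\<theta>\<^sup>2 * (12 * real T * r ^ k) * real (2 ^ m) - \<theta> * lev m k \<le> - 2 * L + - 3 * real k"
        using 1 2 3 4 by linarith
    qed simp
    also have "exp (- 2 * L + - 3 * real k) = 1 / (real m)\<^sup>2 * exp (- 3 * real k)"
    proof -
      have "exp (- 2 * L) = 1 / (exp L)\<^sup>2" by (simp add: exp_minus exp_double inverse_eq_divide)
      hence "exp (- 2 * L) = 1 / (real m)\<^sup>2" using m by (simp add: L_def)
      thus ?thesis by (simp only: exp_add)
    qed
    finally show ?thesis by simp
  qed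
  have PU: "prob (U m) \<le> 4 * real ((T + 1) * (2 * Z + 1)) * (1 / (real m)\<^sup>2)"
    if m: "3 \<le> m" and small: "(real (mesh * m) + 1) ^ 3 * sqrt (ln (real m) / 2 ^ m) * (2 * real T) \<le> 1" for m
  proof -
    have sm: "(real k + 1) ^ 3 * sqrt (ln (real m) / 2 ^ m) * (2 * real T) \<le> 1" if "k \<le> mesh * m" for k
    proof -
      have "real k \<le> real (mesh * m)" using that by (rule of_nat_mono)
      hence "(real k + 1) ^ 3 * sqrt (ln (real m) / 2 ^ m) * (2 * real T) \<le> (real (mesh * m) + 1) ^ 3 * sqrt (ln (real m) / 2 ^ m) * (2 * real T)"
        using m by (intro mult_right_mono power_mono) auto
      thus ?thesis using small by linarith
    qed
    let ?q = "2 * (1 / (real m)\<^sup>2)"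
    have "prob (U m) \<le> (\<Sum>k\<le>mesh * m. prob (\<Union>a\<in>{0..int T * 2 ^ k}. \<Union>b\<in>{- (int Z * 2 ^ k)..int Z * 2 ^ k}. E m k a b))"
      unfolding U_def by (rule measure_UNION_le) (auto intro!: sets.finite_UN Em)
    also have "\<dots> \<le> (\<Sum>k\<le>mesh * m. real ((T + 1) * (2 * Z + 1)) * ?q * (1 / 2) ^ k)"
    proof (rule sum_mono)
      fix k assume k: "k \<in> {..mesh * m}"
      have "prob (\<Union>a\<in>{0..int T * 2 ^ k}. \<Union>b\<in>{- (int Z * 2 ^ k)..int Z * 2 ^ k}. E m k a b)
         \<le> (\<Sum>a\<in>{0..int T * 2 ^ k}. prob (\<Union>b\<in>{- (int Z * 2 ^ k)..int Z * 2 ^ k}. E m k a b))"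
        by (rule measure_UNION_le) (auto intro!: sets.finite_UN Em)
      also have "\<dots> \<le> (\<Sum>a\<in>{0..int T * 2 ^ k}. \<Sum>b\<in>{- (int Z * 2 ^ k)..int Z * 2 ^ k}. prob (E m k a b))"
        by (intro sum_mono measure_UNION_le Em) auto
      also have "\<dots> \<le> (\<Sum>a\<in>{0..int T * 2 ^ k}. \<Sum>b\<in>{- (int Z * 2 ^ k)..int Z * 2 ^ k}. ?q * exp (- 3 * real k))"
        using k by (intro sum_mono PE m sm) auto
      also have "\<dots> = real (card {0..int T * 2 ^ k}) * (real (card {- (int Z * 2 ^ k)..int Z * 2 ^ k}) * (?q * exp (- 3 * real k)))"
        by (simp only: sum_constant of_nat_mult)
      also have "\<dots> \<le> (real (T + 1) * 2 ^ k) * ((real (2 * Z + 1) * 2 ^ k) * (?q * (1 / 8) ^ k))"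
      proof (intro mult_mono card_int_dyadic)
        have "exp (3::real) = exp 1 ^ 3" by (simp add: exp_of_nat_mult[symmetric])
        also have "\<dots> \<ge> 2 ^ 3" using exp_ge_add_one_self[of "1::real"] by (intro power_mono) auto
        finally have "(8::real) \<le> exp 3" by simp
        hence "exp (- 3 :: real) \<le> 1 / 8" by (simp add: exp_minus inverse_eq_divide divide_le_eq le_divide_eq)
        moreover have "exp (- 3 * real k) = exp (- 3) ^ k" by (simp add: exp_of_nat_mult[symmetric] mult.commute)
        ultimately show "exp (- 3 * real k) \<le> (1 / 8) ^ k" by (simp add: power_mono)
      qed auto
      also have "\<dots> = real (T + 1) * real (2 * Z + 1) * ?q * (2 * 2 * (1 / 8)) ^ k"
        by (simp only: power_mult_distrib mult_ac)
      also have "real (T + 1) * real (2 * Z + 1) = real ((T + 1) * (2 * Z + 1))" by (simp only: of_nat_mult)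
      also have "2 * 2 * (1 / 8) = (1 / 2 :: real)" by simp
      finally show "prob (\<Union>a\<in>{0..int T * 2 ^ k}. \<Union>b\<in>{- (int Z * 2 ^ k)..int Z * 2 ^ k}. E m k a b)
        \<le> real ((T + 1) * (2 * Z + 1)) * ?q * (1 / 2) ^ k" .
    qed
    also have "\<dots> = real ((T + 1) * (2 * Z + 1)) * ?q * (\<Sum>k\<le>mesh * m. (1 / 2) ^ k)"
      by (simp only: sum_distrib_left)
    also have "\<dots> \<le> real ((T + 1) * (2 * Z + 1)) * ?q * 2"
    proof (rule mult_left_mono)
      show "(\<Sum>k\<le>mesh * m. (1 / 2) ^ k) \<le> (2::real)"
        by (subst sum_gp0) simp
    qed simp
    finally show ?thesis by (simp add: mult_ac)
  qed
  \<comment> \<open>The maximal inequality requires \<open>\<theta>\<close> times the range of a link to be at most \<open>1\<close>. This holds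
    because there are only \<open>mesh * m\<close> levels, and \<open>\<theta>\<close> is polynomial in the level.\<close>
  have ev: "\<forall>\<^sub>F m in sequentially. (real (mesh * m) + 1) ^ 3 * sqrt (ln (real m) / 2 ^ m) * (2 * real T) \<le> 1"
  proof -
    define P where "P = (real mesh + 1) ^ 3 * (2 * real T)"
    have "(\<lambda>m::nat. real m ^ 3 * sqrt (ln (real m) / 2 ^ m)) \<longlonglongrightarrow> 0" by real_asymp
    hence "(\<lambda>m::nat. P * (real m ^ 3 * sqrt (ln (real m) / 2 ^ m))) \<longlonglongrightarrow> 0" by (rule tendsto_mult_right_zero)
    from order_tendstoD(2)[OF this, of 1] have "\<forall>\<^sub>F m in sequentially. P * (real m ^ 3 * sqrt (ln (real m) / 2 ^ m)) < 1"
      by simp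
    with eventually_ge_at_top[of 1] show ?thesis
    proof eventually_elim
      fix m :: nat assume m: "1 \<le> m" and P: "P * (real m ^ 3 * sqrt (ln (real m) / 2 ^ m)) < 1"
      have "(real (mesh * m) + 1) ^ 3 \<le> ((real mesh + 1) * real m) ^ 3"
        using m by (intro power_mono) (auto simp: algebra_simps)
      hence "(real (mesh * m) + 1) ^ 3 * sqrt (ln (real m) / 2 ^ m) * (2 * real T)
          \<le> ((real mesh + 1) * real m) ^ 3 * sqrt (ln (real m) / 2 ^ m) * (2 * real T)"
        using m by (intro mult_right_mono) auto
      also have "\<dots> = P * (real m ^ 3 * sqrt (ln (real m) / 2 ^ m))"
        by (simp add: P_def power_mult_distrib mult_ac)
      finally show "(real (mesh * m) + 1) ^ 3 * sqrt (ln (real m) / 2 ^ m) * (2 * real T) \<le> 1" using P by linarith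
    qed
  qed
  have "AE \<omega> in M. \<forall>\<^sub>F m in sequentially. \<omega> \<in> space M - U m"
  proof (rule borel_cantelli_AE1)
    show "summable (\<lambda>m. prob (U m))"
    proof (rule summable_comparison_test_ev)
      show "\<forall>\<^sub>F m in sequentially. norm (prob (U m)) \<le> 4 * real ((T + 1) * (2 * Z + 1)) * (1 / (real m)\<^sup>2)"
        using ev eventually_ge_at_top[of 3] by eventually_elim (use PU in auto)
      show "summable (\<lambda>m. 4 * real ((T + 1) * (2 * Z + 1)) * (1 / (real m)\<^sup>2))"
        using inverse_power_summable[of 2, where ?'a=real]
        by (intro summable_mult) (simp add: inverse_eq_divide)
    qed
  qed (auto simp: emeasure_eq_measure Um)
  hence "AE \<omega> in M. \<forall>\<^sub>F m in sequentially. \<forall>n\<in>{..2 ^ m}. \<forall>t\<in>{0..real T}. \<forall>z\<in>{- real Z..real Z}.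
    dyad (mesh * m) t powr (H / 4) * \<bar>dev n (dyad (mesh * m) t) (dyad (mesh * m) z) \<omega>\<bar>
      \<le> 2 * A * sqrt (2 ^ m * ln (real m))"
  proof (rule AE_mp, intro AE_I2 impI)
    fix \<omega> assume \<omega>: "\<omega> \<in> space M" "\<forall>\<^sub>F m in sequentially. \<omega> \<in> space M - U m"
    from \<omega>(2) eventually_ge_at_top[of 1]
    show "\<forall>\<^sub>F m in sequentially. \<forall>n\<in>{..2 ^ m}. \<forall>t\<in>{0..real T}. \<forall>z\<in>{- real Z..real Z}.
      dyad (mesh * m) t powr (H / 4) * \<bar>dev n (dyad (mesh * m) t) (dyad (mesh * m) z) \<omega>\<bar>
        \<le> 2 * A * sqrt (2 ^ m * ln (real m))"
    proof (eventually_elim, intro ballI)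
      fix m n :: nat and t z :: real
      assume U: "\<omega> \<in> space M - U m" and m: "1 \<le> m" and n: "n \<in> {..2 ^ m}" and t: "t \<in> {0..real T}" and z: "z \<in> {- real Z..real Z}"
      let ?K = "mesh * m" and ?R = "sqrt (2 ^ m * ln (real m))"
      have "dyad ?K t powr (H / 4) * \<bar>dev n (dyad ?K t) (dyad ?K z) \<omega>\<bar>
          = \<bar>\<Sum>j=1..n. wdev j (dyad ?K t) (dyad ?K z) \<omega>\<bar>"
        by (simp add: wdev_def dev_def sum_distrib_left[symmetric] abs_mult)
      also have "\<dots> = \<bar>\<Sum>k\<le>?K. \<Sum>j=1..n. link k \<lfloor>2 ^ k * t\<rfloor> \<lfloor>2 ^ k * z\<rfloor> j \<omega>\<bar>"
        unfolding sum_links[symmetric] by (subst sum.swap) (rule refl)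
      also have "\<dots> \<le> (\<Sum>k\<le>?K. \<bar>\<Sum>j=1..n. link k \<lfloor>2 ^ k * t\<rfloor> \<lfloor>2 ^ k * z\<rfloor> j \<omega>\<bar>)" by (rule sum_abs)
      also have "\<dots> \<le> (\<Sum>k\<le>?K. A * ?R * (1 / (real k + 1)\<^sup>2))"
      proof (rule sum_mono)
        fix k assume k: "k \<in> {..?K}"
        have "\<lfloor>2 ^ k * t\<rfloor> \<in> {0..int T * 2 ^ k}" using t by (intro floor_dyadic_nonneg) auto
        moreover have "\<lfloor>2 ^ k * z\<rfloor> \<in> {- (int Z * 2 ^ k)..int Z * 2 ^ k}" using z by (intro floor_dyadic_range) auto
        ultimately have "\<omega> \<notin> E m k \<lfloor>2 ^ k * t\<rfloor> \<lfloor>2 ^ k * z\<rfloor>" using U k unfolding U_def by blast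
        hence "\<bar>\<Sum>j=1..n. link k \<lfloor>2 ^ k * t\<rfloor> \<lfloor>2 ^ k * z\<rfloor> j \<omega>\<bar> \<le> lev m k"
          using n \<omega>(1) unfolding E_def mem_Collect_eq by (meson linear)
        thus "\<bar>\<Sum>j=1..n. link k \<lfloor>2 ^ k * t\<rfloor> \<lfloor>2 ^ k * z\<rfloor> j \<omega>\<bar> \<le> A * ?R * (1 / (real k + 1)\<^sup>2)"
          by (simp add: lev_def mult_ac)
      qed
      also have "\<dots> = A * ?R * (\<Sum>k\<le>?K. 1 / (real k + 1)\<^sup>2)" by (simp only: sum_distrib_left)
      also have "\<dots> \<le> A * ?R * 2"
      proof (rule mult_left_mono)
        have "0 \<le> 1 / (real ?K + 1)" by simp
        thus "(\<Sum>k\<le>?K. 1 / (real k + 1)\<^sup>2) \<le> 2" using sum_inverse_squares_le_2[of ?K] by linarith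
      qed (use A m in simp)
      finally show "dyad ?K t powr (H / 4) * \<bar>dev n (dyad ?K t) (dyad ?K z) \<omega>\<bar> \<le> 2 * A * ?R" by simp
    qed
  qed
  thus ?thesis using A by (intro exI[of _ "2 * A"]) auto
qed

end

section \<open>Oscillation in the space variable\<close>

context fbm_sample
begin

text \<open>
  The case distinction in \<open>\<theta>\<close> is that between the Gaussian and the Poisson regime of Bernstein's
  inequality: the optimal \<open>\<surd>(m / (d N))\<close> is admissible only if it is at most \<open>1 / 2\<close>, the reciprocal
  of the bound for the summands.
\<close>

lemma dev_increment_tail:
  assumes t: "0 < t" and m: "1 \<le> m" and D: "0 < D"
  shows "prob {\<omega>\<in>space M. \<exists>n\<in>{..N}.
      2 * (D + 1) * (sqrt (\<bar>z - z'\<bar> * N * m) + m) \<le> \<bar>dev n t z \<omega> - dev n t z' \<omega>\<bar>}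
    \<le> 2 * exp (- D * real m)"
proof -
  define d where "d = \<bar>z - z'\<bar>"
  define l where "l = 2 * (D + 1) * (sqrt (d * N * m) + real m)"
  define \<theta> where "\<theta> = (if d * N \<le> 4 * real m then 1 / 2 else sqrt (real m / (d * N)))"
  have d: "0 \<le> d" by (simp add: d_def)
  have \<theta>: "0 \<le> \<theta>" "\<theta> * 2 \<le> 1"
  proof -
    show "0 \<le> \<theta>" using d by (simp add: \<theta>_def)
    have "sqrt (real m / (d * N)) \<le> sqrt ((1 / 2)\<^sup>2)" if "\<not> d * N \<le> 4 * real m"
    proof (rule real_sqrt_le_mono)
      have "0 < d * N" using that m by linarith
      thus "real m / (d * N) \<le> (1 / 2)\<^sup>2" using that by (simp add: power2_eq_square divide_le_eq)
    qed
    thus "\<theta> * 2 \<le> 1" by (auto simp: \<theta>_def)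
  qed
  have eq: "dev n t z \<omega> - dev n t z' \<omega> = (\<Sum>j=1..n. 1 * (hit j t z \<omega> - Phi z) - 1 * (hit j t z' \<omega> - Phi z'))" for n \<omega>
    by (simp add: dev_def sum_subtractf)
  have "prob {\<omega>\<in>space M. \<exists>n\<in>{..N}. l \<le> \<bar>\<Sum>j=1..n. 1 * (hit j t z \<omega> - Phi z) - 1 * (hit j t z' \<omega> - Phi z')\<bar>}
      \<le> 2 * exp (\<theta>\<^sup>2 * d * N - \<theta> * l)"
  proof (rule maximal_exponential_inequality_abs[OF _ _ _ _ \<theta>])
    show "indep_vars (\<lambda>_. borel) (\<lambda>j \<omega>. 1 * (hit j t z \<omega> - Phi z) - 1 * (hit j t z' \<omega> - Phi z')) UNIV"
      by (rule hit_linear_indep) (use t in auto)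
    fix j
    have "\<bar>1 * (hit j t z \<omega> - Phi z) - 1 * (hit j t z' \<omega> - Phi z')\<bar> \<le> 2" for \<omega>
      unfolding mult_1 using hit_abs_dev_le_1[of j t z \<omega>] hit_abs_dev_le_1[of j t z' \<omega>] by linarith
    thus "AE \<omega> in M. \<bar>1 * (hit j t z \<omega> - Phi z) - 1 * (hit j t z' \<omega> - Phi z')\<bar> \<le> 2" by simp
    show "expectation (\<lambda>\<omega>. 1 * (hit j t z \<omega> - Phi z) - 1 * (hit j t z' \<omega> - Phi z')) = 0"
      using t by (simp add: hit_integrable hit_expectation prob_space)
    show "expectation (\<lambda>\<omega>. (1 * (hit j t z \<omega> - Phi z) - 1 * (hit j t z' \<omega> - Phi z'))\<^sup>2) \<le> d"
      using hit_dev_diff_second_moment[OF t t, of j z z'] hit_difference_same_time[OF t, of j z z'] by (simp add: d_def)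
  qed
  moreover have "\<theta>\<^sup>2 * d * N - \<theta> * l \<le> - D * real m"
  proof (cases "d * N \<le> 4 * real m")
    case True
    hence \<theta>: "\<theta> = 1 / 2" by (simp add: \<theta>_def)
    have "0 \<le> (D + 1) * sqrt (d * N * m)" using D d by simp
    moreover have "\<theta> * l = (D + 1) * sqrt (d * N * m) + (D + 1) * real m"
      unfolding \<theta> l_def by (simp add: field_simps)
    ultimately have "(D + 1) * real m \<le> \<theta> * l" by linarith
    moreover have "\<theta>\<^sup>2 * d * N \<le> m" using True unfolding \<theta> by (simp add: power2_eq_square)
    ultimately show ?thesis by (simp add: distrib_right)
  next
    case False
    hence \<theta>: "\<theta> = sqrt (real m / (d * N))" and pos: "0 < d * N" using m by (auto simp: \<theta>_def)
    have "\<theta>\<^sup>2 = real m / (d * N)" unfolding \<theta> using d by simp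
    moreover have "x * y = real m" if "x = real m / y" "0 < y" for x y using that by simp
    ultimately have "\<theta>\<^sup>2 * (d * N) = m" using pos by blast
    hence 1: "\<theta>\<^sup>2 * d * N = m" by (simp only: mult.assoc)
    have 2: "\<theta> * sqrt (d * N * m) = m" 
    proof -
      have "sqrt (real m / y) * sqrt (y * m) = m" if "0 < y" for y
        using that by (simp add: real_sqrt_mult[symmetric])
      from this[of "d * N"] pos show ?thesis unfolding \<theta> by blast
    qed
    have "\<theta> * l = 2 * (D + 1) * (\<theta> * sqrt (d * N * m)) + 2 * (D + 1) * (\<theta> * real m)"
      by (simp add: l_def algebra_simps)
    moreover have "0 \<le> 2 * (D + 1) * (\<theta> * real m)" using D \<open>0 \<le> \<theta>\<close> by simp
    ultimately have "2 * (D + 1) * real m \<le> \<theta> * l" unfolding 2 by linarith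
    moreover have "0 \<le> D * real m" using D by simp
    ultimately show ?thesis unfolding 1 by (simp add: distrib_right)
  qed
  ultimately show ?thesis unfolding eq l_def d_def by (smt (verit) exp_le_cancel_iff)
qed

text \<open>
  There are of the order of \<open>8\<close> to the power \<open>mesh * m\<close> triples of a time and two levels on the grid, which the
  constant \<open>D\<close> in the exponent \<open>-D m\<close> outweighs.
\<close>

lemma dev_oscillation_on_grid:
  fixes T Z :: nat
  assumes T: "1 \<le> T"
  shows "\<exists>A>0. AE \<omega> in M. \<forall>\<^sub>F m in sequentially. \<forall>n\<in>{..2 ^ m}. \<forall>t\<in>{0..real T}.
    \<forall>z\<in>{- real Z..real Z}. \<forall>z'\<in>{- real Z..real Z}. 0 < dyad (mesh * m) t \<longrightarrow>
      \<bar>dev n (dyad (mesh * m) t) (dyad (mesh * m) z) \<omega> - dev n (dyad (mesh * m) t) (dyad (mesh * m) z') \<omega>\<bar>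
      \<le> A * (sqrt (\<bar>dyad (mesh * m) z - dyad (mesh * m) z'\<bar> * 2 ^ m * m) + m)"
proof -
  define D where "D = 3 * real mesh + 1"
  have D: "0 < D" by (simp add: D_def add_nonneg_pos)
  define A where "A = 2 * (D + 1)"
  let ?I = "\<lambda>K. {- (int Z * 2 ^ K)..int Z * 2 ^ K}"
  define E where "E = (\<lambda>m a b b'. {\<omega>\<in>space M. \<exists>n\<in>{..2 ^ m}.
      A * (sqrt (\<bar>real_of_int b / 2 ^ (mesh * m) - real_of_int b' / 2 ^ (mesh * m)\<bar> * real (2 ^ m) * real m) + real m)
      \<le> \<bar>dev n (real_of_int a / 2 ^ (mesh * m)) (real_of_int b / 2 ^ (mesh * m)) \<omega>
         - dev n (real_of_int a / 2 ^ (mesh * m)) (real_of_int b' / 2 ^ (mesh * m)) \<omega>\<bar>})"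
  define U where "U = (\<lambda>m. \<Union>a\<in>{1..int T * 2 ^ (mesh * m)}. \<Union>b\<in>?I (mesh * m). \<Union>b'\<in>?I (mesh * m). E m a b b')"
  have Em: "E m a b b' \<in> sets M" if "a \<in> {1..int T * 2 ^ (mesh * m)}" for m a b b'
  proof -
    have "0 \<le> real_of_int a / 2 ^ (mesh * m)" using that by simp
    thus ?thesis unfolding E_def dev_def by measurable
  qed
  have Um: "U m \<in> sets M" for m
    unfolding U_def by (intro sets.finite_UN Em) auto
  have PE: "prob (E m a b b') \<le> 2 * exp (- D * real m)" if "1 \<le> m" "a \<in> {1..int T * 2 ^ (mesh * m)}" for m a b b'
    unfolding E_def A_def using that by (intro dev_increment_tail D) auto
  have PU: "prob (U m) \<le> 2 * (real T * (real (2 * Z + 1))\<^sup>2) * exp (- 1) ^ m" if m: "1 \<le> m" for m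
  proof -
    let ?K = "mesh * m" and ?q = "2 * exp (- D * real m)"
    have "prob (U m) \<le> (\<Sum>a\<in>{1..int T * 2 ^ ?K}. prob (\<Union>b\<in>?I ?K. \<Union>b'\<in>?I ?K. E m a b b'))"
      unfolding U_def by (rule measure_UNION_le) (auto intro!: sets.finite_UN Em)
    also have "\<dots> \<le> (\<Sum>a\<in>{1..int T * 2 ^ ?K}. \<Sum>b\<in>?I ?K. prob (\<Union>b'\<in>?I ?K. E m a b b'))"
      by (rule sum_mono, rule measure_UNION_le) (auto intro!: sets.finite_UN Em)
    also have "\<dots> \<le> (\<Sum>a\<in>{1..int T * 2 ^ ?K}. \<Sum>b\<in>?I ?K. \<Sum>b'\<in>?I ?K. prob (E m a b b'))"
      by (rule sum_mono, rule sum_mono, rule measure_UNION_le) (auto intro!: Em)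
    also have "\<dots> \<le> (\<Sum>a\<in>{1..int T * 2 ^ ?K}. \<Sum>b\<in>?I ?K. \<Sum>b'\<in>?I ?K. ?q)"
      by (intro sum_mono PE m)
    also have "\<dots> = real (card {1..int T * 2 ^ ?K}) * (real (card (?I ?K)) * (real (card (?I ?K)) * ?q))"
      by (simp only: sum_constant)
    also have "\<dots> \<le> (real T * 2 ^ ?K) * ((real (2 * Z + 1) * 2 ^ ?K) * ((real (2 * Z + 1) * 2 ^ ?K) * ?q))"
    proof (intro mult_mono card_int_dyadic)
      show "real (card {1..int T * 2 ^ ?K}) \<le> real T * 2 ^ ?K"
        by (simp add: nat_mult_distrib nat_power_eq)
    qed auto
    also have "\<dots> = 2 * (real T * (real (2 * Z + 1))\<^sup>2) * (((2 ^ ?K) * (2 ^ ?K) * 2 ^ ?K) * exp (- D * real m))"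
      by (simp only: power2_eq_square mult_ac)
    also have "\<dots> \<le> 2 * (real T * (real (2 * Z + 1))\<^sup>2) * exp (- 1) ^ m"
    proof (rule mult_left_mono)
      have "(2::real) ^ ?K \<le> exp 1 ^ ?K" using exp_ge_add_one_self[of "1::real"] by (intro power_mono) auto
      also have "\<dots> = exp (real ?K)" by (simp add: exp_of_nat_mult[symmetric])
      finally have "(2::real) ^ ?K \<le> exp (real ?K)" .
      hence "(2::real) ^ ?K * 2 ^ ?K * 2 ^ ?K \<le> exp (real ?K) * exp (real ?K) * exp (real ?K)"
        by (intro mult_mono) auto
      hence "(2::real) ^ ?K * 2 ^ ?K * 2 ^ ?K * exp (- D * real m) \<le> exp (real ?K) * exp (real ?K) * exp (real ?K) * exp (- D * real m)"
        by (intro mult_right_mono) auto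
      also have "\<dots> = exp (- real m)"
        by (simp add: exp_add[symmetric] D_def algebra_simps)
      also have "\<dots> = exp (- 1) ^ m" by (simp add: exp_of_nat_mult[symmetric])
      finally show "(2::real) ^ ?K * 2 ^ ?K * 2 ^ ?K * exp (- D * real m) \<le> exp (- 1) ^ m" .
    qed simp
    finally show ?thesis .
  qed
  have "AE \<omega> in M. \<forall>\<^sub>F m in sequentially. \<omega> \<in> space M - U m"
  proof (rule borel_cantelli_AE1)
    show "summable (\<lambda>m. prob (U m))"
    proof (rule summable_comparison_test_ev)
      show "\<forall>\<^sub>F m in sequentially. norm (prob (U m)) \<le> 2 * (real T * (real (2 * Z + 1))\<^sup>2) * exp (- 1) ^ m"
        using eventually_ge_at_top[of 1] by eventually_elim (use PU in auto)
      show "summable (\<lambda>m. 2 * (real T * (real (2 * Z + 1))\<^sup>2) * exp (- 1) ^ m)"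
        by (intro summable_mult summable_geometric) simp
    qed
  qed (auto simp: emeasure_eq_measure Um)
  hence "AE \<omega> in M. \<forall>\<^sub>F m in sequentially. \<forall>n\<in>{..2 ^ m}. \<forall>t\<in>{0..real T}.
    \<forall>z\<in>{- real Z..real Z}. \<forall>z'\<in>{- real Z..real Z}. 0 < dyad (mesh * m) t \<longrightarrow>
      \<bar>dev n (dyad (mesh * m) t) (dyad (mesh * m) z) \<omega> - dev n (dyad (mesh * m) t) (dyad (mesh * m) z') \<omega>\<bar>
      \<le> A * (sqrt (\<bar>dyad (mesh * m) z - dyad (mesh * m) z'\<bar> * 2 ^ m * m) + m)"
  proof (rule AE_mp, intro AE_I2 impI)
    fix \<omega> assume \<omega>: "\<omega> \<in> space M" "\<forall>\<^sub>F m in sequentially. \<omega> \<in> space M - U m"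
    from \<omega>(2)
    show "\<forall>\<^sub>F m in sequentially. \<forall>n\<in>{..2 ^ m}. \<forall>t\<in>{0..real T}.
      \<forall>z\<in>{- real Z..real Z}. \<forall>z'\<in>{- real Z..real Z}. 0 < dyad (mesh * m) t \<longrightarrow>
      \<bar>dev n (dyad (mesh * m) t) (dyad (mesh * m) z) \<omega> - dev n (dyad (mesh * m) t) (dyad (mesh * m) z') \<omega>\<bar>
      \<le> A * (sqrt (\<bar>dyad (mesh * m) z - dyad (mesh * m) z'\<bar> * 2 ^ m * m) + m)"
    proof (eventually_elim, intro ballI impI)
      fix m n :: nat and t z z' :: real
      assume U: "\<omega> \<in> space M - U m" and n: "n \<in> {..2 ^ m}" and t: "t \<in> {0..real T}"
        and z: "z \<in> {- real Z..real Z}" and z': "z' \<in> {- real Z..real Z}" and pos: "0 < dyad (mesh * m) t"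
      let ?K = "mesh * m"
      have "\<lfloor>2 ^ ?K * t\<rfloor> \<in> {0..int T * 2 ^ ?K}" using t by (intro floor_dyadic_nonneg) auto
      moreover have "\<lfloor>2 ^ ?K * t\<rfloor> \<noteq> 0" using pos by (auto simp: dyad_def)
      ultimately have a: "\<lfloor>2 ^ ?K * t\<rfloor> \<in> {1..int T * 2 ^ ?K}"
        unfolding atLeastAtMost_iff by linarith
      have b: "\<lfloor>2 ^ ?K * z\<rfloor> \<in> ?I ?K" using z by (intro floor_dyadic_range) auto
      have b': "\<lfloor>2 ^ ?K * z'\<rfloor> \<in> ?I ?K" using z' by (intro floor_dyadic_range) auto
      have "\<omega> \<notin> E m \<lfloor>2 ^ ?K * t\<rfloor> \<lfloor>2 ^ ?K * z\<rfloor> \<lfloor>2 ^ ?K * z'\<rfloor>" using U a b b' unfolding U_def by blast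
      thus "\<bar>dev n (dyad ?K t) (dyad ?K z) \<omega> - dev n (dyad ?K t) (dyad ?K z') \<omega>\<bar>
        \<le> A * (sqrt (\<bar>dyad ?K z - dyad ?K z'\<bar> * 2 ^ m * m) + m)"
        using n \<omega>(1) unfolding E_def mem_Collect_eq dyad_def of_nat_power of_nat_numeral by (meson linear)
    qed
  qed
  moreover have "A > 0" using D by (simp add: A_def)
  ultimately show ?thesis by blast
qed

text \<open>
  Both grid estimates carry over to all admissible arguments. They are applied with the range of
  \<open>z\<close> enlarged by one, since the comparison with grid values shifts \<open>z\<close> by up to \<open>2 / 2\<^sup>m\<close>.
\<close>

lemma dev_bounds:
  fixes T Z :: nat
  assumes T: "1 \<le> T"
  shows "\<exists>A>0. AE \<omega> in M. \<forall>\<^sub>F m in sequentially. \<forall>n\<in>{..2 ^ m}. \<forall>t z z'.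
    0 < t \<and> t \<le> real T \<and> (1 / 2) ^ m \<le> t powr H \<and> \<bar>z\<bar> \<le> real Z \<and> \<bar>z'\<bar> \<le> real Z \<longrightarrow>
      t powr (H / 4) * \<bar>dev n t z \<omega>\<bar> \<le> A * sqrt (2 ^ m * ln (real m)) \<and>
      \<bar>dev n t z \<omega> - dev n t z' \<omega>\<bar> \<le> A * (sqrt (\<bar>z - z'\<bar> * 2 ^ m * m) + m)"
proof -
  obtain C where C: "C > 0" and AE1: "AE \<omega> in M. \<forall>\<^sub>F k in sequentially. \<forall>j\<in>{..2 ^ k}. \<forall>t\<in>{0..real T}.
    \<bar>B j t \<omega> - B j (dyad k t) \<omega>\<bar> \<le> C * (2 powr (- H / 2)) ^ k"
    using dyadic_oscillation_small[of T] by blast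
  obtain A1 where A1: "A1 > 0" and AE2: "AE \<omega> in M. \<forall>\<^sub>F m in sequentially. \<forall>n\<in>{..2 ^ m}. \<forall>t\<in>{0..real T}. \<forall>z\<in>{- real (Z + 1)..real (Z + 1)}.
    dyad (mesh * m) t powr (H / 4) * \<bar>dev n (dyad (mesh * m) t) (dyad (mesh * m) z) \<omega>\<bar>
      \<le> A1 * sqrt (2 ^ m * ln (real m))"
    using weighted_iterated_log_on_grid[OF T, of "Z + 1"] by blast
  obtain A2 where A2: "A2 > 0" and AE3: "AE \<omega> in M. \<forall>\<^sub>F m in sequentially. \<forall>n\<in>{..2 ^ m}. \<forall>t\<in>{0..real T}.
    \<forall>z\<in>{- real (Z + 1)..real (Z + 1)}. \<forall>z'\<in>{- real (Z + 1)..real (Z + 1)}. 0 < dyad (mesh * m) t \<longrightarrow>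
      \<bar>dev n (dyad (mesh * m) t) (dyad (mesh * m) z) \<omega> - dev n (dyad (mesh * m) t) (dyad (mesh * m) z') \<omega>\<bar>
      \<le> A2 * (sqrt (\<bar>dyad (mesh * m) z - dyad (mesh * m) z'\<bar> * 2 ^ m * m) + m)"
    using dev_oscillation_on_grid[OF T, of "Z + 1"] by blast
  define A where "A = 2 * A1 + 4 * real T + 3 * A2 + 4"
  have A: "A > 0" using A1 A2 by (simp add: A_def add_pos_nonneg add_nonneg_pos)
  have mesh_lim: "filterlim (\<lambda>m. mesh * m) sequentially sequentially"
    using mesh_ge_6 by (intro mult_nat_left_at_top) simp
  have big: "\<forall>\<^sub>F m in sequentially. 2 * (real Z + C) \<le> 2 ^ m"
  proof -
    have "filterlim (\<lambda>m. (2::real) ^ m) at_top sequentially" by real_asymp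
    thus ?thesis by (simp add: filterlim_at_top)
  qed
  have "AE \<omega> in M. \<forall>\<^sub>F m in sequentially. \<forall>n\<in>{..2 ^ m}. \<forall>t z z'.
    0 < t \<and> t \<le> real T \<and> (1 / 2) ^ m \<le> t powr H \<and> \<bar>z\<bar> \<le> real Z \<and> \<bar>z'\<bar> \<le> real Z \<longrightarrow>
      t powr (H / 4) * \<bar>dev n t z \<omega>\<bar> \<le> A * sqrt (2 ^ m * ln (real m)) \<and>
      \<bar>dev n t z \<omega> - dev n t z' \<omega>\<bar> \<le> A * (sqrt (\<bar>z - z'\<bar> * 2 ^ m * m) + m)"
    using AE1 AE2 AE3
  proof eventually_elim
    fix \<omega>
    assume e1: "\<forall>\<^sub>F k in sequentially. \<forall>j\<in>{..2 ^ k}. \<forall>t\<in>{0..real T}.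
        \<bar>B j t \<omega> - B j (dyad k t) \<omega>\<bar> \<le> C * (2 powr (- H / 2)) ^ k"
      and e2: "\<forall>\<^sub>F m in sequentially. \<forall>n\<in>{..2 ^ m}. \<forall>t\<in>{0..real T}. \<forall>z\<in>{- real (Z + 1)..real (Z + 1)}.
        dyad (mesh * m) t powr (H / 4) * \<bar>dev n (dyad (mesh * m) t) (dyad (mesh * m) z) \<omega>\<bar>
          \<le> A1 * sqrt (2 ^ m * ln (real m))"
      and e3: "\<forall>\<^sub>F m in sequentially. \<forall>n\<in>{..2 ^ m}. \<forall>t\<in>{0..real T}.
        \<forall>z\<in>{- real (Z + 1)..real (Z + 1)}. \<forall>z'\<in>{- real (Z + 1)..real (Z + 1)}. 0 < dyad (mesh * m) t \<longrightarrow>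
          \<bar>dev n (dyad (mesh * m) t) (dyad (mesh * m) z) \<omega> - dev n (dyad (mesh * m) t) (dyad (mesh * m) z') \<omega>\<bar>
          \<le> A2 * (sqrt (\<bar>dyad (mesh * m) z - dyad (mesh * m) z'\<bar> * 2 ^ m * m) + m)"
    have e1': "\<forall>\<^sub>F m in sequentially. \<forall>j\<in>{..2 ^ (mesh * m)}. \<forall>t\<in>{0..real T}.
        \<bar>B j t \<omega> - B j (dyad (mesh * m) t) \<omega>\<bar> \<le> C * (2 powr (- H / 2)) ^ (mesh * m)"
      using eventually_compose_filterlim[OF e1 mesh_lim] .
    show "\<forall>\<^sub>F m in sequentially. \<forall>n\<in>{..2 ^ m}. \<forall>t z z'.
      0 < t \<and> t \<le> real T \<and> (1 / 2) ^ m \<le> t powr H \<and> \<bar>z\<bar> \<le> real Z \<and> \<bar>z'\<bar> \<le> real Z \<longrightarrow>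
      t powr (H / 4) * \<bar>dev n t z \<omega>\<bar> \<le> A * sqrt (2 ^ m * ln (real m)) \<and>
      \<bar>dev n t z \<omega> - dev n t z' \<omega>\<bar> \<le> A * (sqrt (\<bar>z - z'\<bar> * 2 ^ m * m) + m)"
      using e1' e2 e3 big eventually_ge_at_top[of 3]
    proof (eventually_elim, intro ballI allI impI)
      fix m n :: nat and t z z' :: real
      assume osc: "\<forall>j\<in>{..2 ^ (mesh * m)}. \<forall>t\<in>{0..real T}.
          \<bar>B j t \<omega> - B j (dyad (mesh * m) t) \<omega>\<bar> \<le> C * (2 powr (- H / 2)) ^ (mesh * m)"
        and LIL: "\<forall>n\<in>{..2 ^ m}. \<forall>t\<in>{0..real T}. \<forall>z\<in>{- real (Z + 1)..real (Z + 1)}.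
        dyad (mesh * m) t powr (H / 4) * \<bar>dev n (dyad (mesh * m) t) (dyad (mesh * m) z) \<omega>\<bar>
          \<le> A1 * sqrt (2 ^ m * ln (real m))"
        and OSC: "\<forall>n\<in>{..2 ^ m}. \<forall>t\<in>{0..real T}.
        \<forall>z\<in>{- real (Z + 1)..real (Z + 1)}. \<forall>z'\<in>{- real (Z + 1)..real (Z + 1)}. 0 < dyad (mesh * m) t \<longrightarrow>
          \<bar>dev n (dyad (mesh * m) t) (dyad (mesh * m) z) \<omega> - dev n (dyad (mesh * m) t) (dyad (mesh * m) z') \<omega>\<bar>
          \<le> A2 * (sqrt (\<bar>dyad (mesh * m) z - dyad (mesh * m) z'\<bar> * 2 ^ m * m) + m)"
        and big: "2 * (real Z + C) \<le> 2 ^ m" and m3: "3 \<le> m" and n: "n \<in> {..2 ^ m}"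
        and tz: "0 < t \<and> t \<le> real T \<and> (1 / 2) ^ m \<le> t powr H \<and> \<bar>z\<bar> \<le> real Z \<and> \<bar>z'\<bar> \<le> real Z"
      define K where "K = mesh * m"
      define s where "s = dyad K t"
      define N where "N = (2::real) ^ m"
      have N: "2 \<le> N" using power_increasing[of 1 m "2::real"] m3 by (simp add: N_def)
      have m1: "1 \<le> m" using m3 by simp
      have st: "t \<le> 2 * s" "0 < s" using half_time(1)[of m t] m1 tz by (auto simp: s_def K_def)
      let ?up = "\<lambda>z. dyad K (z + 2 / N)" and ?dn = "\<lambda>z. dyad K (z - 1 / N)"
      have between: "dev n t z \<omega> \<le> dev n s (?up z) \<omega> + 2" "dev n s (?dn z) \<omega> - 2 \<le> dev n t z \<omega>" if "\<bar>z\<bar> \<le> real Z" for z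
        using dev_between_grid_values[OF m1 _ C big osc, of n t z] n tz that by (auto simp: s_def K_def N_def)
      have N1: "0 < 1 / N" "2 / N \<le> 1" "1 / N \<le> 1" using N by (auto simp: divide_le_eq)
      have range: "z + 2 / N \<in> {- real (Z + 1)..real (Z + 1)}" "z - 1 / N \<in> {- real (Z + 1)..real (Z + 1)}" if "\<bar>z\<bar> \<le> real Z" for z
      proof -
        have "0 < 2 / N" using N by simp
        thus "z + 2 / N \<in> {- real (Z + 1)..real (Z + 1)}" "z - 1 / N \<in> {- real (Z + 1)..real (Z + 1)}"
          unfolding atLeastAtMost_iff of_nat_add of_nat_1 using that N1 by linarith+
      qed
      have tT: "t \<in> {0..real T}" using tz by simp
      have L: "1 \<le> sqrt (N * ln (real m))"
      proof -
        have "exp 1 \<le> real m" using m3 exp_le by linarith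
        hence "1 \<le> ln (real m)" using m3 by (subst ln_ge_iff) auto
        hence "1 * 1 \<le> N * ln (real m)" using N by (intro mult_mono) auto
        thus ?thesis by simp
      qed
      show "t powr (H / 4) * \<bar>dev n t z \<omega>\<bar> \<le> A * sqrt (2 ^ m * ln (real m)) \<and>
        \<bar>dev n t z \<omega> - dev n t z' \<omega>\<bar> \<le> A * (sqrt (\<bar>z - z'\<bar> * 2 ^ m * m) + m)"
      proof
        define R where "R = sqrt (N * ln (real m))"
        define p where "p = s powr (H / 4)"
        have g: "p * \<bar>dev n s (?up z) \<omega>\<bar> \<le> A1 * R" "p * \<bar>dev n s (?dn z) \<omega>\<bar> \<le> A1 * R"
          using LIL n tT range[of z] tz by (auto simp: p_def s_def K_def N_def R_def)
        have p: "0 \<le> p" "p \<le> real T" unfolding p_def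
          using powr_time_le[of s "real T" "H / 4"] st dyad_le[of K t] tz T H by (auto simp: s_def)
        have "\<bar>dev n t z \<omega>\<bar> \<le> max \<bar>dev n s (?up z) \<omega>\<bar> \<bar>dev n s (?dn z) \<omega>\<bar> + 2"
          using between[of z] tz by linarith
        hence "p * \<bar>dev n t z \<omega>\<bar> \<le> p * (max \<bar>dev n s (?up z) \<omega>\<bar> \<bar>dev n s (?dn z) \<omega>\<bar> + 2)"
          using p by (intro mult_left_mono)
        also have "\<dots> = max (p * \<bar>dev n s (?up z) \<omega>\<bar>) (p * \<bar>dev n s (?dn z) \<omega>\<bar>) + 2 * p"
          using p by (simp add: distrib_left max_mult_distrib_left)
        also have "\<dots> \<le> A1 * R + 2 * real T" using g p by linarith
        finally have 1: "p * \<bar>dev n t z \<omega>\<bar> \<le> A1 * R + 2 * real T" .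
        have "t powr (H / 4) \<le> 2 * p"
        proof -
          have "t powr (H / 4) \<le> (2 * s) powr (H / 4)" using st tz H by (intro powr_mono2) auto
          also have "\<dots> = 2 powr (H / 4) * p" using st by (simp add: powr_mult p_def)
          also have "\<dots> \<le> 2 powr 1 * p" using p H by (intro mult_right_mono powr_mono) auto
          finally show ?thesis by simp
        qed
        hence "t powr (H / 4) * \<bar>dev n t z \<omega>\<bar> \<le> 2 * p * \<bar>dev n t z \<omega>\<bar>" by (intro mult_right_mono) auto
        hence "t powr (H / 4) * \<bar>dev n t z \<omega>\<bar> \<le> 2 * A1 * R + 4 * real T * 1" using 1 by linarith
        also have "\<dots> \<le> 2 * A1 * R + 4 * real T * R" using L by (intro add_left_mono mult_left_mono) (auto simp: R_def)
        also have "\<dots> = (2 * A1 + 4 * real T) * R" by (simp add: distrib_right)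
        also have "\<dots> \<le> A * R" using A2 L by (intro mult_right_mono) (auto simp: A_def R_def)
        finally show "t powr (H / 4) * \<bar>dev n t z \<omega>\<bar> \<le> A * sqrt (2 ^ m * ln (real m))" by (simp add: R_def N_def)
      next
        have *: "dev n t z \<omega> - dev n t z' \<omega> \<le> A * (sqrt (\<bar>z - z'\<bar> * N * m) + m)"
          if z: "\<bar>z\<bar> \<le> real Z" and z': "\<bar>z'\<bar> \<le> real Z" for z z'
        proof -
          have gap: "\<bar>?up z - ?dn z'\<bar> \<le> \<bar>z - z'\<bar> + 4 / N"
          proof -
            have "1 / 2 ^ K \<le> 1 / N" unfolding N_def
              using mesh_ge_6 by (intro divide_left_mono power_increasing) (auto simp: K_def)
            moreover have "4 / N = 1 / N + 1 / N + 1 / N + 1 / N" "2 / N = 1 / N + 1 / N" by simp_all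
            ultimately show ?thesis
              using dyad_le[of K "z + 2 / N"] dyad_gt[of "z + 2 / N" K] dyad_le[of K "z' - 1 / N"] dyad_gt[of "z' - 1 / N" K] N1
              by linarith
          qed
          have "dev n t z \<omega> - dev n t z' \<omega> \<le> \<bar>dev n s (?up z) \<omega> - dev n s (?dn z') \<omega>\<bar> + 4"
            using between[of z] between[of z'] z z' by linarith
          also have "\<bar>dev n s (?up z) \<omega> - dev n s (?dn z') \<omega>\<bar> \<le> A2 * (sqrt (\<bar>?up z - ?dn z'\<bar> * N * m) + m)"
            using OSC n tT range(1)[OF z] range(2)[OF z'] st unfolding s_def K_def N_def by blast
          also have "sqrt (\<bar>?up z - ?dn z'\<bar> * N * m) \<le> sqrt (\<bar>z - z'\<bar> * N * m) + 2 * m"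
          proof -
            have "sqrt (\<bar>?up z - ?dn z'\<bar> * N * m) \<le> sqrt ((\<bar>z - z'\<bar> + 4 / N) * N * m)"
              using gap N by (intro real_sqrt_le_mono mult_right_mono) auto
            also have "(\<bar>z - z'\<bar> + 4 / N) * N * m = \<bar>z - z'\<bar> * N * m + 4 * real m" using N by (simp add: field_simps)
            also have "sqrt \<dots> \<le> sqrt (\<bar>z - z'\<bar> * N * m) + sqrt (4 * real m)"
              using N by (intro sqrt_add_le_add_sqrt) auto
            also have "sqrt (4 * real m) \<le> sqrt ((2 * real m)\<^sup>2)"
              using m1 by (intro real_sqrt_le_mono) (simp add: power2_eq_square)
            also have "\<dots> = 2 * real m" by (subst real_sqrt_abs) simp
            finally show ?thesis by simp
          qed
          finally have dev_le: "dev n t z \<omega> - dev n t z' \<omega> \<le> A2 * ((sqrt (\<bar>z - z'\<bar> * N * m) + 2 * real m) + real m) + 4"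
            using A2 by simp
          have "A2 * ((Q + 2 * r) + r) + 4 \<le> (3 * A2 + 4) * (Q + r)" if "0 \<le> Q" "1 \<le> r" for Q r :: real
          proof -
            have "(3 * A2 + 4) * (Q + r) - (A2 * ((Q + 2 * r) + r) + 4) = 2 * (A2 * Q) + 4 * Q + 4 * (r - 1)"
              by (simp add: algebra_simps)
            moreover have "0 \<le> 2 * (A2 * Q) + 4 * Q + 4 * (r - 1)" using A2 that by simp
            ultimately show ?thesis by linarith
          qed
          from this[of "sqrt (\<bar>z - z'\<bar> * N * m)" "real m"]
          have bound: "A2 * ((sqrt (\<bar>z - z'\<bar> * N * m) + 2 * real m) + real m) + 4 \<le> (3 * A2 + 4) * (sqrt (\<bar>z - z'\<bar> * N * m) + m)"
            using N m1 by simp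
          note dev_le
          also note bound
          also have "\<dots> \<le> A * (sqrt (\<bar>z - z'\<bar> * N * m) + m)"
            using A1 N by (intro mult_right_mono) (auto simp: A_def)
          finally show ?thesis .
        qed
        show "\<bar>dev n t z \<omega> - dev n t z' \<omega>\<bar> \<le> A * (sqrt (\<bar>z - z'\<bar> * 2 ^ m * m) + m)"
          using *[of z z'] *[of z' z] tz by (simp add: N_def abs_minus_commute abs_le_iff)
      qed
    qed
  qed
  thus ?thesis using A by blast
qed

end

section \<open>Empirical quantiles\<close>

lemma Phi_strict_mono: "a < b \<Longrightarrow> Phi a < Phi b"
proof -
  assume ab: "a < b"
  let ?Z = "max \<bar>a\<bar> \<bar>b\<bar>"
  have "0 < std_normal_density ?Z * (b - a)"
    using ab normal_density_pos[of 1 0 ?Z] by (intro mult_pos_pos) auto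
  also have "\<dots> \<le> Phi b - Phi a" using ab by (intro Phi_increase_lower) auto
  finally show ?thesis by simp
qed

lemma less_quantileD:
  assumes "bdd_below {x. \<alpha> \<le> G x}" "y < quantile G \<alpha>" shows "G y < \<alpha>"
proof (rule ccontr)
  assume "\<not> G y < \<alpha>"
  hence "quantile G \<alpha> \<le> y" unfolding quantile_def using assms(1) by (intro cInf_lower) auto
  thus False using assms(2) by simp
qed

lemma quantile_lessD:
  assumes "mono G" "{x. \<alpha> \<le> G x} \<noteq> {}" "quantile G \<alpha> < y" shows "\<alpha> \<le> G y"
proof -
  obtain x where x: "\<alpha> \<le> G x" "x < y"
    using cInf_lessD[OF assms(2), of y] assms(3) by (auto simp: quantile_def)
  have "G x \<le> G y" using x(2) by (intro monoD[OF assms(1)]) simp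
  thus ?thesis using x(1) by simp
qed

lemma F_emp_mono: "mono (F_emp B n \<omega> t)"
  unfolding F_emp_def by (intro monoI divide_right_mono sum_mono) (auto simp: indicator_def)

lemma F_emp_level_set:
  assumes "1 \<le> n" "0 < \<alpha>" "\<alpha> < 1"
  shows "{x. \<alpha> \<le> F_emp B n \<omega> t x} \<noteq> {}" "bdd_below {x. \<alpha> \<le> F_emp B n \<omega> t x}"
proof -
  let ?V = "(\<lambda>j. B j t \<omega>) ` {1..n}"
  have V: "finite ?V" "?V \<noteq> {}" using assms by auto
  have "F_emp B n \<omega> t (Max ?V) = (\<Sum>j=1..n. 1) / real n"
    unfolding F_emp_def using V by (intro arg_cong2[where f="(/)"] sum.cong) auto
  hence "\<alpha> \<le> F_emp B n \<omega> t (Max ?V)" using assms by simp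
  thus "{x. \<alpha> \<le> F_emp B n \<omega> t x} \<noteq> {}" by blast
  have "Min ?V \<le> x" if "\<alpha> \<le> F_emp B n \<omega> t x" for x
  proof (rule ccontr)
    assume "\<not> Min ?V \<le> x"
    hence "\<forall>y\<in>?V. \<not> y \<le> x" using Min_le[OF V(1)] by (meson order_trans)
    hence "F_emp B n \<omega> t x = 0" unfolding F_emp_def by (simp add: indicator_def)
    thus False using that assms by simp
  qed
  thus "bdd_below {x. \<alpha> \<le> F_emp B n \<omega> t x}" by (intro bdd_belowI[of _ "Min ?V"]) auto
qed

text \<open>
  The parameters stand for \<open>x = n\<^sup>1\<^sup>/\<^sup>4\<close>, \<open>y = (log log n)\<^sup>1\<^sup>/\<^sup>4\<close>, \<open>lg = log n\<close>, and \<open>g\<close> for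
  \<open>\<gamma>\<^sub>n\<close> to the power \<open>-H/4\<close>. In this form \<open>\<delta>\<close> bounds the normalised distance of the quantiles. The three terms
  on the left are the oscillation, the Bernstein correction together with the discretisation
  errors, and the Taylor remainder. Only the first one attains the order of the rate if \<open>g\<close> is bounded.
\<close>

lemma error_terms_le_rate:
  fixes A C x y g lg :: real
  assumes A: "0 < A" and C: "1 \<le> C" and x: "0 < x" and y: "1 \<le> y" and g: "1 \<le> g" and l: "1 \<le> lg"
    and lx: "sqrt lg \<le> x" and yx: "y ^ 3 \<le> x" and \<delta>: "\<delta> = C * g * y\<^sup>2 / x\<^sup>2"
  shows "A * sqrt (8 * \<delta> * lg) + (2 * A + 1) * lg / x\<^sup>2 + 4 * x\<^sup>2 * \<delta>\<^sup>2
    \<le> (A * sqrt (8 * C) + (2 * A + 1) + 4 * C\<^sup>2) * (g\<^sup>2 * y * sqrt lg / x)"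
proof -
  define R where "R = g\<^sup>2 * y * sqrt lg / x"
  have g2: "1 \<le> g\<^sup>2" using g by simp
  have l1: "1 \<le> sqrt lg" using l by simp
  have 1: "sqrt (8 * \<delta> * lg) \<le> sqrt (8 * C) * R"
  proof -
    have "sqrt (8 * \<delta> * lg) = sqrt (8 * C) * (sqrt g * y * sqrt lg / x)"
      unfolding \<delta> using x y by (simp add: real_sqrt_mult real_sqrt_divide)
    also have "\<dots> \<le> sqrt (8 * C) * R" unfolding R_def
    proof (intro mult_left_mono divide_right_mono mult_right_mono)
      have "sqrt g \<le> sqrt (g\<^sup>2)" using g self_le_power[of g 2] by (intro real_sqrt_le_mono) auto
      also have "\<dots> = g" using g by simp
      also have "\<dots> \<le> g\<^sup>2" using g self_le_power[of g 2] by auto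
      finally show "sqrt g \<le> g\<^sup>2" .
    qed (use C x y l in auto)
    finally show ?thesis .
  qed
  have 2: "lg / x\<^sup>2 \<le> R"
  proof -
    have "lg / x\<^sup>2 = sqrt lg / x * (sqrt lg / x)" using l x by (simp add: power2_eq_square)
    also have "\<dots> \<le> 1 * (sqrt lg / x)" using lx x l by (intro mult_right_mono) auto
    also have "\<dots> \<le> (g\<^sup>2 * y) * (sqrt lg / x)"
    proof (rule mult_right_mono)
      show "1 \<le> g\<^sup>2 * y" using mult_mono[OF g2 y] by simp
    qed (use x l in auto)
    finally show ?thesis by (simp add: R_def)
  qed
  have 3: "x\<^sup>2 * \<delta>\<^sup>2 \<le> C\<^sup>2 * R"
  proof -
    have "x\<^sup>2 * \<delta>\<^sup>2 = C\<^sup>2 * (g\<^sup>2 * y * (y ^ 3 / x) / x)"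
      unfolding \<delta> using x by (simp add: field_simps eval_nat_numeral)
    also have "\<dots> \<le> C\<^sup>2 * R" unfolding R_def
    proof (intro mult_left_mono divide_right_mono)
      have "y ^ 3 / x \<le> 1" using yx x by simp
      thus "y ^ 3 / x \<le> sqrt lg" using l1 by linarith
    qed (use x y in auto)
    finally show ?thesis .
  qed
  have "A * sqrt (8 * \<delta> * lg) \<le> A * (sqrt (8 * C) * R)" using 1 A by (intro mult_left_mono) auto
  moreover have "(2 * A + 1) * (lg / x\<^sup>2) \<le> (2 * A + 1) * R" using 2 A by (intro mult_left_mono) auto
  moreover have "4 * (x\<^sup>2 * \<delta>\<^sup>2) \<le> 4 * (C\<^sup>2 * R)" using 3 by simp
  ultimately show ?thesis unfolding R_def[symmetric] by (simp add: distrib_right mult.assoc)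
qed

context fbm_sample
begin

lemma \<tau>_eq: assumes "0 < t" shows "\<tau> M B (Phi z) t = t powr H * z"
proof -
  have "Phi z \<le> Phi (x / t powr H) \<longleftrightarrow> z \<le> x / t powr H" for x
    using Phi_strict_mono[of "x / t powr H" z] Phi_mono[of z "x / t powr H"] by force
  hence "{x. Phi z \<le> F M B t x} = {t powr H * z..}"
    using assms by (auto simp: F_eq_Phi field_simps)
  thus ?thesis by (simp add: \<tau>_def quantile_def)
qed

lemma F_emp_eq_dev:
  assumes "1 \<le> n" shows "real n * F_emp B n \<omega> t (t powr H * y) = dev n t y \<omega> + real n * Phi y"
proof -
  have "indicator {y. y \<le> x} b = (of_bool (b \<le> x) :: real)" for x b :: real by (simp add: indicator_def)
  thus ?thesis using assms by (simp add: F_emp_def dev_def hit_def sum_subtractf)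
qed

section \<open>The Bahadur-Kiefer representation\<close>

lemma bahadur_kiefer_eq:
  assumes n: "1 \<le> n" and t: "0 < t" and \<alpha>: "Phi z = \<alpha>"
  shows "bahadur_kiefer M H B n \<omega> t \<alpha> =
    (dev n t z \<omega> + real n * (std_normal_density z * (\<tau>_emp B n \<omega> \<alpha> t / t powr H - z))) / sqrt n"
proof -
  let ?s = "t powr H"
  have s: "0 < ?s" using t by simp
  have f: "f_dens H t (?s * z) * ?s = std_normal_density z"
    using s by (simp add: f_dens_def normal_density_def real_sqrt_mult power_mult_distrib)
  have \<tau>: "\<tau> M B \<alpha> t = ?s * z" unfolding \<alpha>[symmetric] by (rule \<tau>_eq[OF t])
  have "F_emp B n \<omega> t (?s * z) - Phi z = dev n t z \<omega> / n"
    using F_emp_eq_dev[OF n, of \<omega> t z] n by (simp add: field_simps)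
  hence v: "v M B n \<omega> t (?s * z) = sqrt n * (dev n t z \<omega> / n)"
    using t by (simp add: v_def F_eq_Phi)
  have u: "f_dens H t (?s * z) * u M B n \<omega> t \<alpha> = sqrt n * (std_normal_density z * (\<tau>_emp B n \<omega> \<alpha> t / ?s - z))"
    unfolding u_def \<tau> f[symmetric] using s by (simp add: field_simps)
  have q: "sqrt n = n / sqrt n" using n by (simp add: real_div_sqrt)
  have "bahadur_kiefer M H B n \<omega> t \<alpha> = sqrt n * (dev n t z \<omega> / n + std_normal_density z * (\<tau>_emp B n \<omega> \<alpha> t / ?s - z))"
    unfolding bahadur_kiefer_def \<tau> v u by (simp add: distrib_left)
  also have "\<dots> = (n / sqrt n) * (dev n t z \<omega> / n + std_normal_density z * (\<tau>_emp B n \<omega> \<alpha> t / ?s - z))"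
    using q by simp
  also have "\<dots> = (n * (dev n t z \<omega> / n + std_normal_density z * (\<tau>_emp B n \<omega> \<alpha> t / ?s - z))) / sqrt n"
    by simp
  also have "n * (dev n t z \<omega> / n + std_normal_density z * (\<tau>_emp B n \<omega> \<alpha> t / ?s - z))
      = dev n t z \<omega> + n * (std_normal_density z * (\<tau>_emp B n \<omega> \<alpha> t / ?s - z))"
    using n by (simp add: distrib_left)
  finally show ?thesis .
qed

text \<open>
  A deterministic statement about one sample. As \<open>\<Phi>\<close> grows at least with the slope \<open>\<phi>(Z)\<close> on
  \<open>[-Z, Z]\<close>, the hypothesis on the size of \<open>dev\<close> prevents the empirical quantile from lying outside
  \<open>[z - \<delta>, z + \<delta>]\<close>. The hypothesis on its oscillation then compares the values of \<open>dev\<close> at \<open>z\<close> and next to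
  the empirical quantile.
\<close>

lemma bahadur_kiefer_bound:
  assumes n: "1 \<le> n" and t: "0 < t" and \<alpha>: "0 < \<alpha>" "\<alpha> < 1" "Phi z = \<alpha>" and z: "\<bar>z\<bar> \<le> Z - 2"
    and \<delta>: "0 < \<delta>" "\<delta> \<le> 1" "1 / real n \<le> \<delta>"
    and dev: "\<And>y. \<bar>y\<bar> \<le> Z \<Longrightarrow> \<bar>dev n t y \<omega>\<bar> < std_normal_density Z * \<delta> * n"
    and osc: "\<And>y. \<bar>z - y\<bar> \<le> 2 * \<delta> \<Longrightarrow> \<bar>dev n t z \<omega> - dev n t y \<omega>\<bar> \<le> \<Omega>"
  shows "\<bar>bahadur_kiefer M H B n \<omega> t \<alpha>\<bar> \<le> (\<Omega> + 1) / sqrt n + 4 * sqrt n * \<delta>\<^sup>2"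
proof -
  define s where "s = t powr H"
  have s: "0 < s" using t by (simp add: s_def)
  define q where "q = \<tau>_emp B n \<omega> \<alpha> t / s"
  define p where "p = std_normal_density z"
  have p: "0 \<le> p" "p \<le> 1" by (auto simp: p_def std_normal_density_le_1)
  have n0: "0 < real n" using n by simp
  have ninv: "0 < 1 / real n" using n0 by simp
  have below: "dev n t y \<omega> + real n * Phi y < real n * \<alpha>" if "y < q" for y
  proof -
    have "s * y < quantile (F_emp B n \<omega> t) \<alpha>" using that s by (simp add: q_def \<tau>_emp_def field_simps)
    from less_quantileD[OF F_emp_level_set(2)[OF n \<alpha>(1,2)] this]
    have "real n * F_emp B n \<omega> t (s * y) < real n * \<alpha>" using n0 by (intro mult_strict_left_mono)
    thus ?thesis unfolding s_def F_emp_eq_dev[OF n] .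
  qed
  have above: "real n * \<alpha> \<le> dev n t y \<omega> + real n * Phi y" if "q < y" for y
  proof -
    have "quantile (F_emp B n \<omega> t) \<alpha> < s * y" using that s by (simp add: q_def \<tau>_emp_def field_simps)
    from quantile_lessD[OF F_emp_mono F_emp_level_set(1)[OF n \<alpha>(1,2)] this]
    have "real n * \<alpha> \<le> real n * F_emp B n \<omega> t (s * y)" using n0 by (intro mult_left_mono) auto
    thus ?thesis unfolding s_def F_emp_eq_dev[OF n] .
  qed
  have "q \<le> z + \<delta>"
  proof (rule ccontr)
    assume "\<not> q \<le> z + \<delta>"
    hence "dev n t (z + \<delta>) \<omega> + real n * Phi (z + \<delta>) < real n * \<alpha>" by (intro below) simp
    moreover have "std_normal_density Z * \<delta> \<le> Phi (z + \<delta>) - \<alpha>"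
      using Phi_increase_lower[of z "z + \<delta>" Z] z \<delta> \<alpha> by (simp add: abs_le_iff)
    hence "real n * (std_normal_density Z * \<delta>) \<le> real n * (Phi (z + \<delta>) - \<alpha>)" by (intro mult_left_mono) auto
    moreover have "\<bar>dev n t (z + \<delta>) \<omega>\<bar> < std_normal_density Z * \<delta> * n" using z \<delta> by (intro dev) (simp add: abs_le_iff)
    ultimately show False by (simp add: right_diff_distrib mult.commute)
  qed
  moreover have "z - \<delta> \<le> q"
  proof (rule ccontr)
    assume "\<not> z - \<delta> \<le> q"
    hence "real n * \<alpha> \<le> dev n t (z - \<delta>) \<omega> + real n * Phi (z - \<delta>)" by (intro above) simp
    moreover have "std_normal_density Z * \<delta> \<le> \<alpha> - Phi (z - \<delta>)"
      using Phi_increase_lower[of "z - \<delta>" z Z] z \<delta> \<alpha> by (simp add: abs_le_iff)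
    hence "real n * (std_normal_density Z * \<delta>) \<le> real n * (\<alpha> - Phi (z - \<delta>))" by (intro mult_left_mono) auto
    moreover have "\<bar>dev n t (z - \<delta>) \<omega>\<bar> < std_normal_density Z * \<delta> * n" using z \<delta> by (intro dev) (simp add: abs_le_iff)
    ultimately show False by (simp add: right_diff_distrib mult.commute)
  qed
  ultimately have q: "\<bar>q - z\<bar> \<le> \<delta>" by (simp add: abs_le_iff)
  have taylor: "\<bar>real n * (Phi y - \<alpha>) - real n * (p * (y - z))\<bar> \<le> 4 * real n * \<delta>\<^sup>2" if "\<bar>y - z\<bar> \<le> 2 * \<delta>" for y
  proof -
    have "\<bar>Phi y - \<alpha> - p * (y - z)\<bar> \<le> (y - z)\<^sup>2" using Phi_Taylor[of y z] \<alpha> by (simp add: p_def)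
    also have "\<dots> \<le> (2 * \<delta>)\<^sup>2" using that \<delta> by (intro iffD1[OF abs_le_square_iff]) simp
    finally have "real n * \<bar>Phi y - \<alpha> - p * (y - z)\<bar> \<le> real n * (2 * \<delta>)\<^sup>2" by (intro mult_left_mono) auto
    moreover have "real n * \<bar>Phi y - \<alpha> - p * (y - z)\<bar> = \<bar>real n * (Phi y - \<alpha> - p * (y - z))\<bar>" by (simp add: abs_mult)
    moreover have "real n * (Phi y - \<alpha> - p * (y - z)) = real n * (Phi y - \<alpha>) - real n * (p * (y - z))" by (simp add: right_diff_distrib)
    ultimately show ?thesis by (simp add: power_mult_distrib mult_ac)
  qed
  \<comment> \<open>The empirical distribution function is evaluated at distance \<open>1 / n\<close> from the quantile,
    where monotonicity alone compares it with \<open>\<alpha>\<close>. This costs at most \<open>\<phi>(z) \<le> 1\<close> in \<open>X\<close>.\<close>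
  define X where "X = dev n t z \<omega> + real n * (p * (q - z))"
  have "X \<le> \<Omega> + 1 + 4 * real n * \<delta>\<^sup>2"
  proof -
    define y where "y = q - 1 / real n"
    have y: "y < q" "\<bar>y - z\<bar> \<le> 2 * \<delta>" "\<bar>z - y\<bar> \<le> 2 * \<delta>" 
      unfolding y_def using q \<delta> ninv by linarith+
    have "real n * (p * (y - z)) = real n * (p * (q - z)) - p" using n0 by (simp add: y_def field_simps)
    moreover have "real n * (Phi y - \<alpha>) = real n * Phi y - real n * \<alpha>" by (simp add: right_diff_distrib)
    ultimately show ?thesis using below[OF y(1)] taylor[OF y(2)] osc[OF y(3)] p unfolding X_def by linarith
  qed
  moreover have "- (\<Omega> + 1 + 4 * real n * \<delta>\<^sup>2) \<le> X"
  proof -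
    define y where "y = q + 1 / real n"
    have y: "q < y" "\<bar>y - z\<bar> \<le> 2 * \<delta>" "\<bar>z - y\<bar> \<le> 2 * \<delta>" 
      unfolding y_def using q \<delta> ninv by linarith+
    have "real n * (p * (y - z)) = real n * (p * (q - z)) + p" using n0 by (simp add: y_def field_simps)
    moreover have "real n * (Phi y - \<alpha>) = real n * Phi y - real n * \<alpha>" by (simp add: right_diff_distrib)
    ultimately show ?thesis using above[OF y(1)] taylor[OF y(2)] osc[OF y(3)] p unfolding X_def by linarith
  qed
  ultimately have "\<bar>X\<bar> \<le> \<Omega> + 1 + 4 * real n * \<delta>\<^sup>2" by (simp add: abs_le_iff)
  hence "\<bar>X\<bar> / sqrt n \<le> (\<Omega> + 1 + 4 * real n * \<delta>\<^sup>2) / sqrt n" by (intro divide_right_mono) auto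
  also have "\<dots> = (\<Omega> + 1) / sqrt n + 4 * (real n / sqrt n) * \<delta>\<^sup>2" by (simp add: add_divide_distrib)
  also have "real n / sqrt n = sqrt n" by (simp add: real_div_sqrt)
  finally have "\<bar>X\<bar> / sqrt n \<le> (\<Omega> + 1) / sqrt n + 4 * sqrt n * \<delta>\<^sup>2" .
  moreover have "bahadur_kiefer M H B n \<omega> t \<alpha> = X / sqrt n"
    using bahadur_kiefer_eq[OF n t \<alpha>(3)] by (simp add: X_def p_def q_def s_def)
  ultimately show ?thesis by (simp add: abs_divide)
qed

text \<open>
  The hypothesis on the limit says that \<open>\<gamma>\<^sub>n\<close> eventually exceeds \<open>n\<close> to the power \<open>-1/(2H)\<close>. Therefore times
  \<open>t \<ge> \<gamma>\<^sub>n\<close> are admissible for the comparison with grid values, and the bound for the distance of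
  the quantiles tends to zero.
\<close>

lemma gamma_powr_eventually_ge:
  assumes \<gamma>: "\<And>n. n \<ge> 1 \<Longrightarrow> 0 < \<gamma> n \<and> \<gamma> n \<le> 1"
    and lim: "(\<lambda>n. - ln (\<gamma> n) / ln (real n)) \<longlonglongrightarrow> \<eta>" and \<eta>: "\<eta> < 1 / (2 * H)"
  shows "\<forall>\<^sub>F n in sequentially. real n powr (- 1 / 2) \<le> \<gamma> n powr H"
proof -
  have "\<forall>\<^sub>F n in sequentially. - ln (\<gamma> n) / ln (real n) < 1 / (2 * H)"
    using order_tendstoD(2)[OF lim \<eta>] .
  with eventually_ge_at_top[of 2] show ?thesis
  proof eventually_elim
    fix n :: nat assume n: "2 \<le> n" and l: "- ln (\<gamma> n) / ln (real n) < 1 / (2 * H)"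
    have "0 < ln (real n)" using n by simp
    hence "- ln (\<gamma> n) \<le> 1 / (2 * H) * ln (real n)" using l unfolding pos_divide_less_eq[OF \<open>0 < ln (real n)\<close>] by linarith
    hence "H * (- ln (\<gamma> n)) \<le> H * (1 / (2 * H) * ln (real n))" using H by (intro mult_left_mono) auto
    also have "\<dots> = ln (real n) / 2" using H by simp
    finally have "- (1 / 2) * ln (real n) \<le> H * ln (\<gamma> n)" by simp
    hence "exp (- (1 / 2) * ln (real n)) \<le> exp (H * ln (\<gamma> n))" by simp
    thus "real n powr (- 1 / 2) \<le> \<gamma> n powr H" using n \<gamma>[of n] by (simp add: powr_def)
  qed
qed

end

section \<open>The almost sure rate\<close>

lemma dyadic_block_of:
  assumes "1 \<le> n" defines "m \<equiv> nat \<lceil>log 2 (real n)\<rceil>"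
  shows "n \<le> 2 ^ m" "2 ^ m \<le> 2 * real n" "real m \<le> log 2 (real n) + 1"
proof -
  have l: "0 \<le> log 2 (real n)" using assms by simp
  hence m: "log 2 (real n) \<le> real m" "real m \<le> log 2 (real n) + 1" unfolding m_def by linarith+
  thus "real m \<le> log 2 (real n) + 1" by simp
  have n: "2 powr log 2 (real n) = real n" using assms by simp
  have "2 powr log 2 (real n) \<le> 2 powr real m" using m by (intro powr_mono) auto
  hence "real n \<le> 2 powr real m" unfolding n .
  also have "\<dots> = real (2 ^ m)" by (simp add: powr_realpow)
  finally show "n \<le> 2 ^ m" by (simp only: of_nat_le_iff)
  have "(2::real) ^ m = 2 powr real m" by (simp add: powr_realpow)
  also have "\<dots> \<le> 2 powr (log 2 (real n) + 1)" using m by (intro powr_mono) auto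
  also have "\<dots> = 2 * real n" by (simp add: powr_add n)
  finally show "2 ^ m \<le> 2 * real n" .
qed

theorem theorem3:
  fixes M :: "'a measure" and B :: "nat \<Rightarrow> real \<Rightarrow> 'a \<Rightarrow> real"
    and H \<eta> \<rho> T :: real and \<gamma> :: "nat \<Rightarrow> real"
  assumes "prob_space M"
    and "0 < H" and "H < 1"
    and "iid_processes M B"
    and "\<And>j. sample_continuous_fbm M H (B j)"
    and "\<And>j. modulus_regular M H (B j)"
    and "\<And>n. n \<ge> 1 \<Longrightarrow> 0 < \<gamma> n \<and> \<gamma> n \<le> 1"
    and "(\<lambda>n. - ln (\<gamma> n) / ln (real n)) \<longlonglongrightarrow> \<eta>"
    and "0 \<le> \<eta>" and "\<eta> < 1 / (2 * H)"
    and "0 < \<rho>" and "\<rho> < 1 / 2" and "1 < T"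
  shows "AE \<omega> in M.
     (\<forall>\<^sub>F n in sequentially.
        bdd_above ((\<lambda>(t, \<alpha>). \<bar>bahadur_kiefer M H B n \<omega> t \<alpha>\<bar>) ` ({\<gamma> n..T} \<times> {\<rho>..1 - \<rho>}))) \<and>
     (\<lambda>n. SUP (t, \<alpha>)\<in>{\<gamma> n..T} \<times> {\<rho>..1 - \<rho>}. \<bar>bahadur_kiefer M H B n \<omega> t \<alpha>\<bar>)
       \<in> O(\<lambda>n. real n powr (-1/4) * \<gamma> n powr (-H/2) * ln (ln (real n)) powr (1/4)
              * ln (real n) powr (1/2))"
proof -
  note \<gamma> = assms(7)
  interpret prob_space M by fact
  interpret fbm_sample M B H
    by unfold_locales (use assms in auto)
  obtain Z0 where Z0: "0 < Z0" "\<And>\<alpha>. \<rho> \<le> \<alpha> \<Longrightarrow> \<alpha> \<le> 1 - \<rho> \<Longrightarrow> \<exists>z. \<bar>z\<bar> \<le> Z0 \<and> Phi z = \<alpha>"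
    using Phi_quantile_exists[OF assms(11,12)] by blast
  define T' where "T' = nat \<lceil>T\<rceil>"
  have T': "1 \<le> T'" "T \<le> real T'" using \<open>1 < T\<close> unfolding T'_def by linarith+
  define Z where "Z = nat \<lceil>Z0 + 2\<rceil>"
  have Z: "Z0 \<le> real Z - 2" unfolding Z_def by linarith
  obtain A where A: "0 < A" and good: "AE \<omega> in M. \<forall>\<^sub>F m in sequentially. \<forall>n\<in>{..2 ^ m}. \<forall>t z z'.
    0 < t \<and> t \<le> real T' \<and> (1 / 2) ^ m \<le> t powr H \<and> \<bar>z\<bar> \<le> real Z \<and> \<bar>z'\<bar> \<le> real Z \<longrightarrow>
      t powr (H / 4) * \<bar>dev n t z \<omega>\<bar> \<le> A * sqrt (2 ^ m * ln (real m)) \<and>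
      \<bar>dev n t z \<omega> - dev n t z' \<omega>\<bar> \<le> A * (sqrt (\<bar>z - z'\<bar> * 2 ^ m * m) + m)"
    using dev_bounds[OF T'(1), of Z] by blast
  define c where "c = std_normal_density (real Z)"
  have c: "0 < c" unfolding c_def by (rule normal_density_pos) simp
  \<comment> \<open>The slope \<open>c\<close> times the radius \<open>\<delta>\<close> below has to exceed the bound for \<open>dev\<close>, in which \<open>A\<close> gets a
    factor \<open>2\<close> from the passage from \<open>2\<^sup>m\<close> and \<open>log m\<close> to \<open>n\<close> and \<open>log log n\<close>.\<close>
  define C where "C = (2 * A + 1) / c + 1"
  have "c * C = 2 * A + 1 + c" unfolding C_def distrib_left using c by simp
  hence C: "1 \<le> C" "2 * A < c * C" using A c by (simp_all add: C_def)
  define K where "K = A * sqrt (8 * C) + (2 * A + 1) + 4 * C\<^sup>2"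
  have K: "0 \<le> K" using A C by (simp add: K_def)
  define blk where "blk n = nat \<lceil>log 2 (real n)\<rceil>" for n
  have blk_lim: "filterlim blk sequentially sequentially"
    unfolding blk_def by real_asymp
  define g x y where "g n = \<gamma> n powr (- H / 4)" and "x n = real n powr (1 / 4)" and "y n = ln (ln (real n)) powr (1 / 4)" for n
  define \<delta> where "\<delta> n = C * g n * (y n)\<^sup>2 / (x n)\<^sup>2" for n
  let ?R = "\<lambda>n. real n powr (-1/4) * \<gamma> n powr (-H/2) * ln (ln (real n)) powr (1/4) * ln (real n) powr (1/2)"
  have ev: "\<forall>\<^sub>F n in sequentially. 3 \<le> n \<and> real n powr (- 1 / 2) \<le> \<gamma> n powr H \<and> 1 \<le> ln (ln (real n)) \<and>
      sqrt (ln (real n)) \<le> real n powr (1 / 4) \<and> (ln (ln (real n)) powr (1 / 4)) ^ 3 \<le> real n powr (1 / 4) \<and>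
      log 2 (real n) + 1 \<le> 2 * ln (real n) \<and> ln (2 * ln (real n)) \<le> 2 * ln (ln (real n)) \<and>
      C * (real n powr (1 / 8) * (ln (ln (real n)) powr (1 / 4))\<^sup>2 / (real n powr (1 / 4))\<^sup>2) \<le> 1"
  proof (intro eventually_conj)
    show "\<forall>\<^sub>F n in sequentially. real n powr (- 1 / 2) \<le> \<gamma> n powr H"
      by (rule gamma_powr_eventually_ge[OF \<gamma> assms(8,10)])
    have "(\<lambda>n::nat. real n powr (1 / 8) * (ln (ln (real n)) powr (1 / 4))\<^sup>2 / (real n powr (1 / 4))\<^sup>2) \<longlonglongrightarrow> 0"
      by real_asymp
    hence "(\<lambda>n::nat. C * (real n powr (1 / 8) * (ln (ln (real n)) powr (1 / 4))\<^sup>2 / (real n powr (1 / 4))\<^sup>2)) \<longlonglongrightarrow> 0"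
      by (rule tendsto_mult_right_zero)
    from order_tendstoD(2)[OF this, of 1]
    show "\<forall>\<^sub>F n in sequentially. C * (real n powr (1 / 8) * (ln (ln (real n)) powr (1 / 4))\<^sup>2 / (real n powr (1 / 4))\<^sup>2) \<le> 1"
      by (auto elim!: eventually_mono)
    show "\<forall>\<^sub>F n in sequentially. (3::nat) \<le> n" by (rule eventually_ge_at_top)
    show "\<forall>\<^sub>F n in sequentially. 1 \<le> ln (ln (real n))" by real_asymp
    show "\<forall>\<^sub>F n in sequentially. sqrt (ln (real n)) \<le> real n powr (1 / 4)" by real_asymp
    show "\<forall>\<^sub>F n in sequentially. (ln (ln (real n)) powr (1 / 4)) ^ 3 \<le> real n powr (1 / 4)" by real_asymp
    show "\<forall>\<^sub>F n in sequentially. log 2 (real n) + 1 \<le> 2 * ln (real n)"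
    proof -
      have "\<forall>\<^sub>F n in sequentially. 2 \<le> ln (real n)" by real_asymp
      thus ?thesis
      proof eventually_elim
        fix n :: nat assume n: "2 \<le> ln (real n)"
        have "log 2 (real n) + 1 \<le> ln (real n) / (2 / 3) + 1" unfolding log_def
          using ln2_ge_two_thirds n by (intro add_right_mono divide_left_mono) auto
        also have "\<dots> \<le> 2 * ln (real n)" using n by simp
        finally show "log 2 (real n) + 1 \<le> 2 * ln (real n)" .
      qed
    qed
    show "\<forall>\<^sub>F n in sequentially. ln (2 * ln (real n)) \<le> 2 * ln (ln (real n))" by real_asymp
  qed
  from good show ?thesis
  proof eventually_elim
    fix \<omega>
    assume "\<forall>\<^sub>F m in sequentially. \<forall>n\<in>{..2 ^ m}. \<forall>t z z'.
      0 < t \<and> t \<le> real T' \<and> (1 / 2) ^ m \<le> t powr H \<and> \<bar>z\<bar> \<le> real Z \<and> \<bar>z'\<bar> \<le> real Z \<longrightarrow>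
      t powr (H / 4) * \<bar>dev n t z \<omega>\<bar> \<le> A * sqrt (2 ^ m * ln (real m)) \<and>
      \<bar>dev n t z \<omega> - dev n t z' \<omega>\<bar> \<le> A * (sqrt (\<bar>z - z'\<bar> * 2 ^ m * m) + m)"
    from eventually_compose_filterlim[OF this blk_lim] ev
    have bound: "\<forall>\<^sub>F n in sequentially. 3 \<le> n \<and> (\<forall>t\<in>{\<gamma> n..T}. \<forall>\<alpha>\<in>{\<rho>..1 - \<rho>}. \<bar>bahadur_kiefer M H B n \<omega> t \<alpha>\<bar> \<le> K * ?R n)"
    proof eventually_elim
      fix n :: nat
      assume dev_all: "\<forall>k\<in>{..2 ^ blk n}. \<forall>t z z'.
          0 < t \<and> t \<le> real T' \<and> (1 / 2) ^ blk n \<le> t powr H \<and> \<bar>z\<bar> \<le> real Z \<and> \<bar>z'\<bar> \<le> real Z \<longrightarrow>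
          t powr (H / 4) * \<bar>dev k t z \<omega>\<bar> \<le> A * sqrt (2 ^ blk n * ln (real (blk n))) \<and>
          \<bar>dev k t z \<omega> - dev k t z' \<omega>\<bar> \<le> A * (sqrt (\<bar>z - z'\<bar> * 2 ^ blk n * real (blk n)) + real (blk n))"
        and n: "3 \<le> n \<and> real n powr (- 1 / 2) \<le> \<gamma> n powr H \<and> 1 \<le> ln (ln (real n)) \<and>
          sqrt (ln (real n)) \<le> real n powr (1 / 4) \<and> (ln (ln (real n)) powr (1 / 4)) ^ 3 \<le> real n powr (1 / 4) \<and>
          log 2 (real n) + 1 \<le> 2 * ln (real n) \<and> ln (2 * ln (real n)) \<le> 2 * ln (ln (real n)) \<and>
          C * (real n powr (1 / 8) * (ln (ln (real n)) powr (1 / 4))\<^sup>2 / (real n powr (1 / 4))\<^sup>2) \<le> 1"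
      define lg L m where "lg = ln (real n)" and "L = ln lg" and "m = blk n"
      have n1: "1 \<le> n" and \<gamma>n: "0 < \<gamma> n" "\<gamma> n \<le> 1" using n \<gamma>[of n] by auto
      have n0: "0 < real n" using n1 by simp
      have L: "1 \<le> L" using n by (simp add: L_def lg_def)
      have "exp 1 \<le> real n" using n exp_le by linarith
      hence lg: "1 \<le> lg" using n0 unfolding lg_def by (subst ln_ge_iff) auto
      note blk = dyadic_block_of[OF n1, folded blk_def, folded m_def]
      have m: "real m \<le> 2 * lg" using blk(3) n by (simp add: lg_def)
      have lnm: "ln (real m) \<le> 2 * L"
      proof (cases "m = 0")
        case True thus ?thesis using L by simp
      next
        case False
        hence "ln (real m) \<le> ln (2 * lg)" using m by simp
        thus ?thesis using n by (simp add: L_def lg_def)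
      qed
      have "sqrt lg \<le> x n" "y n ^ 3 \<le> x n" unfolding x_def y_def lg_def using n by blast+
      hence xn: "0 < x n" "(x n)\<^sup>2 = sqrt (real n)" "sqrt lg \<le> x n" and y3: "y n ^ 3 \<le> x n"
        using n0 by (simp_all add: x_def powr_half_sqrt power2_eq_square powr_add[symmetric])
      have yn: "1 \<le> y n" "(y n)\<^sup>2 = sqrt L"
        using L by (simp_all add: y_def L_def lg_def powr_half_sqrt power2_eq_square powr_add[symmetric] ge_one_powr_ge_zero)
      have gn: "1 \<le> g n" "g n \<le> real n powr (1 / 8)"
      proof -
        have "1 powr (- H / 4) \<le> \<gamma> n powr (- H / 4)" using \<gamma>n H by (intro powr_mono2') auto
        thus "1 \<le> g n" by (simp add: g_def)
        have "g n = (\<gamma> n powr H) powr (- 1 / 4)" by (simp add: g_def powr_powr)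
        also have "\<dots> \<le> (real n powr (- 1 / 2)) powr (- 1 / 4)"
          using n n0 by (intro powr_mono2') auto
        also have "\<dots> = real n powr (1 / 8)" by (simp add: powr_powr)
        finally show "g n \<le> real n powr (1 / 8)" .
      qed
      have \<delta>n: "\<delta> n * real n = C * (g n * sqrt (real n * L))"
      proof -
        have "real n / sqrt (real n) = sqrt (real n)" by (rule real_div_sqrt) simp
        hence "\<delta> n * real n = C * g n * sqrt L * sqrt (real n)"
          unfolding \<delta>_def xn yn by (metis times_divide_eq_right times_divide_eq_left)
        thus ?thesis by (simp add: real_sqrt_mult mult_ac)
      qed
      have gL: "1 \<le> g n * sqrt (real n * L)"
      proof -
        have "1 * 1 \<le> real n * L" using n1 L by (intro mult_mono) auto
        hence "1 * 1 \<le> g n * sqrt (real n * L)" using gn by (intro mult_mono) auto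
        thus ?thesis by simp
      qed
      have \<delta>_ge: "1 / real n \<le> \<delta> n"
      proof -
        have "1 * 1 \<le> C * (g n * sqrt (real n * L))" using gL C by (intro mult_mono) auto
        hence "1 \<le> \<delta> n * real n" using \<delta>n by simp
        thus ?thesis using n0 by (simp add: field_simps)
      qed
      have \<delta>_pos: "0 < \<delta> n" using \<delta>_ge n0 by (smt (verit) divide_pos_pos)
      have \<delta>_le: "\<delta> n \<le> 1"
      proof -
        have "\<delta> n = C * (g n * (y n)\<^sup>2 / (x n)\<^sup>2)" by (simp add: \<delta>_def)
        also have "\<dots> \<le> C * (real n powr (1 / 8) * (y n)\<^sup>2 / (x n)\<^sup>2)"
          using gn C by (intro mult_left_mono divide_right_mono mult_right_mono) auto
        also have "\<dots> \<le> 1" using n by (simp add: x_def y_def)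
        finally show ?thesis .
      qed
      have "\<bar>bahadur_kiefer M H B n \<omega> t \<alpha>\<bar> \<le> K * ?R n" if t: "t \<in> {\<gamma> n..T}" and \<alpha>: "\<alpha> \<in> {\<rho>..1 - \<rho>}" for t \<alpha>
      proof -
        obtain z where z: "\<bar>z\<bar> \<le> Z0" "Phi z = \<alpha>" using Z0(2)[of \<alpha>] \<alpha> by auto
        have t0: "0 < t" "t \<le> real T'" using t \<gamma>n T' by auto
        have tH: "(1 / 2) ^ m \<le> t powr H"
        proof -
          have "(1 / 2) ^ m \<le> 1 / real n"
          proof -
            have "real n \<le> real (2 ^ m)" using blk(1) by (rule of_nat_mono)
            thus ?thesis using n0 by (simp add: power_one_over field_simps)
          qed
          also have "\<dots> = real n powr (- 1)" using n0 by (simp add: powr_minus inverse_eq_divide)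
          also have "\<dots> \<le> real n powr (- 1 / 2)" using n1 by (intro powr_mono) auto
          also have "\<dots> \<le> \<gamma> n powr H" using n by blast
          also have "\<dots> \<le> t powr H" using t \<gamma>n H by (intro powr_mono2) auto
          finally show ?thesis .
        qed
        have dv: "t powr (H / 4) * \<bar>dev n t u \<omega>\<bar> \<le> A * sqrt (2 ^ m * ln (real m))"
          "\<bar>dev n t u \<omega> - dev n t w \<omega>\<bar> \<le> A * (sqrt (\<bar>u - w\<bar> * 2 ^ m * m) + m)"
          if "\<bar>u\<bar> \<le> real Z" "\<bar>w\<bar> \<le> real Z" for u w
          using dev_all blk(1) t0 tH that unfolding m_def by blast+
        define \<Omega> where "\<Omega> = A * (sqrt (8 * \<delta> n * lg * real n) + 2 * lg)"
        have "\<bar>bahadur_kiefer M H B n \<omega> t \<alpha>\<bar> \<le> (\<Omega> + 1) / sqrt n + 4 * sqrt n * (\<delta> n)\<^sup>2"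
        proof (rule bahadur_kiefer_bound[where Z="real Z"])
          show "0 < \<alpha>" "\<alpha> < 1" using \<alpha> assms(11) by auto
          show "\<bar>z\<bar> \<le> real Z - 2" using z Z by linarith
          show "\<bar>dev n t w \<omega>\<bar> < std_normal_density (real Z) * \<delta> n * real n" if w: "\<bar>w\<bar> \<le> real Z" for w
          proof -
            have "\<gamma> n powr (H / 4) * \<bar>dev n t w \<omega>\<bar> \<le> t powr (H / 4) * \<bar>dev n t w \<omega>\<bar>"
              using t \<gamma>n H by (intro mult_right_mono powr_mono2) auto
            also have "\<dots> \<le> A * sqrt (2 ^ m * ln (real m))" using dv(1)[OF w w] .
            also have "\<dots> \<le> A * sqrt ((2 * real n) * (2 * L))"
            proof (intro mult_left_mono real_sqrt_le_mono)
              have "2 ^ m * ln (real m) \<le> 2 ^ m * (2 * L)" using lnm by (intro mult_left_mono) auto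
              also have "\<dots> \<le> (2 * real n) * (2 * L)" using blk(2) L by (intro mult_right_mono) auto
              finally show "2 ^ m * ln (real m) \<le> (2 * real n) * (2 * L)" .
            qed (use A in simp)
            also have "\<dots> = 2 * A * sqrt (real n * L)" by (simp add: real_sqrt_mult)
            finally have "g n * (\<gamma> n powr (H / 4) * \<bar>dev n t w \<omega>\<bar>) \<le> g n * (2 * A * sqrt (real n * L))"
              using gn by (intro mult_left_mono) auto
            moreover have "g n * (\<gamma> n powr (H / 4) * \<bar>dev n t w \<omega>\<bar>) = \<bar>dev n t w \<omega>\<bar>"
              using \<gamma>n by (simp add: g_def mult.assoc[symmetric] powr_add[symmetric])
            ultimately have "\<bar>dev n t w \<omega>\<bar> \<le> g n * (2 * A * sqrt (real n * L))" by (simp only:)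
            also have "\<dots> = 2 * A * (g n * sqrt (real n * L))" by (simp only: mult_ac)
            also have "\<dots> < (c * C) * (g n * sqrt (real n * L))" using gL C by (intro mult_strict_right_mono) auto
            also have "\<dots> = c * \<delta> n * real n" using \<delta>n by (simp add: mult.assoc)
            finally show ?thesis by (simp add: c_def)
          qed
          show "\<bar>dev n t z \<omega> - dev n t w \<omega>\<bar> \<le> \<Omega>" if w: "\<bar>z - w\<bar> \<le> 2 * \<delta> n" for w
          proof -
            have "\<bar>z\<bar> \<le> real Z" "\<bar>w\<bar> \<le> real Z" using w z Z \<delta>_le by linarith+
            from dv(2)[OF this] have "\<bar>dev n t z \<omega> - dev n t w \<omega>\<bar> \<le> A * (sqrt (\<bar>z - w\<bar> * 2 ^ m * m) + m)" .
            also have "\<dots> \<le> \<Omega>" unfolding \<Omega>_def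
            proof (intro mult_left_mono add_mono real_sqrt_le_mono m)
              have "\<bar>z - w\<bar> * 2 ^ m * m \<le> (2 * \<delta> n) * (2 * real n) * (2 * lg)"
                using w blk(2) m \<delta>_pos n0 by (intro mult_mono) auto
              thus "\<bar>z - w\<bar> * 2 ^ m * m \<le> 8 * \<delta> n * lg * real n" by (simp add: mult_ac)
            qed (use A in simp)
            finally show ?thesis .
          qed
        qed (use n1 t0 z \<delta>_pos \<delta>_le \<delta>_ge in auto)
        also have "\<dots> \<le> A * sqrt (8 * \<delta> n * lg) + (2 * A + 1) * lg / (x n)\<^sup>2 + 4 * (x n)\<^sup>2 * (\<delta> n)\<^sup>2"
        proof -
          have "(\<Omega> + 1) / sqrt n \<le> (\<Omega> + lg) / sqrt n" using lg by (intro divide_right_mono) auto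
          also have "\<dots> = A * (sqrt (8 * \<delta> n * lg * real n) / sqrt n) + (2 * A + 1) * lg / sqrt n"
            by (simp add: \<Omega>_def add_divide_distrib algebra_simps)
          also have "sqrt (8 * \<delta> n * lg * real n) / sqrt n = sqrt (8 * \<delta> n * lg)"
            using n0 by (simp add: real_sqrt_mult)
          finally show ?thesis unfolding xn by simp
        qed
        also have "\<dots> \<le> K * ((g n)\<^sup>2 * y n * sqrt lg / x n)" unfolding K_def
          by (rule error_terms_le_rate[OF A C(1) xn(1) yn(1) gn(1) lg xn(3) y3 \<delta>_def])
        also have "(g n)\<^sup>2 * y n * sqrt lg / x n = ?R n"
        proof -
          have "(g n)\<^sup>2 = \<gamma> n powr (- H / 2)" by (simp add: g_def power2_eq_square powr_add[symmetric])
          moreover have "real n powr (- 1 / 4) = 1 / x n" by (simp add: x_def powr_minus inverse_eq_divide)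
          moreover have "ln (real n) powr (1 / 2) = sqrt lg" using lg by (simp add: lg_def powr_half_sqrt)
          ultimately show ?thesis by (simp add: y_def)
        qed
        finally show ?thesis .
      qed
      thus "3 \<le> n \<and> (\<forall>t\<in>{\<gamma> n..T}. \<forall>\<alpha>\<in>{\<rho>..1 - \<rho>}. \<bar>bahadur_kiefer M H B n \<omega> t \<alpha>\<bar> \<le> K * ?R n)"
        using n by blast
    qed
    show "(\<forall>\<^sub>F n in sequentially.
        bdd_above ((\<lambda>(t, \<alpha>). \<bar>bahadur_kiefer M H B n \<omega> t \<alpha>\<bar>) ` ({\<gamma> n..T} \<times> {\<rho>..1 - \<rho>}))) \<and>
     (\<lambda>n. SUP (t, \<alpha>)\<in>{\<gamma> n..T} \<times> {\<rho>..1 - \<rho>}. \<bar>bahadur_kiefer M H B n \<omega> t \<alpha>\<bar>) \<in> O(?R)"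
    proof
      show "\<forall>\<^sub>F n in sequentially.
        bdd_above ((\<lambda>(t, \<alpha>). \<bar>bahadur_kiefer M H B n \<omega> t \<alpha>\<bar>) ` ({\<gamma> n..T} \<times> {\<rho>..1 - \<rho>}))"
        using bound by eventually_elim (auto intro!: bdd_aboveI2)
      show "(\<lambda>n. SUP (t, \<alpha>)\<in>{\<gamma> n..T} \<times> {\<rho>..1 - \<rho>}. \<bar>bahadur_kiefer M H B n \<omega> t \<alpha>\<bar>) \<in> O(?R)"
      proof (rule bigoI[of _ K], use bound in eventually_elim)
        fix n assume n: "3 \<le> n \<and> (\<forall>t\<in>{\<gamma> n..T}. \<forall>\<alpha>\<in>{\<rho>..1 - \<rho>}. \<bar>bahadur_kiefer M H B n \<omega> t \<alpha>\<bar> \<le> K * ?R n)"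
        let ?f = "\<lambda>(t, \<alpha>). \<bar>bahadur_kiefer M H B n \<omega> t \<alpha>\<bar>" and ?D = "{\<gamma> n..T} \<times> {\<rho>..1 - \<rho>}"
        have "\<gamma> n \<le> 1" using \<gamma>[of n] n by simp
        hence p: "(T, \<rho>) \<in> ?D" using assms by auto
        hence ne: "?D \<noteq> {}" by blast
        have le: "?f q \<le> K * ?R n" if "q \<in> ?D" for q using n that by auto
        have "(SUP q\<in>?D. ?f q) \<le> K * ?R n" by (rule cSUP_least[OF ne le])
        moreover have "0 \<le> (SUP q\<in>?D. ?f q)"
        proof -
          have "0 \<le> ?f (T, \<rho>)" by simp
          also have "\<dots> \<le> (SUP q\<in>?D. ?f q)" using p le by (intro cSUP_upper) (auto intro!: bdd_aboveI2)
          finally show ?thesis .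
        qed
        moreover have "0 \<le> ?R n" by simp
        ultimately show "norm (SUP q\<in>?D. ?f q) \<le> K * norm (?R n)" by simp
      qed
    qed
  qed
qed

end
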